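(* Assume that $a\in L^2(x_0,\infty)$, $a(pa')'\in L^1(x_0,\infty)$ and $\lim_{x\to\infty}p(x)a'(x)a(x)=0$. Let $\omega\in\mathbb{C}$, $|\omega|=1$. Then for all $z\in\mathbb{C}$ with $\operatorname{Im}z\ne0$ and all $h\in L^2(\mathbb{R}_+)$, the resolvent $R_\omega(z)=(H_\omega-zI)^{-1}$ of the operator $H_\omega$ is given by $$R_\omega(z)h=\gamma_\omega(z)\,\langle h,\varphi_{\bar z}\rangle\,\varphi_z+\mathcal{R}(z)h,$$ where $$\gamma_\omega(z)=-\frac{\tau_+(z)-\omega\,\tau_-(z)}{\sigma_+(z)-\omega\,\sigma_-(z)} .$$
   Context: $\mathbb{R}_+=(0,\infty)$. Standing assumptions: $p\in C^1(\mathbb{R}_+)$ and $q\in C(\mathbb{R}_+)$ are real-valued with finite limits as $x\to0$, and $p(x)>0$ for all $x\ge0$. Fix $x_0>0$ with $q(x)>0$ for $x\ge x_0$; for $x\ge x_0$ put $a(x)=(p(x)q(x))^{-1/4}$, $\xi(x)=\sqrt{q(x)/p(x)}$, $\Xi(x)=\int_{x_0}^x\xi(y)\,dy$, where $a\in C^1([x_0,\infty))$ with $a'$ locally absolutely continuous. Differential expression: $(\mathsf{H}u)(x)=-(p(x)u'(x))'-q(x)u(x)$. Boundary condition with fixed $\alpha\in\mathbb{R}\cup\{\infty\}$: $u'(0)=\alpha u(0)$, understood as $u(0)=0$ if $\alpha=\infty$ (here $u(0),u'(0)$ are limits as $x\to+0$). The maximal operator $H_{\max}$ acts as $H_{\max}u=\mathsf{H}u$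 on the set $\mathcal{D}(H_{\max})$ of all $u$ in the local Sobolev space $\mathbb{H}^2_{\rm loc}(\mathbb{R}_+)$ such that $u\in L^2(\mathbb{R}_+)$, $\mathsf{H}u\in L^2(\mathbb{R}_+)$ and $u$ satisfies the boundary condition. $\langle u,v\rangle=\int_0^\infty u\bar v\,dx$. Under the assumptions of the claim every $u\in\mathcal{D}(H_{\max})$ has asymptotics $u(x)=a(x)\big(s_+e^{i\Xi(x)}+s_-e^{-i\Xi(x)}+o(1)\big)$ as $x\to\infty$ with uniquely determined $s_\pm=s_\pm(u)\in\mathbb{C}$. For $|\omega|=1$, $H_\omega$ is the restriction of $H_{\max}$ to $\mathcal{D}(H_\omega)=\{u\in\mathcal{D}(H_{\max}):s_+(u)=\omega s_-(u)\}$; it is self-adjoint in $L^2(\mathbb{R}_+)$. Regular solutions: for $z\in\mathbb{C}$, $\varphi_z,\theta_z$ are the solutions of $-(pu')'-qu=zu$ on $\mathbb{R}_+$ with, if $\alpha\in\mathbb{R}$: $\varphi_z(0)=1,\ \varphi_z'(0)=\alpha,\ \theta_z(0)=0,\ \theta_z'(0)=-p(0)^{-1}$; if $\alpha=\infty$: $\varphi_z(0)=0,\ \varphi_z'(0)=1,\ \theta_z(0)=p(0)^{-1},\ \theta_z'(0)=0$. Jost solution: $f_z$ is the unique solution of $-(pu')'-qu=zu$ on $\mathbb{R}_+$ with $f_z(x)=a(x)e^{i\Xi(x)}(1+o(1))$ and $f_z'(x)=i\xi(x)a(x)e^{i\Xi(x)}(1+o(1))$ as $x\to\infty$; it exists under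 the assumptions of the claim. The functions $f_z(x)$ and $\overline{f_{\bar z}(x)}$ are linearly independent solutions, and $\sigma_\pm(z),\tau_\pm(z)\in\mathbb{C}$ are defined by $\varphi_z=\sigma_+(z)f_z+\sigma_-(z)\overline{f_{\bar z}}$, $\theta_z=\tau_+(z)f_z+\tau_-(z)\overline{f_{\bar z}}$. One has $|\sigma_+(z)|\ne|\sigma_-(z)|$ for $\operatorname{Im}z\neq0$. Under these assumptions all solutions of the equation are in $L^2(\mathbb{R}_+)$ for every $z\in\mathbb C$. Quasiresolvent: $\mathcal{R}(z)$ is the bounded operator on $L^2(\mathbb{R}_+)$ given by $(\mathcal{R}(z)h)(x)=\theta_z(x)\int_0^x\varphi_z(y)h(y)\,dy+\varphi_z(x)\int_x^\infty\theta_z(y)h(y)\,dy$. *)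

theory Defs
  imports "HOL-Analysis.Analysis" "HOL-Library.Landau_Symbols"
begin

section \<open>Square integrable functions on the half-line\<close>

text \<open>
  Elements of the Hilbert space are represented by functions \<^typ>\<open>real \<Rightarrow> complex\<close>, whose
  values outside the open half-line are irrelevant, and equality in the space is \<open>L2_eq\<close>.
\<close>

abbreviation half_line :: "real measure" where
  "half_line \<equiv> lebesgue_on {0<..}"

definition L2 :: "(real \<Rightarrow> complex) set" where
  "L2 = {h \<in> borel_measurable half_line. integrable half_line (\<lambda>x. (cmod (h x))\<^sup>2)}"

definition L2_eq :: "(real \<Rightarrow> complex) \<Rightarrow> (real \<Rightarrow> complex) \<Rightarrow> bool" where
  "L2_eq u v \<longleftrightarrow> (AE x in half_line. u x = v x)"

definition L2_inner :: "(real \<Rightarrow> complex) \<Rightarrow> (real \<Rightarrow> complex) \<Rightarrow> complex" where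
  "L2_inner u v = (LINT x|half_line. u x * cnj (v x))"

definition L2_norm :: "(real \<Rightarrow> complex) \<Rightarrow> real" where
  "L2_norm u = sqrt (LINT x|half_line. (cmod (u x))\<^sup>2)"

definition L2_loc :: "(real \<Rightarrow> complex) set" where
  "L2_loc = {w \<in> borel_measurable half_line.
     \<forall>a b. 0 < a \<longrightarrow> set_integrable lebesgue {a..b} (\<lambda>x. (cmod (w x))\<^sup>2)}"


section \<open>Absolute continuity and the local Sobolev space\<close>

text \<open>
  The usual epsilon-delta definition; a division is a finite family of nonempty compact
  intervals with pairwise disjoint interiors, and the interval \<open>k\<close> has end points
  \<open>Inf k\<close> and \<open>Sup k\<close>.
\<close>

definition abs_continuous_on :: "real set \<Rightarrow> (real \<Rightarrow> 'a::real_normed_vector) \<Rightarrow> bool" where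
  "abs_continuous_on S f \<longleftrightarrow>
     (\<forall>\<epsilon>>0. \<exists>\<delta>>0. \<forall>\<D> T. \<D> division_of T \<and> T \<subseteq> S \<and> (\<Sum>k\<in>\<D>. Sup k - Inf k) < \<delta>
        \<longrightarrow> (\<Sum>k\<in>\<D>. norm (f (Sup k) - f (Inf k))) < \<epsilon>)"

definition loc_abs_continuous_on :: "real set \<Rightarrow> (real \<Rightarrow> 'a::real_normed_vector) \<Rightarrow> bool" where
  "loc_abs_continuous_on S f \<longleftrightarrow> (\<forall>a b. {a..b} \<subseteq> S \<longrightarrow> abs_continuous_on {a..b} f)"

abbreviation vderiv :: "(real \<Rightarrow> complex) \<Rightarrow> real \<Rightarrow> complex" where
  "vderiv u x \<equiv> vector_derivative u (at x)"

text \<open>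
  Members of the local Sobolev space of order two on the open half-line are represented by
  their continuously differentiable representative; \<open>w\<close> is the second derivative.
\<close>

definition H2_loc :: "(real \<Rightarrow> complex) set" where
  "H2_loc = {u. u C1_differentiable_on {0<..} \<and> loc_abs_continuous_on {0<..} (vderiv u) \<and>
     (\<exists>w\<in>L2_loc. AE x in half_line. (vderiv u has_vector_derivative w x) (at x))}"


section \<open>Unbounded operators and their resolvents\<close>

text \<open>
  A linear operator is given by its domain \<open>D\<close>, consisting of square integrable functions,
  and its action \<open>T\<close>. The resolvent set asks for \<open>T - z\<close> to be a bijection of \<open>D\<close> onto
  the Hilbert space (modulo \<open>L2_eq\<close>) with bounded inverse.
\<close>

definition resolvent_set ::
  "(real \<Rightarrow> complex) set \<Rightarrow> ((real \<Rightarrow> complex) \<Rightarrow> real \<Rightarrow> complex) \<Rightarrow> complex set" where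
  "resolvent_set D T = {z.
     (\<forall>h\<in>L2. \<exists>u\<in>D. L2_eq (\<lambda>x. T u x - z * u x) h \<and>
        (\<forall>v\<in>D. L2_eq (\<lambda>x. T v x - z * v x) h \<longrightarrow> L2_eq v u)) \<and>
     (\<exists>C. \<forall>u\<in>D. L2_norm u \<le> C * L2_norm (\<lambda>x. T u x - z * u x))}"

text \<open>For \<open>z\<close> in the resolvent set the choice is unique up to \<open>L2_eq\<close>.\<close>

definition resolvent ::
  "(real \<Rightarrow> complex) set \<Rightarrow> ((real \<Rightarrow> complex) \<Rightarrow> real \<Rightarrow> complex) \<Rightarrow> complex
     \<Rightarrow> (real \<Rightarrow> complex) \<Rightarrow> real \<Rightarrow> complex" where
  "resolvent D T z h = (SOME u. u \<in> D \<and> L2_eq (\<lambda>x. T u x - z * u x) h)"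


section \<open>The differential expression and its solutions\<close>

definition H_expr :: "(real \<Rightarrow> real) \<Rightarrow> (real \<Rightarrow> real) \<Rightarrow> (real \<Rightarrow> complex) \<Rightarrow> real \<Rightarrow> complex" where
  "H_expr p q u x =
     - vderiv (\<lambda>y. complex_of_real (p y) * vderiv u y) x - complex_of_real (q x) * u x"

definition is_solution ::
  "(real \<Rightarrow> real) \<Rightarrow> (real \<Rightarrow> real) \<Rightarrow> complex \<Rightarrow> (real \<Rightarrow> complex) \<Rightarrow> bool" where
  "is_solution p q z u \<longleftrightarrow>
     (\<forall>x>0. u differentiable (at x) \<and>
        (\<lambda>y. complex_of_real (p y) * vderiv u y) differentiable (at x) \<and>
        H_expr p q u x = z * u x)"

definition initial_values :: "(real \<Rightarrow> complex) \<Rightarrow> complex \<Rightarrow> complex \<Rightarrow> bool" where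
  "initial_values u c d \<longleftrightarrow> (u \<longlongrightarrow> c) (at_right 0) \<and> (vderiv u \<longlongrightarrow> d) (at_right 0)"

text \<open>\<open>Robin \<alpha>\<close> is the condition \<open>u'(0) = \<alpha> u(0)\<close>, \<open>Dirichlet\<close> the case of infinite \<open>\<alpha>\<close>.\<close>

datatype boundary = Robin real | Dirichlet

fun boundary_condition :: "boundary \<Rightarrow> (real \<Rightarrow> complex) \<Rightarrow> bool" where
  "boundary_condition (Robin \<alpha>) u \<longleftrightarrow> (\<exists>c. initial_values u c (complex_of_real \<alpha> * c))"
| "boundary_condition Dirichlet u \<longleftrightarrow> (u \<longlongrightarrow> 0) (at_right 0)"

fun regular_phi ::
  "(real \<Rightarrow> real) \<Rightarrow> (real \<Rightarrow> real) \<Rightarrow> boundary \<Rightarrow> complex \<Rightarrow> (real \<Rightarrow> complex) \<Rightarrow> bool" where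
  "regular_phi p q (Robin \<alpha>) z u \<longleftrightarrow>
     is_solution p q z u \<and> initial_values u 1 (complex_of_real \<alpha>)"
| "regular_phi p q Dirichlet z u \<longleftrightarrow>
     is_solution p q z u \<and> initial_values u 0 1"

fun regular_theta ::
  "(real \<Rightarrow> real) \<Rightarrow> (real \<Rightarrow> real) \<Rightarrow> boundary \<Rightarrow> complex \<Rightarrow> (real \<Rightarrow> complex) \<Rightarrow> bool" where
  "regular_theta p q (Robin \<alpha>) z u \<longleftrightarrow>
     is_solution p q z u \<and> initial_values u 0 (- inverse (complex_of_real (p 0)))"
| "regular_theta p q Dirichlet z u \<longleftrightarrow>
     is_solution p q z u \<and> initial_values u (inverse (complex_of_real (p 0))) 0"


section \<open>Asymptotics at infinity\<close>

definition amp :: "(real \<Rightarrow> real) \<Rightarrow> (real \<Rightarrow> real) \<Rightarrow> real \<Rightarrow> real" where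
  "amp p q x = (p x * q x) powr (- 1 / 4)"

definition xi :: "(real \<Rightarrow> real) \<Rightarrow> (real \<Rightarrow> real) \<Rightarrow> real \<Rightarrow> real" where
  "xi p q x = sqrt (q x / p x)"

definition Xi :: "(real \<Rightarrow> real) \<Rightarrow> (real \<Rightarrow> real) \<Rightarrow> real \<Rightarrow> real \<Rightarrow> real" where
  "Xi p q x0 x = integral {x0..x} (xi p q)"

definition jost_solution ::
  "(real \<Rightarrow> real) \<Rightarrow> (real \<Rightarrow> real) \<Rightarrow> real \<Rightarrow> complex \<Rightarrow> (real \<Rightarrow> complex) \<Rightarrow> bool" where
  "jost_solution p q x0 z f \<longleftrightarrow>
     is_solution p q z f \<and>
     f \<sim>[at_top] (\<lambda>x. complex_of_real (amp p q x) * cis (Xi p q x0 x)) \<and>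
     vderiv f \<sim>[at_top] (\<lambda>x. \<i> * complex_of_real (xi p q x * amp p q x) * cis (Xi p q x0 x))"

definition has_asymptotics ::
  "(real \<Rightarrow> real) \<Rightarrow> (real \<Rightarrow> real) \<Rightarrow> real \<Rightarrow> (real \<Rightarrow> complex) \<Rightarrow> complex \<times> complex \<Rightarrow> bool" where
  "has_asymptotics p q x0 u s \<longleftrightarrow>
     (\<exists>r. (r \<longlongrightarrow> 0) at_top \<and>
        (\<forall>\<^sub>F x in at_top. u x = complex_of_real (amp p q x) *
           (fst s * cis (Xi p q x0 x) + snd s * cis (- Xi p q x0 x) + r x)))"

definition s_plus ::
  "(real \<Rightarrow> real) \<Rightarrow> (real \<Rightarrow> real) \<Rightarrow> real \<Rightarrow> (real \<Rightarrow> complex) \<Rightarrow> complex" where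
  "s_plus p q x0 u = fst (THE s. has_asymptotics p q x0 u s)"

definition s_minus ::
  "(real \<Rightarrow> real) \<Rightarrow> (real \<Rightarrow> real) \<Rightarrow> real \<Rightarrow> (real \<Rightarrow> complex) \<Rightarrow> complex" where
  "s_minus p q x0 u = snd (THE s. has_asymptotics p q x0 u s)"


section \<open>Domains of the operators, and the quasiresolvent\<close>

definition dom_H_max ::
  "(real \<Rightarrow> real) \<Rightarrow> (real \<Rightarrow> real) \<Rightarrow> boundary \<Rightarrow> (real \<Rightarrow> complex) set" where
  "dom_H_max p q \<alpha> = {u \<in> H2_loc. u \<in> L2 \<and> H_expr p q u \<in> L2 \<and> boundary_condition \<alpha> u}"

definition dom_H_omega ::
  "(real \<Rightarrow> real) \<Rightarrow> (real \<Rightarrow> real) \<Rightarrow> real \<Rightarrow> boundary \<Rightarrow> complex \<Rightarrow> (real \<Rightarrow> complex) set" where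
  "dom_H_omega p q x0 \<alpha> \<omega> =
     {u \<in> dom_H_max p q \<alpha>. s_plus p q x0 u = \<omega> * s_minus p q x0 u}"

definition quasiresolvent ::
  "(real \<Rightarrow> complex) \<Rightarrow> (real \<Rightarrow> complex) \<Rightarrow> (real \<Rightarrow> complex) \<Rightarrow> real \<Rightarrow> complex" where
  "quasiresolvent \<phi> \<theta> h x =
     \<theta> x * (LINT y:{0<..<x}|lebesgue. \<phi> y * h y) +
     \<phi> x * (LINT y:{x<..}|lebesgue. \<theta> y * h y)"


section \<open>Hypotheses on the coefficients\<close>

text \<open>
  The value \<open>p 0\<close> stands for the limit of \<open>p\<close> at the origin. At \<open>x0\<close> the amplitude is
  only required to have a one-sided derivative.
\<close>

definition standing_assumptions :: "(real \<Rightarrow> real) \<Rightarrow> (real \<Rightarrow> real) \<Rightarrow> real \<Rightarrow> bool" where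
  "standing_assumptions p q x0 \<longleftrightarrow>
     p C1_differentiable_on {0<..} \<and> (p \<longlongrightarrow> p 0) (at_right 0) \<and> (\<forall>x\<ge>0. p x > 0) \<and>
     continuous_on {0<..} q \<and> (\<exists>l. (q \<longlongrightarrow> l) (at_right 0)) \<and>
     x0 > 0 \<and> (\<forall>x\<ge>x0. q x > 0) \<and>
     (\<exists>a'. (\<forall>x\<ge>x0. (amp p q has_real_derivative a' x) (at x within {x0..})) \<and>
        continuous_on {x0..} a' \<and> loc_abs_continuous_on {x0..} a')"

end

theory Submission
  imports Defs
begin

text \<open>
  Write \<open>W(u, v) = p (u v' - u' v)\<close>. The regular solutions are normalized so that
  \<open>W(\<phi>, \<theta>) = -1\<close>. Variation of constants therefore shows that
  \<open>u = \<theta> A + \<phi> B\<close> with \<open>A' = \<phi> h\<close> and \<open>B' = - \<theta> h\<close> satisfies \<open>(H - z) u = h\<close> almost everywhere; with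
  \<open>A(0) = 0\<close> it satisfies the boundary condition at the origin, whatever the value \<open>K = B(0)\<close> is.
  This is the quasiresolvent plus a multiple of \<open>\<phi>\<close>. All solutions are \<open>O(a)\<close> at infinity and hence
  square integrable, so \<open>A\<close> and \<open>B\<close> have limits, and \<open>u\<close> has the asymptotic coefficients
  \<open>s\<^sub>\<plusminus> = c (\<tau>\<^sub>\<plusminus> + \<gamma> \<sigma>\<^sub>\<plusminus>)\<close>, where \<open>c\<close> is the integral of \<open>\<phi> h\<close> and \<open>\<gamma> c\<close> is the limit of \<open>B\<close>. The
  condition \<open>s\<^sub>+ = \<omega> s\<^sub>-\<close> determines the number \<open>\<gamma>\<close> of the theorem (\<open>green_in_domain\<close>), provided
  \<open>\<sigma>\<^sub>+ \<noteq> \<omega> \<sigma>\<^sub>-\<close>. The latter holds because \<open>W(\<phi>, cnj \<phi>)\<close> vanishes at the origin, has derivative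
  \<open>2 \<i> Im z |\<phi>|\<^sup>2\<close>, and tends to \<open>- 2 \<i> (|\<sigma>\<^sub>+|\<^sup>2 - |\<sigma>\<^sub>-|\<^sup>2)\<close> at infinity (\<open>coefficients_nondegenerate\<close>).

  Uniqueness rests on Lagrange's identity (\<open>lagrange_identity\<close>): two solutions of the
  inhomogeneous equation have the same Wronskian increments with \<open>\<phi>\<close> and \<open>\<theta>\<close>, so by Cramer's rule
  they differ by a combination of \<open>\<phi>\<close> and \<open>\<theta>\<close>. The two conditions, at the origin and at infinity,
  annihilate both coefficients (\<open>green_unique\<close>). The asymptotic coefficients are well defined
  because the phase tends to infinity: where \<open>p a' a\<close> is small, \<open>ln (a\<^sup>2) + \<Xi>\<close> is nondecreasing, so a
  bounded phase would keep \<open>a\<close> away from \<open>0\<close>, contradicting its square integrability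
  (\<open>Xi_unbounded\<close>). The inverse is bounded by the Cauchy-Schwarz inequality.

  Elements of the domain have a second derivative only almost everywhere. Two facts about
  Lebesgue integration on the line bridge this gap: an absolutely continuous function is the
  integral of its almost everywhere derivative (\<open>abs_continuous_on_has_integral\<close>), and the
  indefinite integral of an integrable function is differentiable almost everywhere
  (\<open>lebesgue_differentiation\<close>).
\<close>

section \<open>Absolutely continuous functions\<close>

lemma division_of_real_interval:
  fixes T :: "real set"
  assumes "\<D> division_of T" "K \<in> \<D>"
  shows "K = {Inf K..Sup K}" "Inf K \<le> Sup K" "Inf K \<in> T" "Sup K \<in> T"
proof -
  obtain a b where K: "K = cbox a b" "K \<noteq> {}" "K \<subseteq> T"
    using division_ofD(2-4)[OF assms] by metis
  then have "a \<le> b" "Inf K = a" "Sup K = b" by auto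
  with K show "K = {Inf K..Sup K}" "Inf K \<le> Sup K" "Inf K \<in> T" "Sup K \<in> T" by auto
qed

lemma abs_continuous_on_imp_continuous_on:
  assumes "abs_continuous_on {a..b} F"
  shows "continuous_on {a..b} F"
proof (rule continuous_on_iff[THEN iffD2], intro ballI allI impI)
  fix x and e :: real
  assume x: "x \<in> {a..b}" and "0 < e"
  with assms obtain d where "d > 0" and d:
    "\<And>\<D> T. \<D> division_of T \<Longrightarrow> T \<subseteq> {a..b} \<Longrightarrow> (\<Sum>k\<in>\<D>. Sup k - Inf k) < d
        \<Longrightarrow> (\<Sum>k\<in>\<D>. norm (F (Sup k) - F (Inf k))) < e"
    unfolding abs_continuous_on_def by meson
  have *: "norm (F v - F u) < e" if "u \<in> {a..b}" "v \<in> {a..b}" "u \<le> v" "v - u < d" for u v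
    using d[of "{{u..v}}" "{u..v}"] that division_of_self[of u v] by simp
  have "dist (F y) (F x) < e" if "y \<in> {a..b}" "dist y x < d" for y
  proof (cases "x \<le> y")
    case True
    with *[of x y] x that show ?thesis by (simp add: dist_norm)
  next
    case False
    with *[of y x] x that show ?thesis by (simp add: dist_norm norm_minus_commute)
  qed
  with \<open>d > 0\<close> show "\<exists>d>0. \<forall>y\<in>{a..b}. dist y x < d \<longrightarrow> dist (F y) (F x) < e" by blast
qed

lemma abs_continuous_on_subset:
  "abs_continuous_on S F \<Longrightarrow> T \<subseteq> S \<Longrightarrow> abs_continuous_on T F"
  unfolding abs_continuous_on_def by (meson order_trans)

text \<open>
  All closure properties below come from this criterion: it suffices to dominate the
  increments of \<open>F\<close> by those of \<open>f\<close> and \<open>g\<close>, because the sums over a division add up.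
\<close>

lemma abs_continuous_on_dominated:
  assumes f: "abs_continuous_on S f" and g: "abs_continuous_on S g"
    and M: "0 \<le> M" and le: "\<And>x y. x \<in> S \<Longrightarrow> y \<in> S \<Longrightarrow>
      norm (F x - F y) \<le> M * (norm (f x - f y) + norm (g x - g y))"
  shows "abs_continuous_on S F"
  unfolding abs_continuous_on_def
proof (intro allI impI)
  fix e :: real assume "e > 0"
  define e' where "e' = e / (2 * (M + 1))"
  have e': "e' > 0" using \<open>e > 0\<close> M by (simp add: e'_def)
  obtain d1 where d1: "d1 > 0" "\<And>\<D> T. \<D> division_of T \<Longrightarrow> T \<subseteq> S \<Longrightarrow> (\<Sum>k\<in>\<D>. Sup k - Inf k) < d1
        \<Longrightarrow> (\<Sum>k\<in>\<D>. norm (f (Sup k) - f (Inf k))) < e'"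
    using f e' unfolding abs_continuous_on_def by meson
  obtain d2 where d2: "d2 > 0" "\<And>\<D> T. \<D> division_of T \<Longrightarrow> T \<subseteq> S \<Longrightarrow> (\<Sum>k\<in>\<D>. Sup k - Inf k) < d2
        \<Longrightarrow> (\<Sum>k\<in>\<D>. norm (g (Sup k) - g (Inf k))) < e'"
    using g e' unfolding abs_continuous_on_def by meson
  have "(\<Sum>k\<in>\<D>. norm (F (Sup k) - F (Inf k))) < e"
    if \<D>: "\<D> division_of T" "T \<subseteq> S" "(\<Sum>k\<in>\<D>. Sup k - Inf k) < min d1 d2" for \<D> T
  proof -
    have "(\<Sum>k\<in>\<D>. norm (F (Sup k) - F (Inf k)))
        \<le> (\<Sum>k\<in>\<D>. M * (norm (f (Sup k) - f (Inf k)) + norm (g (Sup k) - g (Inf k))))"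
      using \<D> division_of_real_interval(3,4)[OF \<D>(1)] by (intro sum_mono le) auto
    also have "\<dots> = M * ((\<Sum>k\<in>\<D>. norm (f (Sup k) - f (Inf k))) + (\<Sum>k\<in>\<D>. norm (g (Sup k) - g (Inf k))))"
      by (simp add: sum.distrib distrib_left flip: sum_distrib_left)
    also have "\<dots> \<le> M * (e' + e')"
      using d1(2)[OF \<D>(1,2)] d2(2)[OF \<D>(1,2)] \<D>(3) M by (intro mult_left_mono add_mono) auto
    also have "\<dots> < (M + 1) * (e' + e')"
      using e' by (intro mult_strict_right_mono) auto
    also have "\<dots> = e"
    proof -
      have "c * (e / (2 * c) + e / (2 * c)) = e" if "c > 0" for c
        using that by (simp add: field_simps)
      from this[of "M + 1"] M show ?thesis by (simp add: e'_def)
    qed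
    finally show ?thesis .
  qed
  then show "\<exists>\<delta>>0. \<forall>\<D> T. \<D> division_of T \<and> T \<subseteq> S \<and> (\<Sum>k\<in>\<D>. Sup k - Inf k) < \<delta>
        \<longrightarrow> (\<Sum>k\<in>\<D>. norm (F (Sup k) - F (Inf k))) < e"
    using d1(1) d2(1) by (intro exI[of _ "min d1 d2"]) auto
qed

lemma abs_continuous_on_cong:
  "(\<And>x. x \<in> S \<Longrightarrow> F x = G x) \<Longrightarrow> abs_continuous_on S F \<Longrightarrow> abs_continuous_on S G"
  by (rule abs_continuous_on_dominated[of S F F 1]) auto

lemma abs_continuous_on_add:
  assumes "abs_continuous_on S f" "abs_continuous_on S g"
  shows "abs_continuous_on S (\<lambda>x. f x + g x)"
  by (rule abs_continuous_on_dominated[OF assms, of 1])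
     (simp_all add: add_diff_add norm_triangle_ineq)

lemma abs_continuous_on_diff:
  assumes "abs_continuous_on S f" "abs_continuous_on S g"
  shows "abs_continuous_on S (\<lambda>x. f x - g x)"
proof (rule abs_continuous_on_dominated[OF assms, of 1])
  fix x y
  show "norm (f x - g x - (f y - g y)) \<le> 1 * (norm (f x - f y) + norm (g x - g y))"
    using norm_triangle_ineq4[of "f x - f y" "g x - g y"] by (simp add: algebra_simps)
qed auto

lemma abs_continuous_on_mult:
  fixes f g :: "real \<Rightarrow> 'a::real_normed_algebra"
  assumes f: "abs_continuous_on {a..b} f" and g: "abs_continuous_on {a..b} g"
  shows "abs_continuous_on {a..b} (\<lambda>x. f x * g x)"
proof -
  have "bounded (f ` {a..b})" "bounded (g ` {a..b})"
    using f g by (auto intro!: compact_imp_bounded compact_continuous_image abs_continuous_on_imp_continuous_on)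
  then obtain A B where A: "\<And>x. x \<in> {a..b} \<Longrightarrow> norm (f x) \<le> A" and B: "\<And>x. x \<in> {a..b} \<Longrightarrow> norm (g x) \<le> B"
    unfolding bounded_iff by blast
  show ?thesis
  proof (rule abs_continuous_on_dominated[OF f g, of "max 0 (max A B)"])
    fix x y assume xy: "x \<in> {a..b}" "y \<in> {a..b}"
    have "f x * g x - f y * g y = (f x - f y) * g x + f y * (g x - g y)"
      by (simp add: algebra_simps)
    also have "norm \<dots> \<le> norm (f x - f y) * norm (g x) + norm (f y) * norm (g x - g y)"
      by (intro order_trans[OF norm_triangle_ineq] add_mono norm_mult_ineq)
    also have "\<dots> \<le> norm (f x - f y) * max 0 (max A B) + max 0 (max A B) * norm (g x - g y)"
      using A[OF xy(2)] B[OF xy(1)] by (intro add_mono mult_left_mono mult_right_mono) auto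
    finally show "norm (f x * g x - f y * g y) \<le> max 0 (max A B) * (norm (f x - f y) + norm (g x - g y))"
      by (simp add: algebra_simps)
  qed auto
qed

lemma abs_continuous_on_const: "abs_continuous_on S (\<lambda>x. c :: complex)"
  by (simp add: abs_continuous_on_def exI[of _ "1::real"])

lemma abs_continuous_on_ident: "abs_continuous_on S (\<lambda>x::real. x)"
  unfolding abs_continuous_on_def
proof (intro allI impI exI conjI)
  fix e :: real and \<D> T assume "e > 0" 
  then show "e > 0" .
  assume *: "\<D> division_of T \<and> T \<subseteq> S \<and> (\<Sum>k\<in>\<D>. Sup k - Inf k) < e"
  have "(\<Sum>k\<in>\<D>. norm (Sup k - Inf k)) = (\<Sum>k\<in>\<D>. Sup k - Inf k)"
    using * division_of_real_interval(2)[of \<D> T] by (intro sum.cong) auto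
  with * show "(\<Sum>k\<in>\<D>. norm (Sup k - Inf k)) < e" by simp
qed

lemma C1_imp_abs_continuous_on:
  fixes F :: "real \<Rightarrow> 'a::euclidean_space"
  assumes F: "\<And>x. x \<in> {a..b} \<Longrightarrow> (F has_vector_derivative G x) (at x)"
    and G: "continuous_on {a..b} G"
  shows "abs_continuous_on {a..b} F"
proof -
  have "bounded (G ` {a..b})"
    using G by (intro compact_imp_bounded compact_continuous_image) auto
  then obtain M where M: "\<And>x. x \<in> {a..b} \<Longrightarrow> norm (G x) \<le> M"
    unfolding bounded_iff by blast
  show ?thesis
  proof (rule abs_continuous_on_dominated[OF abs_continuous_on_ident abs_continuous_on_ident, of "max 0 M"])
    fix x y assume xy: "x \<in> {a..b}" "y \<in> {a..b}"
    have "norm (F x - F y) \<le> max 0 M * norm (x - y)"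
    proof (rule differentiable_bound[of "{a..b}" F "\<lambda>x h. h *\<^sub>R G x"])
      show "\<And>x. x \<in> {a..b} \<Longrightarrow> (F has_derivative (\<lambda>h. h *\<^sub>R G x)) (at x within {a..b})"
        using F has_derivative_at_withinI unfolding has_vector_derivative_def by blast
      show "onorm (\<lambda>h. h *\<^sub>R G x) \<le> max 0 M" if "x \<in> {a..b}" for x
        using M[OF that] by (intro onorm_bound) (auto simp: mult.commute mult_left_mono)
    qed (use xy in auto)
    also have "\<dots> \<le> max 0 M * (norm (x - y) + norm (x - y))"
      by (intro mult_left_mono) auto
    finally show "norm (F x - F y) \<le> max 0 M * (norm (x - y) + norm (x - y))" .
  qed auto
qed

section \<open>The fundamental theorem for absolutely continuous functions\<close>

text \<open>
  The form in which absolute continuity enters gauge integration. Degenerate intervals may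
  carry several tags, but they have no increment, so summing over tagged intervals and summing
  over intervals agree.
\<close>

lemma abs_continuous_on_tagged_partial_division:
  assumes F: "abs_continuous_on {a..b} F" and "e > 0"
  obtains d where "d > 0"
    "\<And>p. p tagged_partial_division_of {a..b} \<Longrightarrow> measure lebesgue (\<Union>(snd ` p)) < d
      \<Longrightarrow> (\<Sum>(x,K)\<in>p. norm (F (Sup K) - F (Inf K))) < e"
proof -
  obtain d where "d > 0" and d:
    "\<And>\<D> T. \<D> division_of T \<Longrightarrow> T \<subseteq> {a..b} \<Longrightarrow> (\<Sum>k\<in>\<D>. Sup k - Inf k) < d
        \<Longrightarrow> (\<Sum>k\<in>\<D>. norm (F (Sup k) - F (Inf k))) < e"
    using assms unfolding abs_continuous_on_def by meson
  have "(\<Sum>(x,K)\<in>p. norm (F (Sup K) - F (Inf K))) < e"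
    if p: "p tagged_partial_division_of {a..b}" and m: "measure lebesgue (\<Union>(snd ` p)) < d" for p
  proof -
    have div: "(snd ` p) division_of \<Union>(snd ` p)"
      using p by (rule partial_division_of_tagged_division)
    have "(\<Sum>K\<in>snd ` p. Sup K - Inf K) = (\<Sum>K\<in>snd ` p. measure lebesgue K)"
    proof (rule sum.cong)
      fix K assume "K \<in> snd ` p"
      then obtain u v where "K = {u..v}" "u \<le> v"
        using division_of_real_interval(1,2)[OF div] by blast
      then show "Sup K - Inf K = measure lebesgue K" by simp
    qed simp
    also have "\<dots> = measure lebesgue (\<Union>(snd ` p))"
      using div by (rule content_division)
    finally have "(\<Sum>K\<in>snd ` p. Sup K - Inf K) < d"
      using m by simp
    moreover have "\<Union>(snd ` p) \<subseteq> {a..b}"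
      using tagged_partial_division_ofD(3)[OF p] by (intro UN_least) (metis prod.collapse)
    ultimately have "(\<Sum>K\<in>snd ` p. norm (F (Sup K) - F (Inf K))) < e"
      by (intro d[OF div])
    moreover have "(\<Sum>(x,K)\<in>p. norm (F (Sup K) - F (Inf K))) = (\<Sum>K\<in>snd ` p. norm (F (Sup K) - F (Inf K)))"
    proof -
      define D where "D K = (if K = {} then 0 else norm (F (Sup K) - F (Inf K)))" for K
      have ne: "K \<noteq> {}" if "(x,K) \<in> p" for x K
        using tagged_partial_division_ofD(2)[OF p that] by auto
      have "(\<Sum>(x,K)\<in>p. norm (F (Sup K) - F (Inf K))) = (\<Sum>(x,K)\<in>p. D K)"
        using ne by (intro sum.cong) (auto simp: D_def)
      also have "\<dots> = (\<Sum>K\<in>snd ` p. D K)"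
        by (rule sum.over_tagged_division_lemma[OF tagged_partial_division_of_Union_self[OF p]])
           (auto simp: D_def)
      also have "\<dots> = (\<Sum>K\<in>snd ` p. norm (F (Sup K) - F (Inf K)))"
        using ne by (intro sum.cong) (auto simp: D_def)
      finally show ?thesis .
    qed
    ultimately show ?thesis by simp
  qed
  with \<open>d > 0\<close> that show thesis by blast
qed

text \<open>
  The exceptional null set \<open>N\<close> is enclosed in an open set \<open>U\<close> of small measure. A gauge that
  confines intervals tagged in \<open>N\<close> to \<open>U\<close> makes their increments small by absolute continuity;
  intervals tagged outside \<open>N\<close> are controlled by the derivative.
\<close>

theorem abs_continuous_on_has_integral:
  fixes F g :: "real \<Rightarrow> 'a::euclidean_space"
  assumes ab: "a \<le> b" and F: "abs_continuous_on {a..b} F" and N: "negligible N"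
    and der: "\<And>x. x \<in> {a..b} - N \<Longrightarrow> (F has_vector_derivative g x) (at x within {a..b})"
  shows "(g has_integral F b - F a) {a..b}"
proof (rule has_integral_spike[OF N])
  define G where "G x = (if x \<in> N then 0 else g x)" for x
  show "g x = G x" if "x \<in> {a..b} - N" for x
    using that by (simp add: G_def)
  show "(G has_integral F b - F a) {a..b}"
    unfolding has_integral_real
  proof (intro allI impI)
    fix e :: real assume "e > 0"
    define \<epsilon> where "\<epsilon> = e / (2 * (b - a + 1))"
    have \<epsilon>: "\<epsilon> > 0" using \<open>e > 0\<close> ab by (simp add: \<epsilon>_def)
    have "\<exists>d>0. \<forall>y\<in>{a..b}. \<bar>y - x\<bar> < d \<longrightarrow> norm (F y - F x - (y - x) *\<^sub>R g x) \<le> \<epsilon> * \<bar>y - x\<bar>"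
      if "x \<in> {a..b} - N" for x
      using der[OF that] \<epsilon> unfolding has_vector_derivative_def has_derivative_within_alt
      by (auto simp: real_norm_def)
    then have "\<forall>x\<in>{a..b} - N. \<exists>d. d > 0 \<and>
        (\<forall>y\<in>{a..b}. \<bar>y - x\<bar> < d \<longrightarrow> norm (F y - F x - (y - x) *\<^sub>R g x) \<le> \<epsilon> * \<bar>y - x\<bar>)"
      by blast
    from bchoice[OF this] obtain d where d: "\<And>x. x \<in> {a..b} - N \<Longrightarrow> d x > 0"
      "\<And>x y. x \<in> {a..b} - N \<Longrightarrow> y \<in> {a..b} \<Longrightarrow> \<bar>y - x\<bar> < d x \<Longrightarrow>
         norm (F y - F x - (y - x) *\<^sub>R g x) \<le> \<epsilon> * \<bar>y - x\<bar>"
      by blast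
    obtain \<delta> where "\<delta> > 0" and \<delta>:
      "\<And>p. p tagged_partial_division_of {a..b} \<Longrightarrow> measure lebesgue (\<Union>(snd ` p)) < \<delta>
        \<Longrightarrow> (\<Sum>(x,K)\<in>p. norm (F (Sup K) - F (Inf K))) < e / 2"
      using abs_continuous_on_tagged_partial_division[OF F, of "e / 2"] \<open>e > 0\<close> by auto
    obtain U where U: "open U" "N \<subseteq> U" "U - N \<in> lmeasurable" "emeasure lebesgue (U - N) < ennreal \<delta>"
      using sets_lebesgue_outer_open[OF negligible_imp_sets[OF N] \<open>\<delta> > 0\<close>] by blast
    have Um: "U \<in> lmeasurable" "measure lebesgue U < \<delta>"
    proof -
      have eq: "U = (U - N) \<union> N" using U(2) by blast
      show "U \<in> lmeasurable"
        using U(3) negligible_imp_measurable[OF N] by (subst eq) (rule fmeasurable.Un)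
      have "measure lebesgue U = measure lebesgue ((U - N) \<union> N)"
        using eq by simp
      also have "\<dots> = measure lebesgue (U - N)"
        by (rule measure_Un_null_set) (use U(3) N in \<open>auto simp: fmeasurableD negligible_iff_null_sets\<close>)
      also have "\<dots> < \<delta>"
        using U(3,4) \<open>\<delta> > 0\<close> by (simp add: emeasure_eq_measure2 ennreal_less_iff)
      finally show "measure lebesgue U < \<delta>" .
    qed
    \<comment> \<open>Tags outside the interval are irrelevant, hence the default value \<open>UNIV\<close>.\<close>
    define \<gamma> where "\<gamma> x = (if x \<in> N then U else if x \<in> {a..b} then ball x (d x) else UNIV)" for x
    have "gauge \<gamma>"
      using U d(1) by (auto simp: gauge_def \<gamma>_def)
    moreover have "norm ((\<Sum>(x,K)\<in>p. measure lborel K *\<^sub>R G x) - (F b - F a)) < e"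
      if p: "p tagged_division_of {a..b}" and fine: "\<gamma> fine p" for p
    proof -
      note pD = tagged_division_ofD[OF p]
      have K: "Inf K \<in> K \<and> Sup K \<in> K" "Inf K \<le> x" "x \<le> Sup K" "a \<le> Inf K" "Sup K \<le> b"
          "measure lborel K = Sup K - Inf K" "K \<subseteq> \<gamma> x" if xK: "(x,K) \<in> p" for x K
      proof -
        obtain u v where "K = cbox u v" using pD(4)[OF xK] by blast
        then have uv: "K = {u..v}" by simp
        moreover have "u \<le> v" using pD(2)[OF xK] uv by simp
        ultimately show "Inf K \<in> K \<and> Sup K \<in> K" "Inf K \<le> x" "x \<le> Sup K" "a \<le> Inf K" "Sup K \<le> b"
          "measure lborel K = Sup K - Inf K"
          using pD(2,3)[OF xK] by auto
        show "K \<subseteq> \<gamma> x" using fine xK by (auto simp: fine_def)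
      qed
      define D where "D = (\<lambda>(x,K). measure lborel K *\<^sub>R G x - (F (Sup K) - F (Inf K)))"
      define p1 p2 where "p1 = {xK\<in>p. fst xK \<notin> N}" and "p2 = {xK\<in>p. fst xK \<in> N}"
      have fin: "finite p1" "finite p2" and pp: "p = p1 \<union> p2" "p1 \<inter> p2 = {}"
        using pD(1) by (auto simp: p1_def p2_def)
      have "(\<Sum>(x,K)\<in>p. measure lborel K *\<^sub>R G x) - (F b - F a) = (\<Sum>xK\<in>p. D xK)"
        unfolding additive_tagged_division_1[OF ab p, of F, symmetric] sum_subtractf[symmetric] D_def
        by (intro sum.cong) auto
      also have "norm \<dots> \<le> (\<Sum>xK\<in>p. norm (D xK))"
        by (rule norm_sum)
      also have "\<dots> = (\<Sum>xK\<in>p1. norm (D xK)) + (\<Sum>xK\<in>p2. norm (D xK))"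
        unfolding pp(1) by (intro sum.union_disjoint fin pp(2))
      also have "\<dots> < e / 2 + e / 2"
      proof (rule add_le_less_mono)
        have "(\<Sum>xK\<in>p1. norm (D xK)) \<le> (\<Sum>(x,K)\<in>p1. \<epsilon> * measure lborel K)"
        proof (intro sum_mono, clarify)
          fix x K assume xK: "(x,K) \<in> p1"
          then have xp: "(x,K) \<in> p" "x \<notin> N" by (auto simp: p1_def)
          note k = K[OF xp(1)]
          have xab: "x \<in> {a..b} - N" using k(2-5) xp by auto
          have "K \<subseteq> ball x (d x)"
            using k(7) xab unfolding \<gamma>_def by (simp split: if_splits)
          with k(1) have "Inf K \<in> ball x (d x)" "Sup K \<in> ball x (d x)"
            by blast+
          then have near: "\<bar>Inf K - x\<bar> < d x" "\<bar>Sup K - x\<bar> < d x"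
            by (auto simp: dist_real_def abs_minus_commute)
          have "D (x,K) = (F (Inf K) - F x - (Inf K - x) *\<^sub>R g x) - (F (Sup K) - F x - (Sup K - x) *\<^sub>R g x)"
            using xp(2) unfolding D_def G_def prod.case k(6) by (simp add: algebra_simps)
          also have "norm \<dots> \<le> \<epsilon> * \<bar>Inf K - x\<bar> + \<epsilon> * \<bar>Sup K - x\<bar>"
            using near k(2-5) by (intro norm_triangle_le_diff add_mono d(2) xab) auto
          also have "\<dots> = \<epsilon> * measure lborel K"
            using k(2,3) unfolding k(6) by (simp add: algebra_simps)
          finally show "norm (D (x,K)) \<le> \<epsilon> * measure lborel K" .
        qed
        also have "\<dots> \<le> (\<Sum>(x,K)\<in>p. \<epsilon> * measure lborel K)"
          using \<epsilon> pD(1) by (intro sum_mono2) (auto simp: p1_def intro!: mult_nonneg_nonneg)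
        also have "\<dots> = \<epsilon> * (b - a)"
          using additive_content_tagged_division[of p a b] p ab
          by (simp add: case_prod_unfold flip: sum_distrib_left)
        also have "\<dots> \<le> \<epsilon> * (b - a + 1)"
          using \<epsilon> by simp
        also have "\<dots> = e / 2"
        proof -
          have "e / (2 * c) * c = e / 2" if "c \<noteq> 0" for c
            using that by simp
          from this[of "b - a + 1"] show ?thesis
            using ab by (simp only: \<epsilon>_def)
        qed
        finally show "(\<Sum>xK\<in>p1. norm (D xK)) \<le> e / 2" .
      next
        have p2: "p2 tagged_partial_division_of {a..b}"
          by (rule tagged_partial_division_subset[of p]) (use p in \<open>auto simp: p2_def tagged_division_of_def\<close>)
        have "measure lebesgue (\<Union>(snd ` p2)) \<le> measure lebesgue U"
        proof (rule measure_mono_fmeasurable)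
          show "\<Union>(snd ` p2) \<subseteq> U"
          proof (rule UN_least)
            fix xK assume "xK \<in> p2"
            then show "snd xK \<subseteq> U"
              using K(7)[of "fst xK" "snd xK"] by (simp add: p2_def \<gamma>_def)
          qed
          show "\<Union>(snd ` p2) \<in> sets lebesgue"
            using lmeasurable_division[OF partial_division_of_tagged_division[OF p2]] by (rule fmeasurableD)
        qed (fact Um)
        with Um(2) have "(\<Sum>(x,K)\<in>p2. norm (F (Sup K) - F (Inf K))) < e / 2"
          by (intro \<delta> p2) (rule le_less_trans)
        also have "(\<Sum>(x,K)\<in>p2. norm (F (Sup K) - F (Inf K))) = (\<Sum>xK\<in>p2. norm (D xK))"
          by (intro sum.cong) (auto simp: D_def p2_def G_def norm_minus_commute)
        finally show "(\<Sum>xK\<in>p2. norm (D xK)) < e / 2" .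
      qed
      finally show ?thesis by (simp only: field_sum_of_halves)
    qed
    ultimately show "\<exists>\<gamma>. gauge \<gamma> \<and> (\<forall>p. p tagged_division_of {a..b} \<and> \<gamma> fine p \<longrightarrow>
        norm ((\<Sum>(x,K)\<in>p. measure lborel K *\<^sub>R G x) - (F b - F a)) < e)"
      by (intro exI[of _ \<gamma>]) simp
  qed
qed

text \<open>
  A derivative known only almost everywhere is a derivative everywhere as soon as the
  candidate is continuous, since \<open>F\<close> is then the indefinite integral of \<open>g\<close>.
\<close>

lemma abs_continuous_on_C1:
  fixes F g :: "real \<Rightarrow> 'a::euclidean_space"
  assumes F: "abs_continuous_on {a..b} F" and N: "negligible N"
    and der: "\<And>x. x \<in> {a..b} - N \<Longrightarrow> (F has_vector_derivative g x) (at x)"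
    and g: "continuous_on {a..b} g" and x: "a < x" "x < b"
  shows "(F has_vector_derivative g x) (at x)"
proof -
  have F_eq: "F y = integral {a..y} g + F a" if y: "y \<in> {a..b}" for y
  proof -
    have "(g has_integral F y - F a) {a..y}"
    proof (rule abs_continuous_on_has_integral[OF _ _ N])
      show "abs_continuous_on {a..y} F"
        using F by (rule abs_continuous_on_subset) (use y in auto)
      show "(F has_vector_derivative g t) (at t within {a..y})" if "t \<in> {a..y} - N" for t
        by (rule has_vector_derivative_at_within, rule der) (use that y in auto)
    qed (use y in auto)
    then show ?thesis by (simp add: integral_unique)
  qed
  have "((\<lambda>y. integral {a..y} g) has_vector_derivative g x) (at x within {a..b})"
    using g x by (intro integral_has_vector_derivative) auto
  then have "((\<lambda>y. integral {a..y} g + F a) has_vector_derivative g x) (at x within {a..b})"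
    by (simp add: has_vector_derivative_add_const)
  from has_vector_derivative_transform[OF _ F_eq this]
  have "(F has_vector_derivative g x) (at x within {a..b})"
    using x by simp
  moreover have "at x within {a..b} = at x"
    using x by (simp add: at_within_Icc_at)
  ultimately show ?thesis by simp
qed

section \<open>Differentiation of indefinite integrals\<close>

text \<open>
  Truncation: \<open>g\<close> is the sum of a bounded function, whose integrals are controlled by the total
  length, and of a remainder with small integral.
\<close>

lemma abs_continuous_on_indefinite_integral:
  fixes g :: "real \<Rightarrow> 'a::euclidean_space"
  assumes g: "g absolutely_integrable_on {a..b}"
  shows "abs_continuous_on {a..b} (\<lambda>x. integral {a..x} g)"
  unfolding abs_continuous_on_def
proof (intro allI impI)
  fix e :: real assume "e > 0"
  \<comment> \<open>The part of \<open>norm g\<close> above the level \<open>n\<close>.\<close>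
  define h where "h n x = norm (g x) - min (norm (g x)) (real n)" for n x
  have abs_g: "(\<lambda>x. norm (g x)) absolutely_integrable_on {a..b}"
    using g by (rule absolutely_integrable_norm[unfolded o_def])
  have min_g: "(\<lambda>x. min (norm (g x)) (real n)) absolutely_integrable_on {a..b}" for n
    by (intro absolutely_integrable_min_1 abs_g) simp
  have h_int: "h n integrable_on {a..b}" for n
    unfolding h_def using abs_g min_g by (intro integrable_diff) (auto simp: absolutely_integrable_on_def)
  have "(\<lambda>n. integral {a..b} (h n)) \<longlonglongrightarrow> integral {a..b} (\<lambda>x. 0)"
  proof (rule dominated_convergence(2)[where h = "\<lambda>x. norm (g x)"])
    show "(\<lambda>x. norm (g x)) integrable_on {a..b}"
      using abs_g by (simp add: absolutely_integrable_on_def)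
    show "norm (h n x) \<le> norm (g x)" for n x
      by (auto simp: h_def)
    show "(\<lambda>n. h n x) \<longlonglongrightarrow> 0" for x
    proof (rule tendsto_eventually)
      show "\<forall>\<^sub>F n in sequentially. h n x = 0"
        using eventually_ge_at_top[of "nat \<lceil>norm (g x)\<rceil>"]
        by eventually_elim (auto simp: h_def min_def nat_ceiling_le_eq)
    qed
  qed (fact h_int)
  then have "\<forall>\<^sub>F n in sequentially. integral {a..b} (h n) < e / 2"
    using \<open>e > 0\<close> by (intro order_tendstoD(2)) auto
  then obtain n where n: "integral {a..b} (h n) < e / 2"
    by (meson eventually_sequentially order_refl)
  have "(\<Sum>k\<in>\<D>. norm (integral {a..Sup k} g - integral {a..Inf k} g)) < e"
    if \<D>: "\<D> division_of T" "T \<subseteq> {a..b}" "(\<Sum>k\<in>\<D>. Sup k - Inf k) < e / (2 * (real n + 1))" for \<D> T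
  proof -
    have bound: "norm (integral {a..Sup k} g - integral {a..Inf k} g) \<le> integral k (h n) + real n * (Sup k - Inf k)"
      and h_on: "h n integrable_on k" if k_in: "k \<in> \<D>" for k
    proof -
      obtain u v where k: "k = {u..v}" "u \<le> v" "a \<le> u" "v \<le> b" "Inf k = u" "Sup k = v"
      proof
        show "k = {Inf k..Sup k}" "Inf k \<le> Sup k" "a \<le> Inf k" "Sup k \<le> b"
          using division_of_real_interval[OF \<D>(1) k_in] \<D>(2) by auto
      qed auto
      have gi: "g integrable_on {a..b}"
        using g by (simp add: absolutely_integrable_on_def)
      have sub: "f integrable_on {u..v}" if "f integrable_on {a..b}" for f :: "real \<Rightarrow> 'b::banach"
        using that k by (auto intro: integrable_subinterval_real)
      show "h n integrable_on k"
        using sub[OF h_int] k by simp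
      have "integral {a..u} g + integral {u..v} g = integral {a..v} g"
        using k gi by (intro Henstock_Kurzweil_Integration.integral_combine integrable_subinterval_real[OF gi]) auto
      then have "integral {a..v} g - integral {a..u} g = integral {u..v} g"
        by (metis add_diff_cancel_left')
      then have "norm (integral {a..v} g - integral {a..u} g) = norm (integral {u..v} g)"
        by simp
      also have "\<dots> \<le> integral {u..v} (\<lambda>x. h n x + real n)"
      proof (rule integral_norm_bound_integral)
        show "(\<lambda>x. h n x + real n) integrable_on {u..v}"
          by (intro integrable_add sub[OF h_int] integrable_const_ivl)
        show "norm (g x) \<le> h n x + real n" for x
          by (simp add: h_def)
      qed (rule sub[OF gi])
      also have "\<dots> = integral {u..v} (h n) + real n * (v - u)"
        using sub[OF h_int] k by (subst integral_add) auto
      finally show "norm (integral {a..Sup k} g - integral {a..Inf k} g) \<le> integral k (h n) + real n * (Sup k - Inf k)"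
        using k by simp
    qed
    have "(\<Sum>k\<in>\<D>. norm (integral {a..Sup k} g - integral {a..Inf k} g))
        \<le> (\<Sum>k\<in>\<D>. integral k (h n)) + real n * (\<Sum>k\<in>\<D>. Sup k - Inf k)"
      using bound by (simp add: sum_mono sum_distrib_left flip: sum.distrib)
    also have "(\<Sum>k\<in>\<D>. integral k (h n)) = integral T (h n)"
      using integral_combine_division_bottomup[OF \<D>(1) h_on] by simp
    also have "integral T (h n) \<le> integral {a..b} (h n)"
    proof (rule integral_subset_le[OF \<D>(2) _ h_int])
      show "h n integrable_on T"
        using integrable_combine_division[OF \<D>(1) h_on] .
    qed (simp add: h_def)
    also have "real n * (\<Sum>k\<in>\<D>. Sup k - Inf k) \<le> real n * (e / (2 * (real n + 1)))"
      using \<D>(3) by (intro mult_left_mono) auto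
    also have "\<dots> \<le> e / 2"
      using \<open>e > 0\<close> by (simp add: field_simps)
    finally show ?thesis
      using n by simp
  qed
  then show "\<exists>\<delta>>0. \<forall>\<D> T. \<D> division_of T \<and> T \<subseteq> {a..b} \<and> (\<Sum>k\<in>\<D>. Sup k - Inf k) < \<delta>
        \<longrightarrow> (\<Sum>k\<in>\<D>. norm (integral {a..Sup k} g - integral {a..Inf k} g)) < e"
    using \<open>e > 0\<close> by (intro exI[of _ "e / (2 * (real n + 1))"]) auto
qed

text \<open>
  If the difference quotients of the indefinite integral at \<open>x\<close> do not tend to \<open>g x\<close>, then
  arbitrarily short intervals at \<open>x\<close> violate the estimate of Henstock's lemma by a fixed
  multiple of their length. Vitali's theorem extracts a disjoint family of such intervals
  covering almost all bad points, and Henstock's lemma bounds their total length.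
\<close>

theorem lebesgue_differentiation:
  fixes g :: "real \<Rightarrow> 'a::euclidean_space"
  assumes g: "g integrable_on {a..b}"
  obtains N where "negligible N"
    "\<And>x. x \<in> {a<..<b} - N \<Longrightarrow> ((\<lambda>x. integral {a..x} g) has_vector_derivative g x) (at x)"
proof -
  define F where "F x = integral {a..x} g" for x
  define bad where "bad \<epsilon> x y \<longleftrightarrow> y \<in> {a..b} \<and> y \<noteq> x \<and> \<epsilon> * \<bar>y - x\<bar> < norm (F y - F x - (y - x) *\<^sub>R g x)" for \<epsilon> x y
  define E where "E \<epsilon> = {x \<in> {a..b}. \<forall>d>0. \<exists>y. \<bar>y - x\<bar> < d \<and> bad \<epsilon> x y}" for \<epsilon>
  have F_diff: "F v - F u = integral {u..v} g" if "a \<le> u" "u \<le> v" "v \<le> b" for u v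
  proof -
    have "integral {a..u} g + integral {u..v} g = integral {a..v} g"
      using that by (intro Henstock_Kurzweil_Integration.integral_combine integrable_subinterval_real[OF g]) auto
    then show ?thesis by (simp add: F_def algebra_simps)
  qed
  have negl: "negligible (E \<epsilon>)" if "\<epsilon> > 0" for \<epsilon>
    unfolding negligible_outer_le
  proof (intro allI impI)
    fix e :: real assume "e > 0"
    obtain \<gamma> where \<gamma>: "gauge \<gamma>" and Henstock:
      "\<And>p. p tagged_partial_division_of {a..b} \<Longrightarrow> \<gamma> fine p \<Longrightarrow>
         (\<Sum>(x,K)\<in>p. norm (measure lborel K *\<^sub>R g x - integral K g)) < e * \<epsilon>"
      using Henstock_lemma[of g a b "e * \<epsilon>"] g \<open>e > 0\<close> \<open>\<epsilon> > 0\<close> by auto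
    \<comment> \<open>A bad interval is indexed by its tag \<open>x\<close>, one of its end points, and the other end point \<open>y\<close>; Vitali's theorem sees it as a ball.\<close>
    define J where "J = (\<lambda>(x::real,y). {min x y..max x y})"
    define I where "I = {(x,y). x \<in> {a..b} \<and> bad \<epsilon> x y \<and> J (x,y) \<subseteq> \<gamma> x}"
    define c r where "c = (\<lambda>(x::real,y). (x + y) / 2)" and "r = (\<lambda>(x::real,y). \<bar>y - x\<bar> / 2)"
    have J: "cball (c i) (r i) = J i" for i
      by (cases i) (auto simp: c_def r_def J_def cball_eq_atLeastAtMost min_def max_def field_simps)
    obtain C where C: "countable C" "C \<subseteq> I"
        "pairwise (\<lambda>i j. disjnt (cball (c i) (r i)) (cball (c j) (r j))) C"
        "negligible (E \<epsilon> - (\<Union>i\<in>C. cball (c i) (r i)))"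
    proof (rule Vitali_covering_theorem_cballs[of I r "E \<epsilon>" c])
      show "0 < r i" if "i \<in> I" for i
        using that by (auto simp: I_def r_def bad_def)
      show "\<exists>i. i \<in> I \<and> x \<in> cball (c i) (r i) \<and> r i < d" if x: "x \<in> E \<epsilon>" and "0 < d" for x d
      proof -
        obtain s where s: "s > 0" "ball x s \<subseteq> \<gamma> x"
          using \<gamma> unfolding gauge_def by (meson open_contains_ball)
        obtain y where y: "\<bar>y - x\<bar> < min s d" "bad \<epsilon> x y"
          using x \<open>0 < d\<close> s(1) unfolding E_def by (auto dest: spec[of _ "min s d"])
        have "J (x,y) \<subseteq> ball x s"
          using y(1) by (auto simp: J_def dist_real_def min_def max_def split: if_splits)
        with s(2) y x have "(x,y) \<in> I" "x \<in> J (x,y)" "r (x,y) < d"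
          by (auto simp: I_def E_def J_def r_def)
        then show ?thesis unfolding J by blast
      qed
    qed (rule that; assumption)
    have lm: "J i \<in> lmeasurable" for i
      unfolding J[symmetric] by (rule lmeasurable_cball)
    have bound: "measure lebesgue (\<Union>i\<in>C'. J i) \<le> e" if C': "C' \<subseteq> C" "finite C'" for C'
    proof -
      define p where "p = (\<lambda>i. (fst i, J i)) ` C'"
      have inj: "inj_on (\<lambda>i. (fst i, J i)) C'"
        by (rule inj_onI) (auto simp: J_def min_def max_def split: if_splits)
      have I: "i \<in> I" if "i \<in> C'" for i using that C' C(2) by auto
      have "p tagged_partial_division_of {a..b}"
        unfolding tagged_partial_division_of_def
      proof (intro conjI allI impI; (elim conjE)?)
        show "finite p" using C' by (simp add: p_def)
        fix x K assume "(x, K) \<in> p"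
        then obtain i where i: "i \<in> C'" "x = fst i" "K = J i" by (auto simp: p_def)
        obtain y where y: "i = (x, y)" using i(2) by (cases i) simp
        have "x \<in> {a..b}" "y \<in> {a..b}"
          using I[OF i(1)] by (simp_all add: y I_def bad_def)
        then show "x \<in> K" "K \<subseteq> {a..b}"
          unfolding i(3) y J_def by auto
        show "\<exists>a b. K = cbox a b"
          unfolding i(3) y J_def prod.case box_real(2)[symmetric] by (intro exI) (rule refl)
      next
        fix x1 K1 x2 K2 assume *: "(x1, K1) \<in> p" "(x2, K2) \<in> p" "(x1, K1) \<noteq> (x2, K2)"
        then obtain i j where ij: "i \<in> C'" "j \<in> C'" "K1 = J i" "K2 = J j" "i \<noteq> j"
          by (auto simp: p_def)
        then have "disjnt (J i) (J j)"
          using C(3)[unfolded J] C'(1) by (auto intro: pairwiseD)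
        then have "K1 \<inter> K2 = {}" by (simp add: ij disjnt_def)
        then show "interior K1 \<inter> interior K2 = {}"
          using interior_subset[of K1] interior_subset[of K2] by blast
      qed
      moreover have "\<gamma> fine p"
      proof (rule fineI)
        fix x K assume "(x, K) \<in> p"
        then obtain i where i: "i \<in> C'" "x = fst i" "K = J i" by (auto simp: p_def)
        show "K \<subseteq> \<gamma> x"
          using I[OF i(1)] i(2,3) by (simp add: I_def case_prod_unfold)
      qed
      ultimately have H: "(\<Sum>(x,K)\<in>p. norm (measure lborel K *\<^sub>R g x - integral K g)) < e * \<epsilon>"
        by (rule Henstock)
      have each: "\<epsilon> * measure lebesgue (J i) \<le> norm (measure lborel (J i) *\<^sub>R g (fst i) - integral (J i) g)"
        if i: "i \<in> C'" for i
      proof -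
        obtain x y where xy: "i = (x,y)" by fastforce
        have b: "x \<in> {a..b}" "y \<in> {a..b}" "\<epsilon> * \<bar>y - x\<bar> < norm (F y - F x - (y - x) *\<^sub>R g x)"
          using I[OF i] by (auto simp: xy I_def bad_def)
        show ?thesis
        proof (cases "x \<le> y")
          case True
          with b F_diff[of x y] show ?thesis
            by (simp add: xy J_def min_def max_def norm_minus_commute)
        next
          case False
          have "norm (F y - F x - (y - x) *\<^sub>R g x) = norm ((x - y) *\<^sub>R g x - (F x - F y))"
            by (simp add: algebra_simps)
          with False b F_diff[of y x] show ?thesis
            by (simp add: xy J_def min_def max_def)
        qed
      qed
      have "\<epsilon> * measure lebesgue (\<Union>i\<in>C'. J i) \<le> \<epsilon> * (\<Sum>i\<in>C'. measure lebesgue (J i))"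
        using C' \<open>\<epsilon> > 0\<close> lm by (intro mult_left_mono measure_UNION_le) (simp_all add: fmeasurableD)
      also have "\<dots> \<le> (\<Sum>i\<in>C'. norm (measure lborel (J i) *\<^sub>R g (fst i) - integral (J i) g))"
        unfolding sum_distrib_left by (intro sum_mono each)
      also have "\<dots> = (\<Sum>(x,K)\<in>p. norm (measure lborel K *\<^sub>R g x - integral K g))"
        unfolding p_def by (subst sum.reindex[OF inj]) simp
      finally have "\<epsilon> * measure lebesgue (\<Union>i\<in>C'. J i) \<le> \<epsilon> * e"
        using H by (simp add: mult.commute)
      then show ?thesis
        using \<open>\<epsilon> > 0\<close> by (rule mult_left_le_imp_le)
    qed
    define U where "U = (\<Union>i\<in>C. J i)"
    have U: "U \<in> lmeasurable" "measure lebesgue U \<le> e"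
      unfolding U_def using fmeasurable_UN_bound[OF C(1) lm bound] measure_UN_bound[OF C(1) lm bound] by auto
    have N: "E \<epsilon> - U \<in> null_sets lebesgue"
      using C(4) by (simp add: U_def J negligible_iff_null_sets)
    have "E \<epsilon> \<subseteq> U \<union> (E \<epsilon> - U)" by blast
    moreover have "U \<union> (E \<epsilon> - U) \<in> lmeasurable"
      using U(1) N by (intro fmeasurable.Un) (auto simp: negligible_imp_measurable negligible_iff_null_sets)
    moreover have "measure lebesgue (U \<union> (E \<epsilon> - U)) \<le> e"
      using U N by (subst measure_Un_null_set) (auto simp: fmeasurableD)
    ultimately show "\<exists>T. E \<epsilon> \<subseteq> T \<and> T \<in> lmeasurable \<and> measure lebesgue T \<le> e"
      by (intro exI conjI)
  qed
  show thesis
  proof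
    show "negligible (\<Union>n. E (inverse (real (Suc n))))"
      by (intro negligible_countable_Union countable_image) (auto intro: negl)
    show "((\<lambda>x. integral {a..x} g) has_vector_derivative g x) (at x)"
      if x: "x \<in> {a<..<b} - (\<Union>n. E (inverse (real (Suc n))))" for x
    proof -
      have "\<exists>d>0. \<forall>y. norm (y - x) < d \<longrightarrow> norm (F y - F x - (y - x) *\<^sub>R g x) \<le> e * norm (y - x)"
        if e: "e > 0" for e
      proof -
        obtain n where n: "inverse (real (Suc n)) < e"
          using reals_Archimedean[OF e] by blast
        have "x \<notin> E (inverse (real (Suc n)))" "x \<in> {a..b}"
          using x by auto
        then obtain d where d: "d > 0" "\<And>y. \<bar>y - x\<bar> < d \<Longrightarrow> \<not> bad (inverse (real (Suc n))) x y"
          unfolding E_def by blast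
        \<comment> \<open>The distance to the end points keeps \<open>y\<close> inside the interval of integration.\<close>
        define d' where "d' = min d (min (x - a) (b - x))"
        have "norm (F y - F x - (y - x) *\<^sub>R g x) \<le> e * norm (y - x)" if "norm (y - x) < d'" for y
        proof (cases "y = x")
          case False
          have "y \<in> {a..b}" "\<bar>y - x\<bar> < d"
            using that by (auto simp: d'_def abs_if split: if_splits)
          with d(2)[of y] False have "norm (F y - F x - (y - x) *\<^sub>R g x) \<le> inverse (real (Suc n)) * \<bar>y - x\<bar>"
            unfolding bad_def by (simp add: not_less)
          also have "\<dots> \<le> e * norm (y - x)"
            using n by (simp add: mult_right_mono)
          finally show ?thesis .
        qed simp
        moreover have "d' > 0" using x d(1) by (auto simp: d'_def)
        ultimately show ?thesis by blast
      qed
      then have "(F has_vector_derivative g x) (at x)"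
        unfolding has_vector_derivative_def has_derivative_within_alt
        by (simp add: bounded_linear_scaleR_left)
      then show ?thesis unfolding F_def .
    qed
  qed
qed

section \<open>Square integrable functions\<close>

lemma AE_half_line_iff_negligible:
  "(AE x in half_line. P x) \<longleftrightarrow> (\<exists>N. negligible N \<and> (\<forall>x>0. x \<notin> N \<longrightarrow> P x))"
proof -
  have "(AE x in half_line. P x) \<longleftrightarrow> (AE x in lebesgue. x > 0 \<longrightarrow> P x)"
    by (simp add: AE_restrict_space_iff)
  also have "\<dots> \<longleftrightarrow> (\<exists>N\<in>null_sets lebesgue. {x. \<not> (x > 0 \<longrightarrow> P x)} \<subseteq> N)"
    unfolding eventually_ae_filter by simp
  also have "\<dots> \<longleftrightarrow> (\<exists>N. negligible N \<and> (\<forall>x>0. x \<notin> N \<longrightarrow> P x))"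
    unfolding negligible_iff_null_sets by blast
  finally show ?thesis .
qed

lemma L2_eq_half_line: "(\<And>x. 0 < x \<Longrightarrow> u x = v x) \<Longrightarrow> L2_eq u v"
  unfolding L2_eq_def by (rule AE_I2) simp

lemma integrable_half_line_iff:
  fixes f :: "real \<Rightarrow> 'a::{banach, second_countable_topology}"
  shows "integrable half_line f \<longleftrightarrow> set_integrable lebesgue {0<..} f"
  by (simp add: set_integrable_def integrable_restrict_space)

lemma integral_half_line:
  fixes f :: "real \<Rightarrow> 'a::{banach, second_countable_topology}"
  shows "(LINT x|half_line. f x) = (LINT x:{0<..}|lebesgue. f x)"
  by (simp add: set_lebesgue_integral_def integral_restrict_space)

lemma continuous_on_imp_measurable_half_line:
  "continuous_on {0<..} u \<Longrightarrow> u \<in> borel_measurable half_line"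
  by (rule continuous_imp_measurable_on_sets_lebesgue) auto

lemma L2_measurable: "u \<in> L2 \<Longrightarrow> u \<in> borel_measurable half_line"
  by (simp add: L2_def)

lemma L2_integrable: "u \<in> L2 \<Longrightarrow> integrable half_line (\<lambda>x. (cmod (u x))\<^sup>2)"
  by (simp add: L2_def)

lemma L2_mult_integrable:
  assumes u: "u \<in> L2" and v: "v \<in> L2"
  shows "integrable half_line (\<lambda>x. u x * v x)"
proof (rule Bochner_Integration.integrable_bound)
  show "integrable half_line (\<lambda>x. (cmod (u x))\<^sup>2 + (cmod (v x))\<^sup>2)"
    by (intro Bochner_Integration.integrable_add L2_integrable u v)
  show "(\<lambda>x. u x * v x) \<in> borel_measurable half_line"
    using u v by (intro borel_measurable_times L2_measurable)
  have "s * t \<le> s\<^sup>2 + t\<^sup>2" if "s \<ge> 0" "t \<ge> 0" for s t :: real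
  proof -
    have "0 \<le> (s - t)\<^sup>2" "0 \<le> s * t" using that by auto
    then show ?thesis by (simp add: power2_diff)
  qed
  then show "AE x in half_line. norm (u x * v x) \<le> norm ((cmod (u x))\<^sup>2 + (cmod (v x))\<^sup>2)"
    by (intro always_eventually allI) (simp add: norm_mult)
qed

lemma L2_scale:
  assumes "u \<in> L2"
  shows "(\<lambda>x. c * u x) \<in> L2"
  using assms by (auto simp: L2_def norm_mult power_mult_distrib)

lemma L2_dominated:
  assumes u: "u \<in> borel_measurable half_line" and v: "v \<in> L2" and w: "w \<in> L2"
    and le: "\<And>x. x > 0 \<Longrightarrow> cmod (u x) \<le> cmod (v x) + cmod (w x)"
  shows "u \<in> L2"
  unfolding L2_def
proof (intro CollectI conjI)
  show "integrable half_line (\<lambda>x. (cmod (u x))\<^sup>2)"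
  proof (rule Bochner_Integration.integrable_bound)
    show "integrable half_line (\<lambda>x. 2 * (cmod (v x))\<^sup>2 + 2 * (cmod (w x))\<^sup>2)"
      by (intro Bochner_Integration.integrable_add integrable_mult_right L2_integrable v w)
    show "(\<lambda>x. (cmod (u x))\<^sup>2) \<in> borel_measurable half_line"
      using u by measurable
    show "AE x in half_line. norm ((cmod (u x))\<^sup>2) \<le> norm (2 * (cmod (v x))\<^sup>2 + 2 * (cmod (w x))\<^sup>2)"
    proof (rule AE_I2)
      fix x assume "x \<in> space half_line"
      then have "(cmod (u x))\<^sup>2 \<le> (cmod (v x) + cmod (w x))\<^sup>2"
        using le by (intro power_mono) auto
      also have "\<dots> \<le> 2 * (cmod (v x))\<^sup>2 + 2 * (cmod (w x))\<^sup>2"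
        using sum_squares_bound[of "cmod (v x)" "cmod (w x)"] by (simp add: power2_sum)
      finally show "norm ((cmod (u x))\<^sup>2) \<le> norm (2 * (cmod (v x))\<^sup>2 + 2 * (cmod (w x))\<^sup>2)"
        by simp
    qed
  qed
qed fact

lemma L2_add:
  assumes "u \<in> L2" "v \<in> L2"
  shows "(\<lambda>x. u x + v x) \<in> L2"
  by (rule L2_dominated[OF borel_measurable_add[OF assms[THEN L2_measurable]] assms norm_triangle_ineq])

lemma L2_diff:
  assumes "u \<in> L2" "v \<in> L2"
  shows "(\<lambda>x. u x - v x) \<in> L2"
  by (rule L2_dominated[OF borel_measurable_diff[OF assms[THEN L2_measurable]] assms norm_triangle_ineq4])

text \<open>
  Measurability is inherited because Lebesgue measure is complete.
\<close>

lemma L2_cong_AE: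
  assumes u: "u \<in> L2" and uv: "L2_eq v u"
  shows "v \<in> L2"
proof -
  obtain N where N: "negligible N" "\<And>x. x > 0 \<Longrightarrow> x \<notin> N \<Longrightarrow> v x = u x"
    using uv unfolding L2_eq_def AE_half_line_iff_negligible by blast
  have "u measurable_on {0<..}"
    using L2_measurable[OF u] by (simp add: measurable_on_iff_borel_measurable)
  then have "v measurable_on {0<..}"
    by (rule measurable_on_spike[OF _ N(1)]) (simp add: N(2))
  then have v: "v \<in> borel_measurable half_line"
    by (simp add: measurable_on_iff_borel_measurable)
  have "integrable half_line (\<lambda>x. (cmod (v x))\<^sup>2)"
  proof (rule Bochner_Integration.integrable_bound[OF L2_integrable[OF u]])
    show "(\<lambda>x. (cmod (v x))\<^sup>2) \<in> borel_measurable half_line"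
      using v by measurable
    show "AE x in half_line. norm ((cmod (v x))\<^sup>2) \<le> norm ((cmod (u x))\<^sup>2)"
      using uv unfolding L2_eq_def by eventually_elim simp
  qed
  with v show ?thesis by (simp add: L2_def)
qed

lemma L2_norm_power2: "(L2_norm u)\<^sup>2 = (LINT x|half_line. (cmod (u x))\<^sup>2)"
  unfolding L2_norm_def by simp

lemma L2_norm_nonneg: "0 \<le> L2_norm u"
  unfolding L2_norm_def by simp

lemma L2_norm_mono:
  assumes v: "v \<in> L2" and le: "\<And>x. x > 0 \<Longrightarrow> cmod (u x) \<le> cmod (v x)"
  shows "L2_norm u \<le> L2_norm v"
  unfolding L2_norm_def using le
  by (intro real_sqrt_le_mono integral_mono' L2_integrable v power_mono) auto

lemma L2_norm_scale: "L2_norm (\<lambda>x. c * u x) = cmod c * L2_norm u"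
  unfolding L2_norm_def by (simp add: norm_mult power_mult_distrib real_sqrt_mult)

text \<open>
  The quadratic polynomial \<open>s \<mapsto> \<integral> (|u| - s |v|)\<^sup>2\<close> is nonnegative.
\<close>

lemma Cauchy_Schwarz_L2:
  assumes u: "u \<in> L2" and v: "v \<in> L2"
  shows "(LINT x|half_line. cmod (u x * v x)) \<le> L2_norm u * L2_norm v"
proof -
  define I where "I = (LINT x|half_line. cmod (u x * v x))"
  define F where "F = (L2_norm u)\<^sup>2"
  define G where "G = (L2_norm v)\<^sup>2"
  have int: "integrable half_line (\<lambda>x. cmod (u x * v x))"
    using L2_mult_integrable[OF u v] by (rule integrable_norm)
  have quad: "0 \<le> F - 2 * s * I + s\<^sup>2 * G" for s
  proof -
    have "0 \<le> (LINT x|half_line. (cmod (u x) - s * cmod (v x))\<^sup>2)"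
      by (rule Bochner_Integration.integral_nonneg) simp
    also have "\<dots> = (LINT x|half_line. ((cmod (u x))\<^sup>2 - 2 * s * cmod (u x * v x)) + s\<^sup>2 * (cmod (v x))\<^sup>2)"
      by (rule Bochner_Integration.integral_cong)
         (auto simp: power2_diff norm_mult power_mult_distrib algebra_simps)
    also have "\<dots> = F - 2 * s * I + s\<^sup>2 * G"
    proof -
      have i: "integrable half_line (\<lambda>x. (cmod (u x))\<^sup>2)"
          "integrable half_line (\<lambda>x. 2 * s * cmod (u x * v x))"
          "integrable half_line (\<lambda>x. s\<^sup>2 * (cmod (v x))\<^sup>2)"
        by (intro integrable_mult_right int L2_integrable u v)+
      show ?thesis
        unfolding I_def F_def G_def L2_norm_power2
          Bochner_Integration.integral_add[OF Bochner_Integration.integrable_diff[OF i(1,2)] i(3)]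
          Bochner_Integration.integral_diff[OF i(1,2)] integral_mult_right_zero ..
    qed
    finally show ?thesis .
  qed
  have I0: "0 \<le> I" unfolding I_def by (rule Bochner_Integration.integral_nonneg) simp
  have "I\<^sup>2 \<le> F * G"
  proof (cases "G = 0")
    case True
    have "I = 0"
    proof (rule ccontr)
      assume "I \<noteq> 0"
      then have "2 * ((F + 1) / (2 * I)) * I = F + 1" by simp
      then show False
        using quad[of "(F + 1) / (2 * I)"] by (simp only: True)
    qed
    then show ?thesis by (simp add: True)
  next
    case False
    then have "G > 0" by (simp add: G_def)
    have "0 \<le> F - 2 * (I / G) * I + (I / G)\<^sup>2 * G" by (rule quad)
    also have "\<dots> = F - I\<^sup>2 / G"
      using \<open>G > 0\<close> by (simp add: power2_eq_square)
    finally show ?thesis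
      using \<open>G > 0\<close> by (simp add: field_simps)
  qed
  also have "F * G = (L2_norm u * L2_norm v)\<^sup>2"
    by (simp add: F_def G_def power_mult_distrib)
  finally show ?thesis
    unfolding I_def[symmetric] by (rule power2_le_imp_le) (simp add: L2_norm_nonneg)
qed

lemma L2_set_integral_bound:
  assumes u: "u \<in> L2" and v: "v \<in> L2" and S: "S \<in> sets lebesgue" "S \<subseteq> {0<..}"
  shows "cmod (LINT x:S|lebesgue. u x * v x) \<le> L2_norm u * L2_norm v"
proof -
  have int: "set_integrable lebesgue {0<..} (\<lambda>x. u x * v x)"
    using L2_mult_integrable[OF u v] by (simp add: integrable_half_line_iff)
  have intS: "set_integrable lebesgue S (\<lambda>x. u x * v x)"
    using int S by (rule set_integrable_subset)
  have "cmod (LINT x:S|lebesgue. u x * v x) \<le> (LINT x:S|lebesgue. cmod (u x * v x))"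
    by (rule set_integral_norm_bound[OF intS])
  also have "\<dots> \<le> (LINT x:{0<..}|lebesgue. cmod (u x * v x))"
    unfolding set_lebesgue_integral_def
  proof (rule integral_mono')
    show "integrable lebesgue (\<lambda>x. indicat_real {0<..} x *\<^sub>R cmod (u x * v x))"
      using set_integrable_norm[OF int] unfolding set_integrable_def .
    show "indicat_real S x *\<^sub>R cmod (u x * v x) \<le> indicat_real {0<..} x *\<^sub>R cmod (u x * v x)" for x
      using S(2) by (auto simp: indicator_def)
  qed simp
  also have "\<dots> \<le> L2_norm u * L2_norm v"
    using Cauchy_Schwarz_L2[OF u v] by (simp add: integral_half_line)
  finally show ?thesis .
qed

section \<open>Indefinite integrals on the half-line\<close>

lemma set_integrable_half_line_closed:
  fixes g :: "real \<Rightarrow> complex"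
  assumes g: "set_integrable lebesgue {0<..} g"
  shows "g absolutely_integrable_on {0..b}"
proof -
  have "g absolutely_integrable_on {0<..b}"
    using g by (rule set_integrable_subset) auto
  moreover have "negligible {x \<in> {0<..b} - {0..b}. g x \<noteq> 0}"
    by (rule negligible_subset[of "{}"]) auto
  moreover have "negligible {x \<in> {0..b} - {0<..b}. g x \<noteq> 0}"
    by (rule negligible_subset[of "{0}"]) auto
  ultimately show ?thesis by (rule absolutely_integrable_spike_set)
qed

text \<open>
  The next two lemmas express the integrals in the quasiresolvent through indefinite integrals
  from \<open>0\<close>, for which continuity and differentiation are available.
\<close>

lemma set_integral_below:
  fixes g :: "real \<Rightarrow> complex"
  assumes g: "set_integrable lebesgue {0<..} g"
  shows "(LINT y:{0<..<x}|lebesgue. g y) = integral {0..x} g"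
proof -
  have "set_integrable lebesgue {0<..<x} g"
    using g by (rule set_integrable_subset) auto
  then have "(LINT y:{0<..<x}|lebesgue. g y) = integral {0<..<x} g"
    by (rule set_lebesgue_integral_eq_integral)
  also have "\<dots> = integral {0..x} g"
    by (simp add: integral_open_interval_real)
  finally show ?thesis .
qed

lemma set_integral_above:
  fixes g :: "real \<Rightarrow> complex"
  assumes g: "set_integrable lebesgue {0<..} g" and "x > 0"
  shows "(LINT y:{x<..}|lebesgue. g y) = (LINT y:{0<..}|lebesgue. g y) - integral {0..x} g"
proof -
  have "(LINT y:{0<..}|lebesgue. g y) = (LINT y:{0<..x} \<union> {x<..}|lebesgue. g y)"
    using \<open>x > 0\<close> by (simp add: ivl_disj_un)
  also have "\<dots> = (LINT y:{0<..x}|lebesgue. g y) + (LINT y:{x<..}|lebesgue. g y)"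
    using \<open>x > 0\<close> by (intro set_integral_Un) (auto intro: set_integrable_subset[OF g])
  also have "(LINT y:{0<..x}|lebesgue. g y) = integral {0<..x} g"
    by (intro set_lebesgue_integral_eq_integral) (auto intro: set_integrable_subset[OF g])
  also have "integral {0<..x} g = integral {0..x} g"
  proof (rule integral_spike_set)
    show "negligible {y \<in> {0<..x} - {0..x}. g y \<noteq> 0}"
      by (rule negligible_subset[of "{}"]) auto
    show "negligible {y \<in> {0..x} - {0<..x}. g y \<noteq> 0}"
      by (rule negligible_subset[of "{0}"]) auto
  qed
  finally show ?thesis by simp
qed

lemma integral_tendsto_at_right_0:
  fixes g :: "real \<Rightarrow> complex"
  assumes g: "set_integrable lebesgue {0<..} g"
  shows "((\<lambda>x. integral {0..x} g) \<longlongrightarrow> 0) (at_right 0)"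
proof -
  have "g integrable_on {0..1}"
    using set_integrable_half_line_closed[OF g] set_lebesgue_integral_eq_integral(1) by blast
  then have "continuous_on {0..1} (\<lambda>x. integral {0..x} g)"
    by (rule indefinite_integral_continuous_1)
  from bspec[OF this[unfolded continuous_on_def], of 0]
  have "((\<lambda>x. integral {0..x} g) \<longlongrightarrow> 0) (at 0 within {0..1})"
    by simp
  then show ?thesis
    by (simp add: at_within_Icc_at_right)
qed

lemma integral_tendsto_at_top:
  fixes g :: "real \<Rightarrow> complex"
  assumes g: "set_integrable lebesgue {0<..} g"
  shows "((\<lambda>x. integral {0..x} g) \<longlongrightarrow> (LINT y:{0<..}|lebesgue. g y)) at_top"
  unfolding set_integral_below[OF g, symmetric] unfolding set_lebesgue_integral_def
proof (rule integral_dominated_convergence_at_top)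
  show "integrable lebesgue (\<lambda>y. norm (indicat_real {0<..} y *\<^sub>R g y))"
    using g unfolding set_integrable_def by (rule integrable_norm)
  show "(\<lambda>y. indicat_real {0<..} y *\<^sub>R g y) \<in> borel_measurable lebesgue"
    using g unfolding set_integrable_def by (rule borel_measurable_integrable)
  show "(\<lambda>y. indicat_real {0<..<t} y *\<^sub>R g y) \<in> borel_measurable lebesgue" for t
  proof -
    have "set_integrable lebesgue {0<..<t} g"
      using g by (rule set_integrable_subset) auto
    then show ?thesis unfolding set_integrable_def by (rule borel_measurable_integrable)
  qed
  show "\<forall>\<^sub>F t in at_top. AE y in lebesgue. norm (indicat_real {0<..<t} y *\<^sub>R g y) \<le> norm (indicat_real {0<..} y *\<^sub>R g y)"
    by (intro always_eventually allI AE_I2) (auto simp: indicator_def)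
  show "AE y in lebesgue. ((\<lambda>t. indicat_real {0<..<t} y *\<^sub>R g y) \<longlongrightarrow> indicat_real {0<..} y *\<^sub>R g y) at_top"
  proof (rule AE_I2)
    fix y :: real
    show "((\<lambda>t. indicat_real {0<..<t} y *\<^sub>R g y) \<longlongrightarrow> indicat_real {0<..} y *\<^sub>R g y) at_top"
    proof (rule tendsto_eventually)
      show "\<forall>\<^sub>F t in at_top. indicat_real {0<..<t} y *\<^sub>R g y = indicat_real {0<..} y *\<^sub>R g y"
        using eventually_gt_at_top[of y] by eventually_elim (simp add: indicator_def)
    qed
  qed
qed

lemma integral_abs_continuous_half_line:
  fixes g :: "real \<Rightarrow> complex"
  assumes g: "set_integrable lebesgue {0<..} g" and "0 \<le> a"
  shows "abs_continuous_on {a..b} (\<lambda>x. integral {0..x} g)"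
  using abs_continuous_on_indefinite_integral[OF set_integrable_half_line_closed[OF g]]
  by (rule abs_continuous_on_subset) (use \<open>0 \<le> a\<close> in auto)

lemma integral_half_line_derivative:
  fixes g :: "real \<Rightarrow> complex"
  assumes g: "set_integrable lebesgue {0<..} g"
  obtains N where "negligible N"
    "\<And>x. x > 0 \<Longrightarrow> x \<notin> N \<Longrightarrow> ((\<lambda>x. integral {0..x} g) has_vector_derivative g x) (at x)"
proof -
  have "\<exists>N. negligible N \<and> (\<forall>x\<in>{0<..<real n} - N.
      ((\<lambda>x. integral {0..x} g) has_vector_derivative g x) (at x))" for n
  proof -
    have "g integrable_on {0..real n}"
      using set_integrable_half_line_closed[OF g] set_lebesgue_integral_eq_integral(1) by blast
    then obtain N where "negligible N" "\<And>x. x \<in> {0<..<real n} - N \<Longrightarrow>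
        ((\<lambda>x. integral {0..x} g) has_vector_derivative g x) (at x)"
      by (rule lebesgue_differentiation) (rule that; assumption)
    then show ?thesis by (intro exI[of _ N] conjI ballI)
  qed
  from choice[OF allI[OF this]] obtain N where N0:
      "\<forall>n. negligible (N n) \<and> (\<forall>x\<in>{0<..<real n} - N n.
        ((\<lambda>x. integral {0..x} g) has_vector_derivative g x) (at x))" ..
  have N: "negligible (N n)"
    "x \<in> {0<..<real n} - N n \<Longrightarrow> ((\<lambda>x. integral {0..x} g) has_vector_derivative g x) (at x)" for n x
    using spec[OF N0, of n] by (rule conjunct1) (rule bspec[OF conjunct2[OF spec[OF N0]]])
  show thesis
  proof
    show "negligible (\<Union>n. N n)"
      using N(1) by (intro negligible_countable_Union countable_image) auto
    fix x :: real assume x: "x > 0" "x \<notin> (\<Union>n. N n)"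
    obtain n where "x < real n" using reals_Archimedean2 by blast
    with x N(2)[of x n] show "((\<lambda>x. integral {0..x} g) has_vector_derivative g x) (at x)" by simp
  qed
qed

lemma eventually_at_right_0I:
  assumes "\<And>x::real. 0 < x \<Longrightarrow> P x"
  shows "eventually P (at_right 0)"
  using eventually_at_right_less[of "0::real"] by (rule eventually_mono) (rule assms)

section \<open>The differential expression\<close>

definition wronskian :: "(real \<Rightarrow> real) \<Rightarrow> (real \<Rightarrow> complex) \<Rightarrow> (real \<Rightarrow> complex) \<Rightarrow> real \<Rightarrow> complex" where
  "wronskian p u v x = complex_of_real (p x) * (u x * vderiv v x - vderiv u x * v x)"

locale sturm_liouville =
  fixes p q :: "real \<Rightarrow> real"
  assumes p_C1: "p C1_differentiable_on {0<..}"
    and p_lim: "(p \<longlongrightarrow> p 0) (at_right 0)"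
    and p_pos: "\<And>x. 0 \<le> x \<Longrightarrow> 0 < p x"
    and q_cont: "continuous_on {0<..} q"
begin

definition dp :: "real \<Rightarrow> real" where
  "dp x = vector_derivative p (at x)"

text \<open>
  The quasi-derivative \<open>p u'\<close>, the quantity whose derivative appears in the equation.
\<close>

definition flux :: "(real \<Rightarrow> complex) \<Rightarrow> real \<Rightarrow> complex" where
  "flux u x = complex_of_real (p x) * vderiv u x"

lemma p_nonzero: "0 < x \<Longrightarrow> p x \<noteq> 0"
  using p_pos[of x] by simp

lemma p_derivative: "0 < x \<Longrightarrow> (p has_vector_derivative dp x) (at x)"
  using p_C1 by (simp add: C1_differentiable_on_eq dp_def vector_derivative_works)

lemma dp_cont: "continuous_on {0<..} dp"
  using p_C1 unfolding C1_differentiable_on_eq dp_def[abs_def] by (rule conjunct2)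

lemma of_real_p_derivative:
  "0 < x \<Longrightarrow> ((\<lambda>y. complex_of_real (p y)) has_vector_derivative of_real (dp x)) (at x)"
  by (rule bounded_linear.has_vector_derivative[OF bounded_linear_of_real p_derivative])

lemma p_cont: "continuous_on {0<..} p"
  using p_C1 by (rule C1_differentiable_imp_continuous_on)

lemma inverse_p_derivative:
  assumes "0 < x"
  shows "((\<lambda>y. complex_of_real (inverse (p y))) has_vector_derivative of_real (- dp x * (inverse (p x))\<^sup>2)) (at x)"
proof -
  have "(p has_real_derivative dp x) (at x)"
    using p_derivative[OF assms] by (simp add: has_real_derivative_iff_has_vector_derivative)
  from DERIV_inverse'[OF this p_nonzero[OF assms]]
  have "((\<lambda>y. inverse (p y)) has_vector_derivative (- dp x * (inverse (p x))\<^sup>2)) (at x)"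
    by (simp add: has_real_derivative_iff_has_vector_derivative power2_eq_square mult_ac)
  from bounded_linear.has_vector_derivative[OF bounded_linear_of_real this] show ?thesis .
qed

lemma inverse_p_cont: "continuous_on {0<..} (\<lambda>y. inverse (p y))"
  by (intro continuous_on_inverse p_cont) (auto simp: p_nonzero)

text \<open>
  The equation controls \<open>p u'\<close>; as \<open>p\<close> is differentiable and positive, this is the same as
  controlling \<open>u'\<close>.
\<close>

lemma derivative_from_flux:
  assumes x: "0 < x" and F: "((\<lambda>y. complex_of_real (p y) * g y) has_vector_derivative F) (at x)"
  shows "(g has_vector_derivative (F - of_real (dp x) * g x) * of_real (inverse (p x))) (at x)"
proof -
  have "((\<lambda>y. complex_of_real (p y) * g y * of_real (inverse (p y))) has_vector_derivative
      complex_of_real (p x) * g x * of_real (- dp x * (inverse (p x))\<^sup>2) + F * of_real (inverse (p x))) (at x)"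
    by (rule has_vector_derivative_mult[OF F inverse_p_derivative[OF x]])
  moreover have "complex_of_real (p x) * g x * of_real (- dp x * (inverse (p x))\<^sup>2) + F * of_real (inverse (p x))
      = (F - of_real (dp x) * g x) * of_real (inverse (p x))"
  proof -
    define c i d where "c = complex_of_real (p x)" and "i = complex_of_real (inverse (p x))"
      and "d = complex_of_real (dp x)"
    have "c * i = 1"
      using p_nonzero[OF x] by (simp add: c_def i_def flip: of_real_mult)
    then have "c * g x * (- d * i\<^sup>2) + F * i = (F - d * g x) * i"
      by algebra
    then show ?thesis
      by (simp only: c_def i_def d_def of_real_mult of_real_minus of_real_power)
  qed
  ultimately have "((\<lambda>y. complex_of_real (p y) * g y * of_real (inverse (p y))) has_vector_derivative
      (F - of_real (dp x) * g x) * of_real (inverse (p x))) (at x)"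
    by simp
  then show ?thesis
    by (rule has_vector_derivative_transform_within_open[of _ _ _ "{0<..}"]) (use x p_nonzero in auto)
qed

subsection \<open>Solutions\<close>

lemma solution_derivative:
  assumes "is_solution p q z u" "0 < x"
  shows "(u has_vector_derivative vderiv u x) (at x)"
  using assms by (simp add: is_solution_def vector_derivative_works)

lemma solution_flux_derivative:
  assumes "is_solution p q z u" "0 < x"
  shows "(flux u has_vector_derivative - (of_real (q x) + z) * u x) (at x)"
proof -
  have "((\<lambda>y. complex_of_real (p y) * vderiv u y) has_vector_derivative
      vderiv (\<lambda>y. complex_of_real (p y) * vderiv u y) x) (at x)"
    using assms by (simp add: is_solution_def vector_derivative_works)
  moreover have "H_expr p q u x = z * u x"
    using assms by (simp add: is_solution_def)
  then have "vderiv (\<lambda>y. complex_of_real (p y) * vderiv u y) x = - (of_real (q x) + z) * u x"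
    unfolding H_expr_def by algebra
  ultimately show ?thesis
    by (simp add: flux_def[abs_def])
qed

lemma solution_cont:
  assumes "is_solution p q z u"
  shows "continuous_on {0<..} u"
  using solution_derivative[OF assms]
  by (intro continuous_at_imp_continuous_on ballI has_vector_derivative_continuous) auto

lemma solution_flux_cont:
  assumes "is_solution p q z u"
  shows "continuous_on {0<..} (flux u)"
  using solution_flux_derivative[OF assms]
  by (intro continuous_at_imp_continuous_on ballI has_vector_derivative_continuous) auto

lemma vderiv_eq_flux: "0 < x \<Longrightarrow> vderiv u x = flux u x * of_real (inverse (p x))"
  using p_nonzero[of x] by (simp add: flux_def)

lemma solution_vderiv_cont:
  assumes "is_solution p q z u"
  shows "continuous_on {0<..} (vderiv u)"
proof -
  have "continuous_on {0<..} (\<lambda>x. flux u x * complex_of_real (inverse (p x)))"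
    by (intro continuous_on_mult solution_flux_cont[OF assms] continuous_on_of_real inverse_p_cont)
  then show ?thesis
    by (rule continuous_on_cong[THEN iffD1, rotated 2]) (simp_all only: vderiv_eq_flux greaterThan_iff)
qed

lemma solution_abs_continuous:
  assumes u: "is_solution p q z u" and "0 < a"
  shows "abs_continuous_on {a..b} u"
proof (rule C1_imp_abs_continuous_on)
  show "(u has_vector_derivative vderiv u x) (at x)" if "x \<in> {a..b}" for x
    using solution_derivative[OF u, of x] that \<open>0 < a\<close> by simp
  show "continuous_on {a..b} (vderiv u)"
    using solution_vderiv_cont[OF u] by (rule continuous_on_subset) (use \<open>0 < a\<close> in auto)
qed

lemma solution_flux_abs_continuous:
  assumes u: "is_solution p q z u" and "0 < a"
  shows "abs_continuous_on {a..b} (flux u)"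
proof (rule C1_imp_abs_continuous_on)
  show "(flux u has_vector_derivative - (of_real (q x) + z) * u x) (at x)" if "x \<in> {a..b}" for x
    using solution_flux_derivative[OF u, of x] that \<open>0 < a\<close> by simp
  have "continuous_on {0<..} (\<lambda>x. - (complex_of_real (q x) + z) * u x)"
    by (intro continuous_on_mult continuous_on_minus continuous_on_add continuous_on_of_real
        q_cont continuous_on_const solution_cont[OF u])
  then show "continuous_on {a..b} (\<lambda>x. - (complex_of_real (q x) + z) * u x)"
    by (rule continuous_on_subset) (use \<open>0 < a\<close> in auto)
qed

lemma wronskian_flux: "wronskian p u v x = u x * flux v x - flux u x * v x"
  by (simp add: wronskian_def flux_def algebra_simps)

text \<open>
  For \<open>z = w\<close> the Wronskian is constant; for \<open>w = cnj z\<close> and \<open>v = cnj u\<close> its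
  derivative is \<open>2 \<i> Im z |u|\<^sup>2\<close>, of constant sign up to the factor \<open>\<i>\<close>.
\<close>

lemma wronskian_solutions_derivative:
  assumes u: "is_solution p q z u" and v: "is_solution p q w v" and x: "0 < x"
  shows "(wronskian p u v has_vector_derivative (z - w) * (u x * v x)) (at x)"
proof -
  have "((\<lambda>x. u x * flux v x - flux u x * v x) has_vector_derivative
     (u x * (- (of_real (q x) + w) * v x) + vderiv u x * flux v x)
     - (flux u x * vderiv v x + (- (of_real (q x) + z) * u x) * v x)) (at x)"
    by (intro has_vector_derivative_diff has_vector_derivative_mult
        solution_derivative[OF u x] solution_derivative[OF v x]
        solution_flux_derivative[OF u x] solution_flux_derivative[OF v x])
  moreover have "wronskian p u v = (\<lambda>x. u x * flux v x - flux u x * v x)"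
    by (rule ext) (rule wronskian_flux)
  moreover have "(u x * (- (of_real (q x) + w) * v x) + vderiv u x * flux v x)
     - (flux u x * vderiv v x + (- (of_real (q x) + z) * u x) * v x) = (z - w) * (u x * v x)"
    by (simp add: flux_def algebra_simps)
  ultimately show ?thesis by simp
qed

lemma wronskian_initial_values:
  assumes u: "initial_values u c d" and v: "initial_values v c' d'"
  shows "(wronskian p u v \<longlongrightarrow> of_real (p 0) * (c * d' - d * c')) (at_right 0)"
  using u v p_lim unfolding initial_values_def wronskian_def[abs_def]
  by (intro tendsto_mult tendsto_diff tendsto_of_real) auto

lemma wronskian_solutions_constant:
  assumes u: "is_solution p q z u" and v: "is_solution p q z v"
    and u0: "initial_values u c d" and v0: "initial_values v c' d'" and x: "0 < x"
  shows "wronskian p u v x = of_real (p 0) * (c * d' - d * c')"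
proof -
  have "\<exists>k. \<forall>x\<in>{0<..}. wronskian p u v x = k"
  proof (rule has_derivative_zero_constant)
    show "(wronskian p u v has_derivative (\<lambda>h. 0)) (at y within {0<..})" if "y \<in> {0<..}" for y
      using wronskian_solutions_derivative[OF u v, of y] that
      by (intro has_derivative_at_withinI[where s = "{0<..}"]) (simp add: has_vector_derivative_def)
  qed auto
  then obtain k where k: "\<And>x. 0 < x \<Longrightarrow> wronskian p u v x = k" by auto
  have "(wronskian p u v \<longlongrightarrow> k) (at_right 0)"
    by (intro tendsto_eventually eventually_at_right_0I k)
  from tendsto_unique[OF _ this wronskian_initial_values[OF u0 v0]]
  have "k = of_real (p 0) * (c * d' - d * c')" by simp
  with k x show ?thesis by simp
qed

text \<open>
  Cramer's rule for the linear system that the two Wronskians form in \<open>u x\<close> and \<open>u' x\<close>. It takes the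
  place of uniqueness theorems for the differential equation: a function with constant
  Wronskians is a combination of \<open>\<phi>\<close> and \<open>\<theta>\<close>.
\<close>

lemma wronskian_Cramer:
  assumes "wronskian p \<phi> \<theta> x = - 1"
  shows "u x = \<theta> x * wronskian p u \<phi> x - \<phi> x * wronskian p u \<theta> x"
    and "vderiv u x = vderiv \<theta> x * wronskian p u \<phi> x - vderiv \<phi> x * wronskian p u \<theta> x"
proof -
  have "u x = - wronskian p \<phi> \<theta> x * u x" "vderiv u x = - wronskian p \<phi> \<theta> x * vderiv u x"
    using assms by simp_all
  then show "u x = \<theta> x * wronskian p u \<phi> x - \<phi> x * wronskian p u \<theta> x"
    and "vderiv u x = vderiv \<theta> x * wronskian p u \<phi> x - vderiv \<phi> x * wronskian p u \<theta> x"
    by (simp_all add: wronskian_def algebra_simps)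
qed

subsection \<open>Lagrange's identity\<close>

lemma H2_locD:
  assumes "u \<in> H2_loc"
  shows "0 < x \<Longrightarrow> (u has_vector_derivative vderiv u x) (at x)"
    and "continuous_on {0<..} (vderiv u)"
    and "0 < a \<Longrightarrow> abs_continuous_on {a..b} (vderiv u)"
proof -
  have C1: "u C1_differentiable_on {0<..}" and ac: "loc_abs_continuous_on {0<..} (vderiv u)"
    using assms by (auto simp: H2_loc_def)
  show "(u has_vector_derivative vderiv u x) (at x)" if "0 < x"
    using C1 that by (simp add: C1_differentiable_on_eq vector_derivative_works)
  show "continuous_on {0<..} (vderiv u)"
    using C1 by (simp add: C1_differentiable_on_eq)
  show "abs_continuous_on {a..b} (vderiv u)" if "0 < a"
  proof -
    have "{a..b} \<subseteq> {0<..}" using that by auto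
    with ac show ?thesis unfolding loc_abs_continuous_on_def by blast
  qed
qed

text \<open>
  The Wronskian is absolutely continuous since \<open>u'\<close> is, and almost everywhere its derivative is
  \<open>h v\<close>.
\<close>

lemma lagrange_identity:
  assumes u: "u \<in> H2_loc" and eq: "L2_eq (\<lambda>x. H_expr p q u x - z * u x) h"
    and v: "is_solution p q z v" and ab: "0 < a" "a \<le> b"
  shows "((\<lambda>x. h x * v x) has_integral wronskian p u v b - wronskian p u v a) {a..b}"
proof -
  obtain w where "AE x in half_line. (vderiv u has_vector_derivative w x) (at x)"
    using u unfolding H2_loc_def by blast
  then obtain N1 where N1: "negligible N1"
      "\<forall>x>0. x \<notin> N1 \<longrightarrow> (vderiv u has_vector_derivative w x) (at x)"
    unfolding AE_half_line_iff_negligible by (elim exE conjE)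
  obtain N2 where N2: "negligible N2"
      "\<forall>x>0. x \<notin> N2 \<longrightarrow> H_expr p q u x - z * u x = h x"
    using eq unfolding L2_eq_def AE_half_line_iff_negligible by (elim exE conjE)
  have sub: "{a..b} \<subseteq> {0<..}" using ab by auto
  have W: "wronskian p u v = (\<lambda>x. u x * flux v x - (complex_of_real (p x) * vderiv u x) * v x)"
    by (rule ext) (simp add: wronskian_flux flux_def)
  show ?thesis
  proof (rule abs_continuous_on_has_integral[OF ab(2) _ negligible_Un[OF N1(1) N2(1)]])
    have "abs_continuous_on {a..b} u"
      using H2_locD(1)[OF u] continuous_on_subset[OF H2_locD(2)[OF u] sub] ab
      by (intro C1_imp_abs_continuous_on) auto
    moreover have "abs_continuous_on {a..b} (\<lambda>x. complex_of_real (p x))"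
    proof (rule C1_imp_abs_continuous_on)
      show "((\<lambda>x. complex_of_real (p x)) has_vector_derivative of_real (dp x)) (at x)"
        if "x \<in> {a..b}" for x using that ab by (intro of_real_p_derivative) auto
      show "continuous_on {a..b} (\<lambda>x. complex_of_real (dp x))"
        by (intro continuous_on_of_real continuous_on_subset[OF dp_cont sub])
    qed
    ultimately show "abs_continuous_on {a..b} (wronskian p u v)"
      unfolding W
      by (intro abs_continuous_on_diff abs_continuous_on_mult H2_locD(3)[OF u ab(1)]
          solution_abs_continuous[OF v ab(1)] solution_flux_abs_continuous[OF v ab(1)])
  next
    fix x assume x: "x \<in> {a..b} - (N1 \<union> N2)"
    then have x0: "0 < x" using ab by auto
    define F where "F = of_real (p x) * w x + of_real (dp x) * vderiv u x"
    have F: "((\<lambda>y. complex_of_real (p y) * vderiv u y) has_vector_derivative F) (at x)"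
      unfolding F_def using N1(2) x x0
      by (intro has_vector_derivative_mult of_real_p_derivative) auto
    then have "H_expr p q u x = - F - of_real (q x) * u x"
      unfolding H_expr_def by (simp add: vector_derivative_at)
    then have h: "h x = - F - of_real (q x) * u x - z * u x"
      using N2(2) x x0 by auto
    have "(wronskian p u v has_vector_derivative
       (u x * (- (of_real (q x) + z) * v x) + vderiv u x * flux v x)
       - ((complex_of_real (p x) * vderiv u x) * vderiv v x + F * v x)) (at x)"
      unfolding W
      by (intro has_vector_derivative_diff has_vector_derivative_mult F H2_locD(1)[OF u x0]
        solution_derivative[OF v x0] solution_flux_derivative[OF v x0])
    moreover have "(u x * (- (of_real (q x) + z) * v x) + vderiv u x * flux v x)
       - ((complex_of_real (p x) * vderiv u x) * vderiv v x + F * v x) = h x * v x"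
      unfolding h flux_def by (simp add: algebra_simps)
    ultimately have "(wronskian p u v has_vector_derivative h x * v x) (at x)" by simp
    then show "(wronskian p u v has_vector_derivative h x * v x) (at x within {a..b})"
      by (rule has_vector_derivative_at_within)
  qed
qed

end

section \<open>Variation of constants\<close>

text \<open>
  The second derivative of a solution of the inhomogeneous equation has this form, with
  continuous \<open>c\<close> and \<open>r\<close>.
\<close>

lemma L2_loc_continuous_combination:
  assumes c: "continuous_on {0<..} c" and r: "continuous_on {0<..} r" and h: "h \<in> L2"
  shows "(\<lambda>x. c x + r x * h x) \<in> L2_loc"
proof -
  have meas: "(\<lambda>x. c x + r x * h x) \<in> borel_measurable half_line"
    by (intro borel_measurable_add borel_measurable_times continuous_on_imp_measurable_half_line c r
        L2_measurable[OF h])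
  have "set_integrable lebesgue {a..b} (\<lambda>x. (cmod (c x + r x * h x))\<^sup>2)" if a: "0 < a" for a b
  proof -
    have sub: "{a..b} \<subseteq> {0<..}" using a by auto
    have "bounded (c ` {a..b})" "bounded (r ` {a..b})"
      by (intro compact_imp_bounded compact_continuous_image continuous_on_subset[OF c sub]
          continuous_on_subset[OF r sub] compact_Icc)+
    then obtain M M' where M: "\<forall>y\<in>c ` {a..b}. cmod y \<le> M" and M': "\<forall>y\<in>r ` {a..b}. cmod y \<le> M'"
      unfolding bounded_iff by (elim exE)
    have hint: "set_integrable lebesgue {a..b} (\<lambda>x. (cmod (h x))\<^sup>2)"
      using L2_integrable[OF h, unfolded integrable_half_line_iff]
      by (rule set_integrable_subset) (use sub in auto)
    show ?thesis
    proof (rule set_integrable_bound)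
      show "set_integrable lebesgue {a..b} (\<lambda>x. 2 * M\<^sup>2 + (2 * M'\<^sup>2) * (cmod (h x))\<^sup>2)"
        by (intro set_integral_add(1) set_integrable_mult_right hint absolutely_integrable_on_const) simp
      have "(\<lambda>x. (cmod (c x + r x * h x))\<^sup>2) \<in> borel_measurable half_line"
        using meas by measurable
      then have "set_borel_measurable lebesgue {0<..} (\<lambda>x. (cmod (c x + r x * h x))\<^sup>2)"
        unfolding set_borel_measurable_def by (subst (asm) borel_measurable_restrict_space_iff) simp_all
      then show "set_borel_measurable lebesgue {a..b} (\<lambda>x. (cmod (c x + r x * h x))\<^sup>2)"
        by (rule set_borel_measurable_subset) (use sub in auto)
      show "AE x in lebesgue. x \<in> {a..b} \<longrightarrow>
          norm ((cmod (c x + r x * h x))\<^sup>2) \<le> norm (2 * M\<^sup>2 + (2 * M'\<^sup>2) * (cmod (h x))\<^sup>2)"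
      proof (intro AE_I2 impI)
        fix x assume x: "x \<in> {a..b}"
        have b: "cmod (c x) \<le> M" "cmod (r x * h x) \<le> M' * cmod (h x)"
          using M M' x by (auto simp: norm_mult intro: mult_right_mono)
        have "(cmod (c x + r x * h x))\<^sup>2 \<le> (M + M' * cmod (h x))\<^sup>2"
          using b by (intro power_mono order_trans[OF norm_triangle_ineq] add_mono) auto
        also have "\<dots> \<le> 2 * M\<^sup>2 + 2 * (M' * cmod (h x))\<^sup>2"
          using sum_squares_bound[of M "M' * cmod (h x)"] unfolding power2_sum by linarith
        finally show "norm ((cmod (c x + r x * h x))\<^sup>2) \<le> norm (2 * M\<^sup>2 + (2 * M'\<^sup>2) * (cmod (h x))\<^sup>2)"
          by (simp add: power_mult_distrib)
      qed
    qed
  qed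
  with meas show ?thesis by (simp add: L2_loc_def)
qed

text \<open>
  Variation of constants with a free constant \<open>K\<close> yields
  a one-parameter family of solutions satisfying the boundary condition of \<open>\<phi>\<close>.
\<close>

locale inhomogeneous = sturm_liouville +
  fixes z K :: complex and \<phi> \<theta> h :: "real \<Rightarrow> complex"
  assumes phi: "is_solution p q z \<phi>" and theta: "is_solution p q z \<theta>"
    and wronskian: "\<And>x. 0 < x \<Longrightarrow> wronskian p \<phi> \<theta> x = - 1"
    and phi_L2: "\<phi> \<in> L2" and theta_L2: "\<theta> \<in> L2" and h_L2: "h \<in> L2"
begin

definition A :: "real \<Rightarrow> complex" where
  "A x = integral {0..x} (\<lambda>y. \<phi> y * h y)"

text \<open>
  The constant \<open>K\<close> is the value of \<open>B\<close> at the origin; changing it adds a multiple of \<open>\<phi>\<close> to \<open>sol\<close>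
  and so preserves the boundary condition.
\<close>

definition B :: "real \<Rightarrow> complex" where
  "B x = K - integral {0..x} (\<lambda>y. \<theta> y * h y)"

definition sol :: "real \<Rightarrow> complex" where
  "sol x = \<theta> x * A x + \<phi> x * B x"

text \<open>
  The derivative of \<open>sol\<close>: the terms containing \<open>A'\<close> and \<open>B'\<close> cancel.
\<close>

definition sol' :: "real \<Rightarrow> complex" where
  "sol' x = vderiv \<theta> x * A x + vderiv \<phi> x * B x"

lemma phi_h: "set_integrable lebesgue {0<..} (\<lambda>y. \<phi> y * h y)"
  using L2_mult_integrable[OF phi_L2 h_L2] by (simp only: integrable_half_line_iff)

lemma theta_h: "set_integrable lebesgue {0<..} (\<lambda>y. \<theta> y * h y)"
  using L2_mult_integrable[OF theta_L2 h_L2] by (simp only: integrable_half_line_iff)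

lemma A_abs_continuous: "0 \<le> a \<Longrightarrow> abs_continuous_on {a..b} A"
  unfolding A_def[abs_def] by (rule integral_abs_continuous_half_line[OF phi_h])

lemma B_abs_continuous: "0 \<le> a \<Longrightarrow> abs_continuous_on {a..b} B"
  unfolding B_def[abs_def]
  by (intro abs_continuous_on_diff abs_continuous_on_const integral_abs_continuous_half_line[OF theta_h])

lemma half_line_cont_from_Icc:
  fixes F :: "real \<Rightarrow> complex"
  assumes "\<And>a b. 0 < a \<Longrightarrow> continuous_on {a..b} F"
  shows "continuous_on {0<..} F"
proof (rule continuous_at_imp_continuous_on, rule ballI)
  fix x :: real assume "x \<in> {0<..}"
  then have x: "0 < x / 2" "x / 2 < x" "x < x + 1" by auto
  have "continuous_on {x/2<..<x+1} F"
    using assms[OF x(1), of "x + 1"] by (rule continuous_on_subset) auto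
  then show "isCont F x"
    using x by (simp add: continuous_on_eq_continuous_at)
qed

lemma A_cont: "continuous_on {0<..} A"
  by (rule half_line_cont_from_Icc, rule abs_continuous_on_imp_continuous_on, rule A_abs_continuous) simp

lemma B_cont: "continuous_on {0<..} B"
  by (rule half_line_cont_from_Icc, rule abs_continuous_on_imp_continuous_on, rule B_abs_continuous) simp

lemma sol_cont: "continuous_on {0<..} sol"
  unfolding sol_def[abs_def]
  by (intro continuous_on_add continuous_on_mult A_cont B_cont solution_cont[OF phi] solution_cont[OF theta])

lemma sol'_cont: "continuous_on {0<..} sol'"
  unfolding sol'_def[abs_def]
  by (intro continuous_on_add continuous_on_mult A_cont B_cont solution_vderiv_cont[OF phi]
      solution_vderiv_cont[OF theta])

lemma AB_derivatives:
  obtains N where "negligible N"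
    "\<And>x. 0 < x \<Longrightarrow> x \<notin> N \<Longrightarrow> (A has_vector_derivative \<phi> x * h x) (at x)"
    "\<And>x. 0 < x \<Longrightarrow> x \<notin> N \<Longrightarrow> (B has_vector_derivative - (\<theta> x * h x)) (at x)"
proof -
  obtain N1 where N1: "negligible N1" "\<And>x. 0 < x \<Longrightarrow> x \<notin> N1 \<Longrightarrow> (A has_vector_derivative \<phi> x * h x) (at x)"
    by (rule integral_half_line_derivative[OF phi_h, folded A_def]) (rule that; assumption)
  obtain N2 where N2: "negligible N2" "\<And>x. 0 < x \<Longrightarrow> x \<notin> N2 \<Longrightarrow>
      ((\<lambda>x. integral {0..x} (\<lambda>y. \<theta> y * h y)) has_vector_derivative \<theta> x * h x) (at x)"
    by (rule integral_half_line_derivative[OF theta_h]) (rule that; assumption)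
  show thesis
  proof
    show "negligible (N1 \<union> N2)" using N1(1) N2(1) by (rule negligible_Un)
    fix x assume x: "0 < x" "x \<notin> N1 \<union> N2"
    then show "(A has_vector_derivative \<phi> x * h x) (at x)" by (intro N1(2)) auto
    have "(B has_vector_derivative 0 - \<theta> x * h x) (at x)"
      unfolding B_def[abs_def] using x by (intro has_vector_derivative_diff has_vector_derivative_const N2(2)) auto
    then show "(B has_vector_derivative - (\<theta> x * h x)) (at x)" by simp
  qed
qed

text \<open>
  \<open>A\<close> and \<open>B\<close> are differentiable only almost everywhere, so the product rule gives the derivative
  almost everywhere; continuity of \<open>sol'\<close> upgrades this to every point.
\<close>

lemma sol_derivative:
  assumes x: "0 < x"
  shows "(sol has_vector_derivative sol' x) (at x)"
proof -
  obtain N where N: "negligible N"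
    "\<And>x. 0 < x \<Longrightarrow> x \<notin> N \<Longrightarrow> (A has_vector_derivative \<phi> x * h x) (at x)"
    "\<And>x. 0 < x \<Longrightarrow> x \<notin> N \<Longrightarrow> (B has_vector_derivative - (\<theta> x * h x)) (at x)"
    by (rule AB_derivatives) (rule that; assumption)
  show ?thesis
  proof (rule abs_continuous_on_C1[OF _ N(1), of "x / 2" "x + 1"])
    show "abs_continuous_on {x/2..x+1} sol"
      unfolding sol_def[abs_def] using x
      by (intro abs_continuous_on_add abs_continuous_on_mult A_abs_continuous B_abs_continuous
          solution_abs_continuous[OF phi] solution_abs_continuous[OF theta]) auto
    show "continuous_on {x/2..x+1} sol'"
      using sol'_cont by (rule continuous_on_subset) (use x in auto)
    show "(sol has_vector_derivative sol' y) (at y)" if y: "y \<in> {x/2..x+1} - N" for y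
    proof -
      have y0: "0 < y" "y \<notin> N" using y x by auto
      have "(sol has_vector_derivative (\<theta> y * (\<phi> y * h y) + vderiv \<theta> y * A y)
          + (\<phi> y * - (\<theta> y * h y) + vderiv \<phi> y * B y)) (at y)"
        unfolding sol_def[abs_def]
        by (intro has_vector_derivative_add has_vector_derivative_mult N(2,3) y0
            solution_derivative[OF phi] solution_derivative[OF theta])
      moreover have "(\<theta> y * (\<phi> y * h y) + vderiv \<theta> y * A y)
          + (\<phi> y * - (\<theta> y * h y) + vderiv \<phi> y * B y) = sol' y"
        by (simp add: sol'_def algebra_simps)
      ultimately show ?thesis by simp
    qed
  qed (use x in auto)
qed

lemma vderiv_sol: "0 < x \<Longrightarrow> vderiv sol x = sol' x"
  by (rule vector_derivative_at) (rule sol_derivative)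

definition sol_flux :: "real \<Rightarrow> complex" where
  "sol_flux x = flux \<theta> x * A x + flux \<phi> x * B x"

lemma sol_flux_eq: "sol_flux x = complex_of_real (p x) * sol' x"
  by (simp add: sol_flux_def sol'_def flux_def algebra_simps)

text \<open>
  In the derivative of the flux the terms containing \<open>A'\<close> and \<open>B'\<close> combine to the Wronskian
  times \<open>h\<close>, and the Wronskian is \<open>-1\<close>.
\<close>

lemma sol_flux_derivative:
  obtains N where "negligible N"
    "\<And>x. 0 < x \<Longrightarrow> x \<notin> N \<Longrightarrow>
      (sol_flux has_vector_derivative - (of_real (q x) + z) * sol x - h x) (at x)"
proof -
  obtain N where N: "negligible N"
    "\<And>x. 0 < x \<Longrightarrow> x \<notin> N \<Longrightarrow> (A has_vector_derivative \<phi> x * h x) (at x)"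
    "\<And>x. 0 < x \<Longrightarrow> x \<notin> N \<Longrightarrow> (B has_vector_derivative - (\<theta> x * h x)) (at x)"
    by (rule AB_derivatives) (rule that; assumption)
  show thesis
  proof
    show "negligible N" by fact
    fix x assume x: "0 < x" "x \<notin> N"
    have "(sol_flux has_vector_derivative
        (flux \<theta> x * (\<phi> x * h x) + (- (of_real (q x) + z) * \<theta> x) * A x)
        + (flux \<phi> x * - (\<theta> x * h x) + (- (of_real (q x) + z) * \<phi> x) * B x)) (at x)"
      unfolding sol_flux_def[abs_def]
      by (intro has_vector_derivative_add has_vector_derivative_mult N(2,3) x
          solution_flux_derivative[OF phi] solution_flux_derivative[OF theta])
    moreover have "(flux \<theta> x * (\<phi> x * h x) + (- (of_real (q x) + z) * \<theta> x) * A x)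
        + (flux \<phi> x * - (\<theta> x * h x) + (- (of_real (q x) + z) * \<phi> x) * B x)
        = - (of_real (q x) + z) * sol x + wronskian p \<phi> \<theta> x * h x"
      by (simp add: wronskian_flux sol_def algebra_simps)
    ultimately show "(sol_flux has_vector_derivative - (of_real (q x) + z) * sol x - h x) (at x)"
      using wronskian[OF x(1)] by simp
  qed
qed

lemma sol_flux_abs_continuous: "0 < a \<Longrightarrow> abs_continuous_on {a..b} sol_flux"
  unfolding sol_flux_def[abs_def]
  by (intro abs_continuous_on_add abs_continuous_on_mult A_abs_continuous B_abs_continuous
      solution_flux_abs_continuous[OF phi] solution_flux_abs_continuous[OF theta]) auto

lemma vderiv_sol_abs_continuous:
  assumes a: "0 < a"
  shows "abs_continuous_on {a..b} (vderiv sol)"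
proof (rule abs_continuous_on_cong)
  have sub: "{a..b} \<subseteq> {0<..}" using a by auto
  have "abs_continuous_on {a..b} (\<lambda>x. complex_of_real (inverse (p x)))"
  proof (rule C1_imp_abs_continuous_on)
    show "((\<lambda>x. complex_of_real (inverse (p x))) has_vector_derivative of_real (- dp x * (inverse (p x))\<^sup>2)) (at x)"
      if "x \<in> {a..b}" for x using that a by (intro inverse_p_derivative) auto
    show "continuous_on {a..b} (\<lambda>x. complex_of_real (- dp x * (inverse (p x))\<^sup>2))"
      by (intro continuous_on_of_real continuous_on_mult continuous_on_minus continuous_on_power
          continuous_on_subset[OF dp_cont sub] continuous_on_subset[OF inverse_p_cont sub])
  qed
  then show "abs_continuous_on {a..b} (\<lambda>x. sol_flux x * complex_of_real (inverse (p x)))"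
    by (intro abs_continuous_on_mult sol_flux_abs_continuous a)
  show "sol_flux x * complex_of_real (inverse (p x)) = vderiv sol x" if "x \<in> {a..b}" for x
  proof -
    have "0 < x" using that a by simp
    then show ?thesis
      using p_nonzero[of x] by (simp add: vderiv_sol sol_flux_eq)
  qed
qed

lemma vderiv_sol_derivative:
  assumes x: "0 < x" and F: "(sol_flux has_vector_derivative F) (at x)"
  shows "(vderiv sol has_vector_derivative (F - of_real (dp x) * sol' x) * of_real (inverse (p x))) (at x)"
proof -
  have "(sol' has_vector_derivative (F - of_real (dp x) * sol' x) * of_real (inverse (p x))) (at x)"
    by (rule derivative_from_flux[OF x F[unfolded sol_flux_eq[abs_def]]])
  then show ?thesis
    by (rule has_vector_derivative_transform_within_open[of _ _ _ "{0<..}"]) (use x vderiv_sol in auto)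
qed

lemma sol_H2_loc: "sol \<in> H2_loc"
proof -
  obtain N where N: "negligible N"
    "\<And>x. 0 < x \<Longrightarrow> x \<notin> N \<Longrightarrow>
      (sol_flux has_vector_derivative - (of_real (q x) + z) * sol x - h x) (at x)"
    by (rule sol_flux_derivative) (rule that; assumption)
  define c where "c x = (- (of_real (q x) + z) * sol x - of_real (dp x) * sol' x) * of_real (inverse (p x))" for x
  define r where "r x = - complex_of_real (inverse (p x))" for x
  define w where "w x = c x + r x * h x" for x
  have "sol C1_differentiable_on {0<..}"
    unfolding C1_differentiable_on_def using sol_derivative sol'_cont
    by (intro exI[of _ sol']) auto
  moreover have "loc_abs_continuous_on {0<..} (vderiv sol)"
    unfolding loc_abs_continuous_on_def
  proof (intro allI impI)
    fix a b :: real assume *: "{a..b} \<subseteq> {0<..}"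
    show "abs_continuous_on {a..b} (vderiv sol)"
    proof (cases "a \<le> b")
      case True
      then have "a \<in> {a..b}" by simp
      with * have "0 < a" by blast
      then show ?thesis by (rule vderiv_sol_abs_continuous)
    next
      case False
      then have "{a..b} = {1..0}" by simp
      then show ?thesis using vderiv_sol_abs_continuous[of 1 0] by simp
    qed
  qed
  moreover have "w \<in> L2_loc"
    unfolding w_def[abs_def]
  proof (rule L2_loc_continuous_combination[OF _ _ h_L2])
    show "continuous_on {0<..} c"
      unfolding c_def[abs_def]
      by (intro continuous_on_mult continuous_on_diff continuous_on_minus continuous_on_add
          continuous_on_of_real q_cont dp_cont inverse_p_cont sol_cont sol'_cont continuous_on_const)
    show "continuous_on {0<..} r"
      unfolding r_def[abs_def] by (intro continuous_on_minus continuous_on_of_real inverse_p_cont)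
  qed
  moreover have "AE x in half_line. (vderiv sol has_vector_derivative w x) (at x)"
    unfolding AE_half_line_iff_negligible
  proof (intro exI[of _ N] conjI allI impI N(1))
    fix x assume x: "0 < x" "x \<notin> N"
    have "w x = (- (of_real (q x) + z) * sol x - h x - of_real (dp x) * sol' x) * of_real (inverse (p x))"
      unfolding w_def c_def r_def by (simp add: algebra_simps)
    then show "(vderiv sol has_vector_derivative w x) (at x)"
      using vderiv_sol_derivative[OF x(1) N(2)[OF x]] by simp
  qed
  ultimately show ?thesis unfolding H2_loc_def by blast
qed

lemma sol_equation: "L2_eq (\<lambda>x. H_expr p q sol x - z * sol x) h"
proof -
  obtain N where N: "negligible N"
    "\<And>x. 0 < x \<Longrightarrow> x \<notin> N \<Longrightarrow>
      (sol_flux has_vector_derivative - (of_real (q x) + z) * sol x - h x) (at x)"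
    by (rule sol_flux_derivative) (rule that; assumption)
  show ?thesis
    unfolding L2_eq_def AE_half_line_iff_negligible
  proof (intro exI[of _ N] conjI allI impI N(1))
    fix x assume x: "0 < x" "x \<notin> N"
    have "((\<lambda>y. complex_of_real (p y) * vderiv sol y) has_vector_derivative
        - (of_real (q x) + z) * sol x - h x) (at x)"
      using N(2)[OF x]
      by (rule has_vector_derivative_transform_within_open[of _ _ _ "{0<..}"])
         (use x in \<open>auto simp: vderiv_sol sol_flux_eq\<close>)
    then show "H_expr p q sol x - z * sol x = h x"
      unfolding H_expr_def by (simp add: vector_derivative_at algebra_simps)
  qed
qed

lemma A_bound: "cmod (A x) \<le> L2_norm \<phi> * L2_norm h"
  unfolding A_def set_integral_below[OF phi_h, symmetric]
  by (rule L2_set_integral_bound[OF phi_L2 h_L2]) auto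

lemma theta_integral_bound: "cmod (integral {0..x} (\<lambda>y. \<theta> y * h y)) \<le> L2_norm \<theta> * L2_norm h"
  unfolding set_integral_below[OF theta_h, symmetric]
  by (rule L2_set_integral_bound[OF theta_L2 h_L2]) auto

lemma sol_bound:
  "cmod (sol x) \<le> cmod (of_real (L2_norm \<phi> * L2_norm h) * \<theta> x)
     + cmod (of_real (cmod K + L2_norm \<theta> * L2_norm h) * \<phi> x)"
proof -
  have B: "cmod (B x) \<le> cmod K + L2_norm \<theta> * L2_norm h"
    unfolding B_def by (rule order_trans[OF norm_triangle_ineq4 add_left_mono[OF theta_integral_bound]])
  have "cmod (sol x) \<le> cmod (A x) * cmod (\<theta> x) + cmod (B x) * cmod (\<phi> x)"
    unfolding sol_def by (rule order_trans[OF norm_triangle_ineq]) (simp add: norm_mult mult.commute)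
  also have "\<dots> \<le> (L2_norm \<phi> * L2_norm h) * cmod (\<theta> x) + (cmod K + L2_norm \<theta> * L2_norm h) * cmod (\<phi> x)"
    by (intro add_mono mult_right_mono A_bound B) auto
  also have "\<dots> = cmod (of_real (L2_norm \<phi> * L2_norm h) * \<theta> x)
     + cmod (of_real (cmod K + L2_norm \<theta> * L2_norm h) * \<phi> x)"
    unfolding norm_mult norm_of_real
    by (simp add: L2_norm_nonneg abs_of_nonneg)
  finally show ?thesis .
qed

lemma sol_L2: "sol \<in> L2"
  by (rule L2_dominated[OF continuous_on_imp_measurable_half_line[OF sol_cont]
        L2_scale[OF theta_L2] L2_scale[OF phi_L2] sol_bound])

lemma H_sol_L2: "H_expr p q sol \<in> L2"
proof (rule L2_cong_AE)
  show "(\<lambda>x. h x + z * sol x) \<in> L2"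
    by (intro L2_add h_L2 L2_scale sol_L2)
  show "L2_eq (H_expr p q sol) (\<lambda>x. h x + z * sol x)"
    using sol_equation unfolding L2_eq_def by eventually_elim (simp add: algebra_simps)
qed

lemma sol_initial_values:
  assumes "initial_values \<phi> c d" "initial_values \<theta> c' d'"
  shows "initial_values sol (c * K) (d * K)"
proof -
  have A0: "(A \<longlongrightarrow> 0) (at_right 0)"
    unfolding A_def[abs_def] by (rule integral_tendsto_at_right_0[OF phi_h])
  have "(B \<longlongrightarrow> K - 0) (at_right 0)"
    unfolding B_def[abs_def] by (intro tendsto_diff tendsto_const integral_tendsto_at_right_0[OF theta_h])
  then have B0: "(B \<longlongrightarrow> K) (at_right 0)" by simp
  have "(sol \<longlongrightarrow> c' * 0 + c * K) (at_right 0)"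
    using assms unfolding sol_def[abs_def] initial_values_def
    by (intro tendsto_add tendsto_mult A0 B0) auto
  moreover have "(sol' \<longlongrightarrow> d' * 0 + d * K) (at_right 0)"
    using assms unfolding sol'_def[abs_def] initial_values_def
    by (intro tendsto_add tendsto_mult A0 B0) auto
  then have "(vderiv sol \<longlongrightarrow> d' * 0 + d * K) (at_right 0)"
    by (rule Lim_transform_eventually) (intro eventually_at_right_0I, simp add: vderiv_sol)
  ultimately show ?thesis by (simp add: initial_values_def)
qed

text \<open>
  Lagrange's identity gives both Wronskians the same increments.
\<close>

lemma wronskian_difference_constant:
  assumes v: "v \<in> H2_loc" and eq: "L2_eq (\<lambda>x. H_expr p q v x - z * v x) h"
    and \<psi>: "is_solution p q z \<psi>" and x: "0 < x"
  shows "wronskian p v \<psi> x - wronskian p sol \<psi> x = wronskian p v \<psi> 1 - wronskian p sol \<psi> 1"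
proof -
  have "wronskian p v \<psi> b - wronskian p v \<psi> a = wronskian p sol \<psi> b - wronskian p sol \<psi> a"
    if "0 < a" "a \<le> b" for a b
    by (rule has_integral_unique[OF lagrange_identity[OF v eq \<psi> that]
          lagrange_identity[OF sol_H2_loc sol_equation \<psi> that]])
  from this[of 1 x] this[of x 1] x show ?thesis
    by (cases "x \<le> 1") (simp_all add: algebra_simps)
qed

text \<open>
  The constants are Wronskians of the difference with \<open>\<theta>\<close> and \<open>\<phi>\<close>, and Cramer's rule expresses
  the difference through them.
\<close>

lemma solution_difference:
  assumes v: "v \<in> H2_loc" and eq: "L2_eq (\<lambda>x. H_expr p q v x - z * v x) h"
  obtains k1 k2 where "\<And>x. 0 < x \<Longrightarrow> v x = sol x + k1 * \<phi> x + k2 * \<theta> x"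
    "\<And>x. 0 < x \<Longrightarrow> vderiv v x = vderiv sol x + k1 * vderiv \<phi> x + k2 * vderiv \<theta> x"
proof
  define k1 k2 where "k1 = - (wronskian p v \<theta> 1 - wronskian p sol \<theta> 1)"
    and "k2 = wronskian p v \<phi> 1 - wronskian p sol \<phi> 1"
  fix x :: real assume x: "0 < x"
  have W: "wronskian p v \<phi> x = wronskian p sol \<phi> x + k2" "wronskian p v \<theta> x = wronskian p sol \<theta> x - k1"
    using wronskian_difference_constant[OF v eq phi x] wronskian_difference_constant[OF v eq theta x]
    by (simp_all add: k1_def k2_def algebra_simps)
  note C = wronskian_Cramer[OF wronskian[OF x]]
  show "v x = sol x + k1 * \<phi> x + k2 * \<theta> x"
    unfolding C(1)[of v] C(1)[of sol] W by (simp add: algebra_simps)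
  show "vderiv v x = vderiv sol x + k1 * vderiv \<phi> x + k2 * vderiv \<theta> x"
    unfolding C(2)[of v] C(2)[of sol] W by (simp add: algebra_simps)
qed

end

section \<open>The phase is unbounded\<close>

locale quasiclassical = sturm_liouville +
  fixes x0 :: real
  assumes x0_pos: "0 < x0" and q_pos: "\<And>x. x0 \<le> x \<Longrightarrow> 0 < q x"
    and amp_derivative_ex: "\<exists>a'. \<forall>x\<ge>x0. (amp p q has_real_derivative a' x) (at x within {x0..})"
    and amp_L2: "set_integrable lebesgue {x0<..} (\<lambda>x. (amp p q x)\<^sup>2)"
    and amp_lim: "((\<lambda>x. p x * deriv (amp p q) x * amp p q x) \<longlongrightarrow> 0) at_top"
begin

abbreviation a :: "real \<Rightarrow> real" where "a \<equiv> amp p q"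
abbreviation \<xi> :: "real \<Rightarrow> real" where "\<xi> \<equiv> xi p q"
abbreviation \<Xi> :: "real \<Rightarrow> real" where "\<Xi> \<equiv> Xi p q x0"

lemma pq_pos: "x0 \<le> x \<Longrightarrow> 0 < p x \<and> 0 < q x"
  using p_pos[of x] q_pos[of x] x0_pos by simp

lemma amp_pos: "x0 \<le> x \<Longrightarrow> 0 < a x"
  using pq_pos[of x] by (simp add: amp_def)

lemma xi_pos: "x0 \<le> x \<Longrightarrow> 0 < \<xi> x"
  using pq_pos[of x] by (simp add: xi_def)

text \<open>
  This normalization turns Wronskians at infinity into expressions in the coefficients of the
  two waves alone.
\<close>

lemma xi_amp:
  assumes "x0 \<le> x"
  shows "p x * \<xi> x * (a x)\<^sup>2 = 1"
proof -
  have pq: "0 < p x" "0 < q x" using pq_pos[OF assms] by auto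
  have "(a x)\<^sup>2 = (p x * q x) powr (- 1 / 2)"
    unfolding amp_def power2_eq_square by (subst powr_add[symmetric]) simp
  also have "\<dots> = inverse (sqrt (p x * q x))"
    using pq by (simp add: powr_half_sqrt powr_minus flip: powr_half_sqrt)
  finally have a2: "(a x)\<^sup>2 = inverse (sqrt (p x) * sqrt (q x))"
    by (simp add: real_sqrt_mult)
  have "p x = sqrt (p x) * sqrt (p x)" using pq by simp
  then have "p x * \<xi> x * (a x)\<^sup>2 = (sqrt (p x) * sqrt (p x)) * (sqrt (q x) / sqrt (p x)) * inverse (sqrt (p x) * sqrt (q x))"
    unfolding a2 xi_def real_sqrt_divide by simp
  also have "\<dots> = 1"
    using pq by (simp add: field_simps)
  finally show ?thesis .
qed

lemma xi_cont: "continuous_on {x0..} \<xi>"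
  unfolding xi_def[abs_def] using x0_pos p_nonzero
  by (intro continuous_on_real_sqrt continuous_on_divide continuous_on_subset[OF p_cont]
      continuous_on_subset[OF q_cont]) auto

lemma Xi_derivative:
  assumes "x0 < x"
  shows "(\<Xi> has_real_derivative \<xi> x) (at x)"
proof -
  have "continuous_on {x0..x+1} \<xi>"
    using xi_cont by (rule continuous_on_subset) auto
  then have "(\<Xi> has_real_derivative \<xi> x) (at x within {x0..x+1})"
    unfolding Xi_def[abs_def] using assms by (intro integral_has_real_derivative) auto
  then show ?thesis
    using assms by (simp add: at_within_Icc_at)
qed

lemma Xi_mono:
  assumes "x0 < x" "x \<le> y"
  shows "\<Xi> x \<le> \<Xi> y"
proof (rule DERIV_nonneg_imp_nondecreasing[OF assms(2)])
  fix t assume "x \<le> t" "t \<le> y"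
  then show "\<exists>d. (\<Xi> has_real_derivative d) (at t) \<and> 0 \<le> d"
    using Xi_derivative[of t] xi_pos[of t] assms by (intro exI[of _ "\<xi> t"]) auto
qed

lemma amp_derivative:
  assumes "x0 < x"
  shows "(a has_real_derivative deriv a x) (at x)"
proof -
  obtain a' where "\<forall>x\<ge>x0. (a has_real_derivative a' x) (at x within {x0..})"
    using amp_derivative_ex by (elim exE)
  then have "(a has_real_derivative a' x) (at x within {x0..})"
    using assms by simp
  then have "(a has_real_derivative a' x) (at x within {x0<..})"
    by (rule has_field_derivative_subset) auto
  then have "(a has_real_derivative a' x) (at x)"
    using assms by (subst (asm) at_within_open) auto
  then show ?thesis by (simp add: DERIV_imp_deriv)
qed

text \<open>
  The derivative is \<open>(2 p a' a + 1) / (p a\<^sup>2)\<close>, and \<open>p a' a\<close> tends to \<open>0\<close>.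
\<close>

lemma log_amp_Xi_mono:
  obtains X where "x0 < X" "\<And>x. X \<le> x \<Longrightarrow> 2 * ln (a X) + \<Xi> X \<le> 2 * ln (a x) + \<Xi> x"
proof -
  have "\<forall>\<^sub>F x in at_top. - (1 / 2) < p x * deriv a x * a x"
    using amp_lim by (rule order_tendstoD(1)) simp
  then obtain X0 where X0: "\<forall>x\<ge>X0. - (1 / 2) < p x * deriv a x * a x"
    unfolding eventually_at_top_linorder by (elim exE)
  define X where "X = max X0 (x0 + 1)"
  have X: "x0 < X" "X0 \<le> X" by (auto simp: X_def)
  have "2 * ln (a X) + \<Xi> X \<le> 2 * ln (a x) + \<Xi> x" if "X \<le> x" for x
  proof (rule DERIV_nonneg_imp_nondecreasing[OF that])
    fix t assume t: "X \<le> t" "t \<le> x"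
    then have t0: "x0 < t" using X by simp
    have pos: "0 < a t" "0 < p t" using amp_pos[of t] pq_pos[of t] t0 by auto
    have "((\<lambda>x. 2 * ln (a x) + \<Xi> x) has_real_derivative 2 * (1 / a t * deriv a t) + \<xi> t) (at t)"
      by (intro DERIV_add DERIV_cmult DERIV_chain2[where f = ln, OF DERIV_ln_divide] pos amp_derivative t0 Xi_derivative)
    moreover have "0 \<le> 2 * (1 / a t * deriv a t) + \<xi> t"
    proof -
      have "(2 * (1 / a t * deriv a t) + \<xi> t) * (p t * (a t)\<^sup>2) = 2 * (p t * deriv a t * a t) + p t * \<xi> t * (a t)\<^sup>2"
        using pos by (simp add: power2_eq_square algebra_simps)
      also have "\<dots> \<ge> 0"
        using X0[rule_format, of t] t X xi_amp[of t] t0 by simp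
      finally have "0 * (p t * (a t)\<^sup>2) \<le> (2 * (1 / a t * deriv a t) + \<xi> t) * (p t * (a t)\<^sup>2)"
        by simp
      then show ?thesis
        by (rule mult_right_le_imp_le) (use pos in simp)
    qed
    ultimately show "\<exists>d. ((\<lambda>x. 2 * ln (a x) + \<Xi> x) has_real_derivative d) (at t) \<and> 0 \<le> d"
      by (intro exI conjI)
  qed
  with X(1) show thesis by (rule that)
qed

text \<open>
  Otherwise the preceding monotonicity keeps the amplitude away from \<open>0\<close>, which is impossible
  for a square integrable function on a half-line.
\<close>

lemma Xi_unbounded: "\<exists>x>x0. M < \<Xi> x"
proof (rule ccontr)
  assume "\<not> (\<exists>x>x0. M < \<Xi> x)"
  then have "\<forall>x>x0. \<not> M < \<Xi> x" by blast
  then have M: "\<Xi> x \<le> M" if "x0 < x" for x using that by (simp add: not_less)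
  obtain X where X: "x0 < X" "\<And>x. X \<le> x \<Longrightarrow> 2 * ln (a X) + \<Xi> X \<le> 2 * ln (a x) + \<Xi> x"
    by (rule log_amp_Xi_mono) (rule that; assumption)
  define c where "c = exp (2 * ln (a X) + \<Xi> X - M)"
  define I where "I = (LINT x:{x0<..}|lebesgue. (a x)\<^sup>2)"
  have c: "0 < c" by (simp add: c_def)
  have le: "c \<le> (a x)\<^sup>2" if "X \<le> x" for x
  proof -
    have "2 * ln (a X) + \<Xi> X - M \<le> 2 * ln (a x)"
      using X(2)[OF that] M[of x] X(1) that by simp
    then have "c \<le> exp (2 * ln (a x))" unfolding c_def by simp
    also have "\<dots> = (exp (ln (a x)))\<^sup>2" by (rule exp_double)
    also have "\<dots> = (a x)\<^sup>2" using amp_pos[of x] X(1) that by simp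
    finally show ?thesis .
  qed
  \<comment> \<open>A positive lower bound \<open>c\<close> on a half-line makes the integral at least \<open>c n\<close> for every \<open>n\<close>.\<close>
  have "c * real n \<le> I" for n :: nat
  proof -
    have "c * real n = (LINT x:{X..X + real n}|lebesgue. c)"
      by (simp add: set_lebesgue_integral_def)
    also have "\<dots> \<le> I"
      unfolding I_def set_lebesgue_integral_def
    proof (rule integral_mono')
      show "integrable lebesgue (\<lambda>x. indicat_real {x0<..} x *\<^sub>R (a x)\<^sup>2)"
        using amp_L2 unfolding set_integrable_def .
      show "indicat_real {X..X + real n} x *\<^sub>R c \<le> indicat_real {x0<..} x *\<^sub>R (a x)\<^sup>2" for x
        using le[of x] X(1) by (auto simp: indicator_def)
    qed (simp add: indicator_def)
    finally show ?thesis .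
  qed
  moreover obtain n :: nat where "I / c < real n" using reals_Archimedean2 by blast
  then have "I < c * real n" using c by (simp add: pos_divide_less_eq mult.commute)
  ultimately show False by (simp add: not_le[symmetric])
qed

text \<open>
  A continuous unbounded phase takes all large values, so it may be used as a new variable.
\<close>

lemma tendsto_of_phase:
  fixes g :: "real \<Rightarrow> complex"
  assumes lim: "((\<lambda>x. g (\<Xi> x)) \<longlongrightarrow> l) at_top"
  shows "(g \<longlongrightarrow> l) at_top"
proof (rule tendstoI)
  fix e :: real assume "0 < e"
  from tendstoD[OF lim this] obtain X1 where X1: "\<forall>x\<ge>X1. dist (g (\<Xi> x)) l < e"
    unfolding eventually_at_top_linorder by (elim exE)
  define X where "X = max X1 (x0 + 1)"
  have X: "x0 < X" "X1 \<le> X" by (auto simp: X_def)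
  show "\<forall>\<^sub>F t in at_top. dist (g t) l < e"
  proof (rule eventually_at_top_linorderI)
    fix t assume t: "\<Xi> X \<le> t"
    obtain y where y: "x0 < y" "t < \<Xi> y" using Xi_unbounded[of t] by (elim exE conjE)
    have Xy: "X \<le> y"
    proof (rule ccontr)
      assume "\<not> X \<le> y"
      then have "\<Xi> y \<le> \<Xi> X" using y(1) by (intro Xi_mono) auto
      with y(2) t show False by simp
    qed
    have "continuous_on {X..y} \<Xi>"
    proof (intro continuous_at_imp_continuous_on ballI)
      fix s assume "s \<in> {X..y}"
      then have "x0 < s" using X by simp
      then show "isCont \<Xi> s" by (rule DERIV_isCont[OF Xi_derivative])
    qed
    from IVT'[OF t less_imp_le[OF y(2)] Xy this] obtain x where "X \<le> x" "\<Xi> x = t"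
      by (elim exE conjE)
    then show "dist (g t) l < e" using X1[rule_format, of x] X by simp
  qed
qed

section \<open>Uniqueness of the asymptotic coefficients\<close>

text \<open>
  Dividing by the positive amplitude replaces the existentially quantified remainder by an
  explicit one.
\<close>

lemma has_asymptotics_iff:
  "has_asymptotics p q x0 u s \<longleftrightarrow>
    ((\<lambda>x. u x / of_real (a x) - (fst s * cis (\<Xi> x) + snd s * cis (- \<Xi> x))) \<longlongrightarrow> 0) at_top"
  (is "_ \<longleftrightarrow> (?r \<longlongrightarrow> 0) at_top")
proof
  assume "has_asymptotics p q x0 u s"
  then obtain r where r: "(r \<longlongrightarrow> 0) at_top"
    "\<forall>\<^sub>F x in at_top. u x = complex_of_real (a x) * (fst s * cis (\<Xi> x) + snd s * cis (- \<Xi> x) + r x)"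
    unfolding has_asymptotics_def by (elim exE conjE)
  have "\<forall>\<^sub>F x in at_top. r x = ?r x"
    using r(2) eventually_ge_at_top[of x0]
  proof eventually_elim
    case (elim x)
    then show ?case using amp_pos[of x] by simp
  qed
  with r(1) show "(?r \<longlongrightarrow> 0) at_top" by (rule Lim_transform_eventually)
next
  assume r: "(?r \<longlongrightarrow> 0) at_top"
  have "\<forall>\<^sub>F x in at_top. u x = complex_of_real (a x) * (fst s * cis (\<Xi> x) + snd s * cis (- \<Xi> x) + ?r x)"
    using eventually_ge_at_top[of x0]
  proof eventually_elim
    case (elim x)
    then show ?case using amp_pos[of x] by simp
  qed
  with r show "has_asymptotics p q x0 u s"
    unfolding has_asymptotics_def by (intro exI[of _ ?r] conjI)
qed

text \<open>
  A periodic function with limit \<open>0\<close> vanishes.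
\<close>

lemma phase_combination_zero:
  assumes "((\<lambda>x. c * cis (\<Xi> x) + d * cis (- \<Xi> x)) \<longlongrightarrow> 0) at_top"
  shows "c = 0" "d = 0"
proof -
  define g where "g t = c * cis t + d * cis (- t)" for t
  have lim: "(g \<longlongrightarrow> 0) at_top"
    by (rule tendsto_of_phase) (use assms in \<open>simp add: g_def\<close>)
  have g0: "g t = 0" for t
  proof -
    have period: "g (t + 2 * pi * real n) = g t" for n
    proof -
      have "cis (2 * pi * real n) = 1"
        by (rule cis_multiple_2pi) simp
      moreover have "cis (- (2 * pi * real n)) = 1"
        unfolding cis_cnj[symmetric] calculation by simp
      moreover have "g (t + s) = c * (cis t * cis s) + d * (cis (- t) * cis (- s))" for s
        by (simp only: g_def cis_mult minus_add_distrib)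
      ultimately show ?thesis
        by (simp add: g_def)
    qed
    have "filterlim (\<lambda>n. t + 2 * pi * real n) at_top sequentially"
      by (rule filterlim_tendsto_add_at_top[OF tendsto_const
          filterlim_tendsto_pos_mult_at_top[OF tendsto_const _ filterlim_real_sequentially]]) simp
    from filterlim_compose[OF lim this] have "(\<lambda>n. g t) \<longlonglongrightarrow> 0"
      by (simp add: period)
    then show ?thesis by (simp add: LIMSEQ_const_iff)
  qed
  have "c + d = 0" using g0[of 0] by (simp add: g_def)
  moreover have "\<i> * (c - d) = 0"
    using g0[of "pi / 2"] unfolding g_def cis_pi_half cis_minus_pi_half by algebra
  then have "c = d" by simp
  ultimately show "c = 0" "d = 0" by simp_all
qed

lemma has_asymptotics_unique:
  assumes s: "has_asymptotics p q x0 u s" and t: "has_asymptotics p q x0 u t"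
  shows "s = t"
proof -
  have "((\<lambda>x. (u x / of_real (a x) - (fst t * cis (\<Xi> x) + snd t * cis (- \<Xi> x)))
      - (u x / of_real (a x) - (fst s * cis (\<Xi> x) + snd s * cis (- \<Xi> x)))) \<longlongrightarrow> 0 - 0) at_top"
    using s t unfolding has_asymptotics_iff by (intro tendsto_diff)
  then have "((\<lambda>x. (fst s - fst t) * cis (\<Xi> x) + (snd s - snd t) * cis (- \<Xi> x)) \<longlongrightarrow> 0) at_top"
    by (simp add: algebra_simps)
  from phase_combination_zero[OF this] show ?thesis
    by (simp add: prod_eq_iff)
qed

lemma s_plus_minus:
  assumes "has_asymptotics p q x0 u s"
  shows "s_plus p q x0 u = fst s" "s_minus p q x0 u = snd s"
proof -
  have "(THE s. has_asymptotics p q x0 u s) = s"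
    using assms has_asymptotics_unique[OF _ assms] by (rule the_equality)
  then show "s_plus p q x0 u = fst s" "s_minus p q x0 u = snd s"
    by (simp_all add: s_plus_def s_minus_def)
qed

end

section \<open>Complex conjugation of solutions\<close>

context sturm_liouville
begin

lemma is_solutionI:
  assumes u: "\<And>x. 0 < x \<Longrightarrow> (u has_vector_derivative g x) (at x)"
    and flux: "\<And>x. 0 < x \<Longrightarrow>
      ((\<lambda>y. complex_of_real (p y) * g y) has_vector_derivative - (of_real (q x) + z) * u x) (at x)"
  shows "is_solution p q z u"
  unfolding is_solution_def
proof (intro allI impI conjI)
  fix x :: real assume x: "0 < x"
  have g: "vderiv u y = g y" if "0 < y" for y
    using u[OF that] by (rule vector_derivative_at)
  have F: "((\<lambda>y. complex_of_real (p y) * vderiv u y) has_vector_derivative - (of_real (q x) + z) * u x) (at x)"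
    using flux[OF x]
    by (rule has_vector_derivative_transform_within_open[of _ _ _ "{0<..}"]) (use x g in auto)
  show "u differentiable (at x)"
    using u[OF x] by (rule differentiableI_vector)
  show "(\<lambda>y. complex_of_real (p y) * vderiv u y) differentiable (at x)"
    using F by (rule differentiableI_vector)
  show "H_expr p q u x = z * u x"
    unfolding H_expr_def vector_derivative_at[OF F] by (simp add: algebra_simps)
qed

lemma vderiv_cnj:
  assumes "is_solution p q z u" "0 < x"
  shows "vderiv (\<lambda>x. cnj (u x)) x = cnj (vderiv u x)"
  by (rule vector_derivative_at)
     (rule bounded_linear.has_vector_derivative[OF bounded_linear_cnj solution_derivative[OF assms]])

lemma solution_cnj:
  assumes u: "is_solution p q z u"
  shows "is_solution p q (cnj z) (\<lambda>x. cnj (u x))"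
proof (rule is_solutionI)
  fix x :: real assume x: "0 < x"
  show "((\<lambda>x. cnj (u x)) has_vector_derivative cnj (vderiv u x)) (at x)"
    by (rule bounded_linear.has_vector_derivative[OF bounded_linear_cnj solution_derivative[OF u x]])
  have "((\<lambda>x. cnj (flux u x)) has_vector_derivative cnj (- (of_real (q x) + z) * u x)) (at x)"
    by (rule bounded_linear.has_vector_derivative[OF bounded_linear_cnj solution_flux_derivative[OF u x]])
  then show "((\<lambda>y. complex_of_real (p y) * cnj (vderiv u y)) has_vector_derivative
      - (of_real (q x) + cnj z) * cnj (u x)) (at x)"
    by (simp add: flux_def)
qed

lemma initial_values_cnj:
  assumes u: "is_solution p q z u" and "initial_values u c d"
  shows "initial_values (\<lambda>x. cnj (u x)) (cnj c) (cnj d)"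
proof -
  have d: "((\<lambda>x. cnj (vderiv u x)) \<longlongrightarrow> cnj d) (at_right 0)"
    and c: "((\<lambda>x. cnj (u x)) \<longlongrightarrow> cnj c) (at_right 0)"
    using assms(2) unfolding initial_values_def by (auto intro: tendsto_cnj)
  have "\<forall>\<^sub>F x in at_right 0. cnj (vderiv u x) = vderiv (\<lambda>x. cnj (u x)) x"
    by (intro eventually_at_right_0I vderiv_cnj[OF u, symmetric])
  with d have "(vderiv (\<lambda>x. cnj (u x)) \<longlongrightarrow> cnj d) (at_right 0)"
    by (rule Lim_transform_eventually)
  with c show ?thesis
    unfolding initial_values_def by (rule conjI)
qed

end

section \<open>Asymptotics of solutions\<close>

lemma tendsto_mult_bounded_zero:
  fixes f g :: "real \<Rightarrow> complex"
  assumes f: "(f \<longlongrightarrow> 0) F" and g: "\<And>x. cmod (g x) \<le> M"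
  shows "((\<lambda>x. f x * g x) \<longlongrightarrow> 0) F"
proof (rule tendsto_0_le[OF f])
  show "\<forall>\<^sub>F x in F. norm (f x * g x) \<le> norm (f x) * M"
    by (intro always_eventually allI) (simp add: norm_mult mult_left_mono g)
qed

lemma asymp_equiv_unimodular:
  fixes f e :: "real \<Rightarrow> complex" and m :: "real \<Rightarrow> real"
  assumes f: "f \<sim>[at_top] (\<lambda>x. of_real (m x) * e x)"
    and m: "\<forall>\<^sub>F x in at_top. 0 < m x" and e: "\<And>x. cmod (e x) = 1"
  shows "((\<lambda>x. f x / of_real (m x) - e x) \<longlongrightarrow> 0) at_top"
proof -
  have ne: "\<forall>\<^sub>F x in at_top. f x \<noteq> 0 \<or> complex_of_real (m x) * e x \<noteq> 0"
    using m
  proof eventually_elim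
    case (elim x)
    then show ?case using e[of x] by auto
  qed
  have "((\<lambda>x. f x / (of_real (m x) * e x) - 1) \<longlongrightarrow> 1 - 1) at_top"
    by (intro tendsto_diff asymp_equivD_strong[OF f ne] tendsto_const)
  then have "((\<lambda>x. f x / (of_real (m x) * e x) - 1) \<longlongrightarrow> 0) at_top" by simp
  then show ?thesis
  proof (rule tendsto_0_le[where K = 1])
    show "\<forall>\<^sub>F x in at_top. norm (f x / of_real (m x) - e x) \<le> norm (f x / (of_real (m x) * e x) - 1) * 1"
      using m
    proof eventually_elim
      case (elim x)
      have "e x \<noteq> 0" using e[of x] by auto
      then have "f x / of_real (m x) - e x = (f x / (of_real (m x) * e x) - 1) * e x"
        using elim by (simp add: left_diff_distrib)
      then show ?case by (simp add: norm_mult e)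
    qed
  qed
qed

context quasiclassical
begin

lemma jost_asymptotics:
  assumes "jost_solution p q x0 \<zeta> f"
  shows "((\<lambda>x. f x / of_real (a x) - cis (\<Xi> x)) \<longlongrightarrow> 0) at_top"
    and "((\<lambda>x. vderiv f x / of_real (\<xi> x * a x) - \<i> * cis (\<Xi> x)) \<longlongrightarrow> 0) at_top"
proof -
  show "((\<lambda>x. f x / of_real (a x) - cis (\<Xi> x)) \<longlongrightarrow> 0) at_top"
  proof (rule asymp_equiv_unimodular)
    show "\<forall>\<^sub>F x in at_top. 0 < a x"
      using eventually_ge_at_top[of x0] by eventually_elim (rule amp_pos)
  qed (use assms in \<open>simp_all add: jost_solution_def\<close>)
  show "((\<lambda>x. vderiv f x / of_real (\<xi> x * a x) - \<i> * cis (\<Xi> x)) \<longlongrightarrow> 0) at_top"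
  proof (rule asymp_equiv_unimodular)
    show "\<forall>\<^sub>F x in at_top. 0 < \<xi> x * a x"
      using eventually_ge_at_top[of x0] by eventually_elim (intro mult_pos_pos xi_pos amp_pos)
    have "vderiv f \<sim>[at_top] (\<lambda>x. \<i> * complex_of_real (\<xi> x * a x) * cis (\<Xi> x))"
      using assms by (simp only: jost_solution_def)
    moreover have "(\<lambda>x. \<i> * complex_of_real (\<xi> x * a x) * cis (\<Xi> x))
        = (\<lambda>x. of_real (\<xi> x * a x) * (\<i> * cis (\<Xi> x)))"
      by (simp only: mult_ac)
    ultimately show "vderiv f \<sim>[at_top] (\<lambda>x. of_real (\<xi> x * a x) * (\<i> * cis (\<Xi> x)))"
      by simp
  qed (simp add: norm_mult)
qed

lemma solution_asymptotics:
  assumes f: "jost_solution p q x0 \<zeta> f" and g: "jost_solution p q x0 \<zeta>' g"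
    and u: "\<And>x. 0 < x \<Longrightarrow> u x = \<sigma> * f x + \<mu> * cnj (g x)"
  shows "has_asymptotics p q x0 u (\<sigma>, \<mu>)"
    and "((\<lambda>x. vderiv u x / of_real (\<xi> x * a x) - \<i> * (\<sigma> * cis (\<Xi> x) - \<mu> * cis (- \<Xi> x))) \<longlongrightarrow> 0) at_top"
proof -
  have fs: "is_solution p q \<zeta> f" and gs: "is_solution p q \<zeta>' g"
    using f g by (simp_all add: jost_solution_def)
  have du: "vderiv u x = \<sigma> * vderiv f x + \<mu> * cnj (vderiv g x)" if x: "0 < x" for x
  proof (rule vector_derivative_at)
    have "((\<lambda>x. \<sigma> * f x + \<mu> * cnj (g x)) has_vector_derivative \<sigma> * vderiv f x + \<mu> * cnj (vderiv g x)) (at x)"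
      by (intro has_vector_derivative_add has_vector_derivative_mult_right solution_derivative[OF fs x]
          bounded_linear.has_vector_derivative[OF bounded_linear_cnj solution_derivative[OF gs x]])
    then show "(u has_vector_derivative \<sigma> * vderiv f x + \<mu> * cnj (vderiv g x)) (at x)"
      by (rule has_vector_derivative_transform_within_open[of _ _ _ "{0<..}"]) (use x u in auto)
  qed
  have pos: "\<forall>\<^sub>F x in at_top. (0::real) < x" by (rule eventually_gt_at_top)
  have "((\<lambda>x. \<sigma> * (f x / of_real (a x) - cis (\<Xi> x)) + \<mu> * cnj (g x / of_real (a x) - cis (\<Xi> x)))
      \<longlongrightarrow> \<sigma> * 0 + \<mu> * cnj 0) at_top"
    by (intro tendsto_add tendsto_mult tendsto_const tendsto_cnj jost_asymptotics(1)[OF f] jost_asymptotics(1)[OF g])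
  then have "((\<lambda>x. \<sigma> * (f x / of_real (a x) - cis (\<Xi> x)) + \<mu> * cnj (g x / of_real (a x) - cis (\<Xi> x)))
      \<longlongrightarrow> 0) at_top" by simp
  then show "has_asymptotics p q x0 u (\<sigma>, \<mu>)"
    unfolding has_asymptotics_iff
  proof (rule Lim_transform_eventually)
    show "\<forall>\<^sub>F x in at_top. \<sigma> * (f x / of_real (a x) - cis (\<Xi> x)) + \<mu> * cnj (g x / of_real (a x) - cis (\<Xi> x))
        = u x / of_real (a x) - (fst (\<sigma>, \<mu>) * cis (\<Xi> x) + snd (\<sigma>, \<mu>) * cis (- \<Xi> x))"
      using pos by eventually_elim
        (simp add: u cis_cnj add_divide_distrib right_diff_distrib)
  qed
  have "((\<lambda>x. \<sigma> * (vderiv f x / of_real (\<xi> x * a x) - \<i> * cis (\<Xi> x))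
        + \<mu> * cnj (vderiv g x / of_real (\<xi> x * a x) - \<i> * cis (\<Xi> x))) \<longlongrightarrow> \<sigma> * 0 + \<mu> * cnj 0) at_top"
    by (intro tendsto_add tendsto_mult tendsto_const tendsto_cnj jost_asymptotics(2)[OF f] jost_asymptotics(2)[OF g])
  then have "((\<lambda>x. \<sigma> * (vderiv f x / of_real (\<xi> x * a x) - \<i> * cis (\<Xi> x))
        + \<mu> * cnj (vderiv g x / of_real (\<xi> x * a x) - \<i> * cis (\<Xi> x))) \<longlongrightarrow> 0) at_top" by simp
  then show "((\<lambda>x. vderiv u x / of_real (\<xi> x * a x) - \<i> * (\<sigma> * cis (\<Xi> x) - \<mu> * cis (- \<Xi> x))) \<longlongrightarrow> 0) at_top"
  proof (rule Lim_transform_eventually)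
    show "\<forall>\<^sub>F x in at_top. \<sigma> * (vderiv f x / of_real (\<xi> x * a x) - \<i> * cis (\<Xi> x))
        + \<mu> * cnj (vderiv g x / of_real (\<xi> x * a x) - \<i> * cis (\<Xi> x))
        = vderiv u x / of_real (\<xi> x * a x) - \<i> * (\<sigma> * cis (\<Xi> x) - \<mu> * cis (- \<Xi> x))"
      using pos
    proof eventually_elim
      case (elim x)
      show ?case
        unfolding du[OF elim] complex_cnj_diff complex_cnj_divide complex_cnj_mult complex_cnj_i
          complex_cnj_complex_of_real cis_cnj add_divide_distrib
        by (simp add: algebra_simps)
    qed
  qed
qed

text \<open>
  Such a function is bounded near the origin and is at infinity bounded by a multiple of the
  amplitude, which is square integrable.
\<close>

lemma L2_of_asymptotics:
  assumes cont: "continuous_on {0<..} u" and u0: "(u \<longlongrightarrow> c) (at_right 0)"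
    and asym: "has_asymptotics p q x0 u s"
  shows "u \<in> L2"
proof -
  define r where "r x = u x / of_real (a x) - (fst s * cis (\<Xi> x) + snd s * cis (- \<Xi> x))" for x
  have "(r \<longlongrightarrow> 0) at_top"
    using asym unfolding has_asymptotics_iff r_def .
  from tendstoD[OF this zero_less_one] obtain X0 where X0: "\<forall>x\<ge>X0. dist (r x) 0 < 1"
    unfolding eventually_at_top_linorder by (elim exE) simp
  define X where "X = max X0 (x0 + 1)"
  have X: "x0 < X" "X0 \<le> X" by (auto simp: X_def)
  define C where "C = cmod (fst s) + cmod (snd s) + 1"
  have far: "cmod (u x) \<le> C * a x" if "X \<le> x" for x
  proof -
    have ax: "0 < a x" using amp_pos[of x] that X by simp
    have "cmod (u x / of_real (a x)) = cmod (r x + fst s * cis (\<Xi> x) + snd s * cis (- \<Xi> x))"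
      by (simp add: r_def)
    also have "\<dots> \<le> cmod (r x) + cmod (fst s) + cmod (snd s)"
      by (rule order_trans[OF norm_triangle_ineq add_mono[OF order_trans[OF norm_triangle_ineq]]])
         (simp_all add: norm_mult)
    also have "\<dots> \<le> C"
      using X0[rule_format, of x] that X by (simp add: C_def)
    finally show ?thesis
      using ax by (simp add: norm_divide pos_divide_le_eq)
  qed
  have "\<forall>\<^sub>F x in at_right 0. dist (u x) c < 1"
    using tendstoD[OF u0, of 1] by simp
  then obtain d where d: "0 < d" "\<forall>y>0. y < d \<longrightarrow> dist (u y) c < 1"
    unfolding eventually_at_right_field by (elim exE conjE)
  have sub: "{d..X} \<subseteq> {0<..}" using d(1) by auto
  have "bounded (u ` {d..X})"
    by (intro compact_imp_bounded compact_continuous_image continuous_on_subset[OF cont sub] compact_Icc)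
  then obtain M where M: "\<forall>y\<in>u ` {d..X}. cmod y \<le> M"
    unfolding bounded_iff by (elim exE)
  define M' where "M' = max M (cmod c + 1)"
  have near: "cmod (u x) \<le> M'" if "0 < x" "x \<le> X" for x
  proof (cases "x < d")
    case True
    then have "cmod (u x - c) < 1" using d(2) that by (simp add: dist_norm)
    then have "cmod (u x) < cmod c + 1"
      using norm_triangle_sub[of "u x" c] by simp
    then show ?thesis by (simp add: M'_def)
  next
    case False
    then show ?thesis using M that by (simp add: M'_def le_max_iff_disj)
  qed
  have meas: "u \<in> borel_measurable half_line"
    using cont by (rule continuous_on_imp_measurable_half_line)
  have "set_integrable lebesgue {0<..} (\<lambda>x. (cmod (u x))\<^sup>2)"
  proof (rule set_integrable_bound)
    have 1: "integrable lebesgue (\<lambda>x. indicat_real {0<..X} x * M'\<^sup>2)"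
      by (rule integrable_mult_left) (use X x0_pos in \<open>simp add: integrable_indicator_iff\<close>)
    have 2: "integrable lebesgue (\<lambda>x. C\<^sup>2 * (indicat_real {x0<..} x * (a x)\<^sup>2))"
      using amp_L2 unfolding set_integrable_def by (intro integrable_mult_right) simp
    have 3: "integrable lebesgue (\<lambda>x. indicat_real {0<..X} x * M'\<^sup>2 + C\<^sup>2 * (indicat_real {x0<..} x * (a x)\<^sup>2))"
      using 1 2 by (rule Bochner_Integration.integrable_add)
    show "set_integrable lebesgue {0<..} (\<lambda>x. indicat_real {0<..X} x * M'\<^sup>2 + C\<^sup>2 * (indicat_real {x0<..} x * (a x)\<^sup>2))"
      unfolding set_integrable_def by (rule integrable_mult_indicator[OF _ 3]) simp
    have "(\<lambda>x. (cmod (u x))\<^sup>2) \<in> borel_measurable half_line"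
      using meas by measurable
    then show "set_borel_measurable lebesgue {0<..} (\<lambda>x. (cmod (u x))\<^sup>2)"
      unfolding set_borel_measurable_def by (subst (asm) borel_measurable_restrict_space_iff) simp_all
    show "AE x in lebesgue. x \<in> {0<..} \<longrightarrow> norm ((cmod (u x))\<^sup>2)
        \<le> norm (indicat_real {0<..X} x * M'\<^sup>2 + C\<^sup>2 * (indicat_real {x0<..} x * (a x)\<^sup>2))"
    proof (intro AE_I2 impI)
      fix x :: real assume "x \<in> {0<..}"
      then have x: "0 < x" by simp
      have nn: "0 \<le> indicat_real {0<..X} x * M'\<^sup>2" "0 \<le> C\<^sup>2 * (indicat_real {x0<..} x * (a x)\<^sup>2)"
        by simp_all
      have "(cmod (u x))\<^sup>2 \<le> indicat_real {0<..X} x * M'\<^sup>2 + C\<^sup>2 * (indicat_real {x0<..} x * (a x)\<^sup>2)"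
      proof (cases "x \<le> X")
        case True
        have "(cmod (u x))\<^sup>2 \<le> M'\<^sup>2" using near[OF x True] by (rule power_mono) simp
        moreover have "indicat_real {0<..X} x * M'\<^sup>2 = M'\<^sup>2" using True x by simp
        ultimately show ?thesis using nn(2) by linarith
      next
        case False
        have "(cmod (u x))\<^sup>2 \<le> (C * a x)\<^sup>2" using far[of x] False by (intro power_mono) auto
        moreover have "C\<^sup>2 * (indicat_real {x0<..} x * (a x)\<^sup>2) = (C * a x)\<^sup>2"
          using False X by (simp add: power_mult_distrib)
        ultimately show ?thesis using nn(1) by linarith
      qed
      with nn show "norm ((cmod (u x))\<^sup>2)
        \<le> norm (indicat_real {0<..X} x * M'\<^sup>2 + C\<^sup>2 * (indicat_real {x0<..} x * (a x)\<^sup>2))"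
        by simp
    qed
  qed
  with meas show ?thesis
    unfolding L2_def by (simp only: integrable_half_line_iff mem_Collect_eq simp_thms)
qed

lemma Im_mult_cnj_combination:
  "Im ((A + B) * cnj (\<i> * (A - B))) = (cmod B)\<^sup>2 - (cmod A)\<^sup>2"
  by (simp only: cmod_power2) (simp add: power2_eq_square algebra_simps)

text \<open>
  Put \<open>w = W(u, cnj u) / (2 \<i> Im z)\<close>. Then \<open>w' = |u|\<^sup>2\<close>. At the origin \<open>w\<close> tends to \<open>0\<close> because the
  boundary data are real, and at infinity to a multiple of \<open>|\<sigma>|\<^sup>2 - |\<mu>|\<^sup>2\<close>. If this difference
  vanished, the nondecreasing function \<open>w\<close> would be \<open>0\<close> and so would \<open>u\<close>.
\<close>

lemma coefficients_nondegenerate: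
  assumes z: "Im z \<noteq> 0" and u: "is_solution p q z u"
    and init: "initial_values u (of_real c) (of_real d)"
    and asym: "has_asymptotics p q x0 u (\<sigma>, \<mu>)"
    and asym': "((\<lambda>x. vderiv u x / of_real (\<xi> x * a x) - \<i> * (\<sigma> * cis (\<Xi> x) - \<mu> * cis (- \<Xi> x))) \<longlongrightarrow> 0) at_top"
    and nonzero: "0 < x1" "u x1 \<noteq> 0"
  shows "cmod \<sigma> \<noteq> cmod \<mu>"
proof
  assume eq: "cmod \<sigma> = cmod \<mu>"
  \<comment> \<open>\<open>W\<close> is purely imaginary, so its imaginary part carries all information.\<close>
  define W where "W = wronskian p u (\<lambda>x. cnj (u x))"
  define w where "w x = Im (W x) / (2 * Im z)" for x
  have w_derivative: "(w has_real_derivative (cmod (u x))\<^sup>2) (at x)" if x: "0 < x" for x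
  proof -
    have "(W has_vector_derivative (z - cnj z) * (u x * cnj (u x))) (at x)"
      unfolding W_def by (rule wronskian_solutions_derivative[OF u solution_cnj[OF u] x])
    from bounded_linear.has_vector_derivative[OF bounded_linear_Im this]
    have "((\<lambda>x. Im (W x)) has_real_derivative Im ((z - cnj z) * (u x * cnj (u x)))) (at x)"
      by (simp add: has_real_derivative_iff_has_vector_derivative)
    from DERIV_cdivide[OF this, of "2 * Im z"]
    have "(w has_real_derivative Im ((z - cnj z) * (u x * cnj (u x))) / (2 * Im z)) (at x)"
      unfolding w_def[abs_def] .
    moreover have "Im ((z - cnj z) * (u x * cnj (u x))) / (2 * Im z) = (cmod (u x))\<^sup>2"
      using z by (simp add: complex_mult_cnj cmod_power2 complex_diff_cnj flip: of_real_power of_real_add)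
    ultimately show ?thesis by simp
  qed
  have "(W \<longlongrightarrow> of_real (p 0) * (of_real c * cnj (of_real d) - of_real d * cnj (of_real c))) (at_right 0)"
    unfolding W_def by (rule wronskian_initial_values[OF init initial_values_cnj[OF u init]])
  then have "(W \<longlongrightarrow> 0) (at_right 0)" by (simp add: mult.commute)
  then have "((\<lambda>x. Im (W x) / (2 * Im z)) \<longlongrightarrow> Im 0 / (2 * Im z)) (at_right 0)"
    using z by (intro tendsto_divide tendsto_Im tendsto_const) simp_all
  then have w0: "(w \<longlongrightarrow> 0) (at_right 0)" by (simp add: w_def[abs_def])
  have w_inf: "(w \<longlongrightarrow> 0) at_top"
  proof -
    define A where "A x = \<sigma> * cis (\<Xi> x)" for x
    define B where "B x = \<mu> * cis (- \<Xi> x)" for x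
    define X where "X x = u x / of_real (a x)" for x
    define Y where "Y x = vderiv u x / of_real (\<xi> x * a x)" for x
    have XY: "((\<lambda>x. X x - (A x + B x)) \<longlongrightarrow> 0) at_top" "((\<lambda>x. Y x - \<i> * (A x - B x)) \<longlongrightarrow> 0) at_top"
      using asym asym' unfolding has_asymptotics_iff X_def Y_def A_def B_def by simp_all
    have bnd: "cmod (A x + B x) \<le> cmod \<sigma> + cmod \<mu>" "cmod (cnj (\<i> * (A x - B x))) \<le> cmod \<sigma> + cmod \<mu>" for x
      using norm_triangle_ineq[of "A x" "B x"] norm_triangle_ineq4[of "A x" "B x"]
      unfolding complex_mod_cnj norm_mult by (simp_all add: A_def B_def norm_mult)
    \<comment> \<open>The errors of \<open>X\<close> and \<open>Y\<close> tend to \<open>0\<close> and the leading terms are bounded.\<close>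
    have "((\<lambda>x. (X x - (A x + B x)) * cnj (\<i> * (A x - B x)) + cnj (Y x - \<i> * (A x - B x)) * (A x + B x)
        + (X x - (A x + B x)) * cnj (Y x - \<i> * (A x - B x))) \<longlongrightarrow> 0 + 0 + 0 * cnj 0) at_top"
    proof (intro tendsto_add tendsto_mult tendsto_cnj XY)
      show "((\<lambda>x. (X x - (A x + B x)) * cnj (\<i> * (A x - B x))) \<longlongrightarrow> 0) at_top"
        by (rule tendsto_mult_bounded_zero[OF XY(1) bnd(2)])
      have "((\<lambda>x. cnj (Y x - \<i> * (A x - B x))) \<longlongrightarrow> cnj 0) at_top"
        by (intro tendsto_cnj XY(2))
      then have "((\<lambda>x. cnj (Y x - \<i> * (A x - B x))) \<longlongrightarrow> 0) at_top" by simp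
      then show "((\<lambda>x. cnj (Y x - \<i> * (A x - B x)) * (A x + B x)) \<longlongrightarrow> 0) at_top"
        by (rule tendsto_mult_bounded_zero[OF _ bnd(1)])
    qed
    then have "((\<lambda>x. X x * cnj (Y x) - (A x + B x) * cnj (\<i> * (A x - B x))) \<longlongrightarrow> 0) at_top"
      by (simp add: algebra_simps)
    then have "((\<lambda>x. Im (X x * cnj (Y x) - (A x + B x) * cnj (\<i> * (A x - B x)))) \<longlongrightarrow> Im 0) at_top"
      by (rule tendsto_Im)
    moreover have "Im ((A x + B x) * cnj (\<i> * (A x - B x))) = 0" for x
      unfolding Im_mult_cnj_combination by (simp add: A_def B_def norm_mult eq)
    ultimately have "((\<lambda>x. Im (X x * cnj (Y x))) \<longlongrightarrow> 0) at_top"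
      by (simp only: minus_complex.sel diff_0_right zero_complex.sel)
    then have "((\<lambda>x. 2 * Im (X x * cnj (Y x)) / (2 * Im z)) \<longlongrightarrow> 2 * 0 / (2 * Im z)) at_top"
      using z by (intro tendsto_divide tendsto_mult tendsto_const) simp_all
    then have "((\<lambda>x. 2 * Im (X x * cnj (Y x)) / (2 * Im z)) \<longlongrightarrow> 0) at_top" by simp
    then show ?thesis
    proof (rule Lim_transform_eventually)
      show "\<forall>\<^sub>F x in at_top. 2 * Im (X x * cnj (Y x)) / (2 * Im z) = w x"
        using eventually_ge_at_top[of x0]
      proof eventually_elim
        case (elim x)
        have x: "0 < x" using elim x0_pos by simp
        have ne: "complex_of_real (a x) \<noteq> 0" "complex_of_real (\<xi> x * a x) \<noteq> 0"
          using amp_pos[OF elim] xi_pos[OF elim] by simp_all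
        have uX: "u x = of_real (a x) * X x" and uY: "vderiv u x = of_real (\<xi> x * a x) * Y x"
          using ne by (simp_all add: X_def Y_def)
        have "W x = of_real (p x * \<xi> x * (a x)\<^sup>2) * (X x * cnj (Y x) - Y x * cnj (X x))"
          unfolding W_def wronskian_def vderiv_cnj[OF u x] uX uY
          by (simp add: power2_eq_square algebra_simps)
        also have "\<dots> = X x * cnj (Y x) - cnj (X x * cnj (Y x))"
          unfolding xi_amp[OF elim] by (simp add: mult.commute)
        finally have "Im (W x) = 2 * Im (X x * cnj (Y x))" by simp
        then show ?case by (simp add: w_def)
      qed
    qed
  qed
  have mono: "w x \<le> w y" if "0 < x" "x \<le> y" for x y
  proof (rule DERIV_nonneg_imp_nondecreasing[OF that(2)])
    fix t assume "x \<le> t" "t \<le> y"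
    then show "\<exists>d. (w has_real_derivative d) (at t) \<and> 0 \<le> d"
      using that w_derivative[of t] by (intro exI[of _ "(cmod (u t))\<^sup>2"]) simp
  qed
  have w_zero: "w x = 0" if x: "0 < x" for x
  proof (rule antisym)
    show "w x \<le> 0"
    proof (rule tendsto_lowerbound[OF w_inf])
      show "\<forall>\<^sub>F y in at_top. w x \<le> w y"
        using eventually_ge_at_top[of x] by eventually_elim (rule mono[OF x])
    qed simp
    show "0 \<le> w x"
    proof (rule tendsto_upperbound[OF w0])
      show "\<forall>\<^sub>F y in at_right 0. w y \<le> w x"
        by (rule eventually_at_rightI[of 0 x]) (use x in \<open>auto intro: mono\<close>)
    qed simp
  qed
  have "(w has_real_derivative 0) (at x1)"
  proof (rule has_field_derivative_transform_within_open[of "\<lambda>x. 0" _ _ "{0<..}"])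
    show "((\<lambda>x. 0) has_real_derivative 0) (at x1)" by (rule DERIV_const)
  qed (use nonzero(1) w_zero in auto)
  from DERIV_unique[OF w_derivative[OF nonzero(1)] this] nonzero(2) show False by simp
qed

end

section \<open>Boundary values at the origin\<close>

text \<open>
  The values at the origin of the solution and of its derivative. Naming them treats both kinds
  of boundary condition uniformly; that they are real matters for complex conjugation.
\<close>

fun phi_init :: "boundary \<Rightarrow> real \<times> real" where
  "phi_init (Robin \<alpha>) = (1, \<alpha>)"
| "phi_init Dirichlet = (0, 1)"

fun theta_init :: "real \<Rightarrow> boundary \<Rightarrow> real \<times> real" where
  "theta_init p0 (Robin \<alpha>) = (0, - inverse p0)"
| "theta_init p0 Dirichlet = (inverse p0, 0)"

lemma regular_phi_iff:
  "regular_phi p q \<alpha> z u \<longleftrightarrow> is_solution p q z u \<and>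
     initial_values u (of_real (fst (phi_init \<alpha>))) (of_real (snd (phi_init \<alpha>)))"
  by (cases \<alpha>) simp_all

lemma regular_theta_iff:
  "regular_theta p q \<alpha> z u \<longleftrightarrow> is_solution p q z u \<and>
     initial_values u (of_real (fst (theta_init (p 0) \<alpha>))) (of_real (snd (theta_init (p 0) \<alpha>)))"
  by (cases \<alpha>) simp_all

lemma init_determinant:
  assumes "p0 \<noteq> 0"
  shows "complex_of_real p0 * (of_real (fst (phi_init \<alpha>)) * of_real (snd (theta_init p0 \<alpha>))
    - of_real (snd (phi_init \<alpha>)) * of_real (fst (theta_init p0 \<alpha>))) = - 1"
  using assms by (cases \<alpha>) simp_all

lemma boundary_condition_multiple:
  assumes "initial_values u (of_real (fst (phi_init \<alpha>)) * K) (of_real (snd (phi_init \<alpha>)) * K)"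
  shows "boundary_condition \<alpha> u"
proof (cases \<alpha>)
  case (Robin b)
  then show ?thesis using assms by auto
next
  case Dirichlet
  then show ?thesis using assms by (simp add: initial_values_def)
qed

text \<open>
  The Dirichlet condition says nothing about the derivative of \<open>v\<close>, so in this case the limit of
  \<open>v\<close> itself is compared; for a Robin condition the limits of \<open>v\<close> and of \<open>v'\<close> are combined.
\<close>

lemma boundary_condition_excludes_theta:
  assumes bc: "boundary_condition \<alpha> v" and p0: "p0 \<noteq> 0"
    and u: "initial_values u (of_real (fst (phi_init \<alpha>)) * K) (of_real (snd (phi_init \<alpha>)) * K)"
    and phi: "initial_values \<phi> (of_real (fst (phi_init \<alpha>))) (of_real (snd (phi_init \<alpha>)))"
    and theta: "initial_values \<theta> (of_real (fst (theta_init p0 \<alpha>))) (of_real (snd (theta_init p0 \<alpha>)))"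
    and v: "\<And>x. 0 < x \<Longrightarrow> v x = u x + k1 * \<phi> x + k2 * \<theta> x"
    and v': "\<And>x. 0 < x \<Longrightarrow> vderiv v x = vderiv u x + k1 * vderiv \<phi> x + k2 * vderiv \<theta> x"
  shows "k2 = 0"
proof -
  let ?c = "\<lambda>g. complex_of_real (fst g)" and ?d = "\<lambda>g. complex_of_real (snd g)"
  have "((\<lambda>x. u x + k1 * \<phi> x + k2 * \<theta> x) \<longlongrightarrow>
      ?c (phi_init \<alpha>) * K + k1 * ?c (phi_init \<alpha>) + k2 * ?c (theta_init p0 \<alpha>)) (at_right 0)"
    using u phi theta unfolding initial_values_def
    by (intro tendsto_add tendsto_mult tendsto_const) auto
  then have lim: "(v \<longlongrightarrow> ?c (phi_init \<alpha>) * K + k1 * ?c (phi_init \<alpha>) + k2 * ?c (theta_init p0 \<alpha>)) (at_right 0)"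
    by (rule Lim_transform_eventually) (intro eventually_at_right_0I v[symmetric])
  have "((\<lambda>x. vderiv u x + k1 * vderiv \<phi> x + k2 * vderiv \<theta> x) \<longlongrightarrow>
      ?d (phi_init \<alpha>) * K + k1 * ?d (phi_init \<alpha>) + k2 * ?d (theta_init p0 \<alpha>)) (at_right 0)"
    using u phi theta unfolding initial_values_def
    by (intro tendsto_add tendsto_mult tendsto_const) auto
  then have lim': "(vderiv v \<longlongrightarrow> ?d (phi_init \<alpha>) * K + k1 * ?d (phi_init \<alpha>) + k2 * ?d (theta_init p0 \<alpha>)) (at_right 0)"
    by (rule Lim_transform_eventually) (intro eventually_at_right_0I v'[symmetric])
  show ?thesis
  proof (cases \<alpha>)
    case (Robin b)
    then obtain c where "initial_values v c (of_real b * c)"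
      using bc by auto
    then have c: "(v \<longlongrightarrow> c) (at_right 0)" "(vderiv v \<longlongrightarrow> of_real b * c) (at_right 0)"
      by (simp_all add: initial_values_def)
    have "c = K + k1"
      using tendsto_unique[OF _ c(1) lim] Robin by simp
    moreover have "of_real b * c = of_real b * K + k1 * of_real b + k2 * of_real (- inverse p0)"
      using tendsto_unique[OF _ c(2) lim'] Robin by simp
    ultimately have "k2 * of_real (- inverse p0) = 0"
      by (simp add: algebra_simps)
    then show ?thesis using p0 by simp
  next
    case Dirichlet
    have "(v \<longlongrightarrow> 0) (at_right 0)" using bc Dirichlet by simp
    from tendsto_unique[OF _ this lim] show ?thesis using Dirichlet p0 by simp
  qed
qed

section \<open>The resolvent\<close>

text \<open>
  The last hypothesis says that \<open>\<phi>\<close> violates the condition at infinity, that is, that \<open>z\<close> is not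
  an eigenvalue.
\<close>

locale resolvent_setup = quasiclassical +
  fixes \<alpha> :: boundary and \<omega> z \<sigma>\<^sub>p \<sigma>\<^sub>m \<tau>\<^sub>p \<tau>\<^sub>m :: complex and \<phi> \<theta> :: "real \<Rightarrow> complex"
  assumes phi: "regular_phi p q \<alpha> z \<phi>" and theta: "regular_theta p q \<alpha> z \<theta>"
    and phi_asym: "has_asymptotics p q x0 \<phi> (\<sigma>\<^sub>p, \<sigma>\<^sub>m)"
    and theta_asym: "has_asymptotics p q x0 \<theta> (\<tau>\<^sub>p, \<tau>\<^sub>m)"
    and nondegenerate: "\<sigma>\<^sub>p - \<omega> * \<sigma>\<^sub>m \<noteq> 0"
begin

lemma phi_solution: "is_solution p q z \<phi>"
  and phi_initial: "initial_values \<phi> (of_real (fst (phi_init \<alpha>))) (of_real (snd (phi_init \<alpha>)))"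
  using phi unfolding regular_phi_iff by (rule conjunct1, rule conjunct2)

lemma theta_solution: "is_solution p q z \<theta>"
  and theta_initial: "initial_values \<theta> (of_real (fst (theta_init (p 0) \<alpha>))) (of_real (snd (theta_init (p 0) \<alpha>)))"
  using theta unfolding regular_theta_iff by (rule conjunct1, rule conjunct2)

lemma phi_L2: "\<phi> \<in> L2"
  using phi_initial unfolding initial_values_def
  by (intro L2_of_asymptotics[OF solution_cont[OF phi_solution] _ phi_asym]) (rule conjunct1)

lemma theta_L2: "\<theta> \<in> L2"
  using theta_initial unfolding initial_values_def
  by (intro L2_of_asymptotics[OF solution_cont[OF theta_solution] _ theta_asym]) (rule conjunct1)

lemma p0: "p 0 \<noteq> 0"
  using p_pos[of 0] by simp

lemma wronskian_phi_theta: "0 < x \<Longrightarrow> wronskian p \<phi> \<theta> x = - 1"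
  using wronskian_solutions_constant[OF phi_solution theta_solution phi_initial theta_initial]
  by (simp only: init_determinant[OF p0])

definition \<gamma> :: complex where
  "\<gamma> = - ((\<tau>\<^sub>p - \<omega> * \<tau>\<^sub>m) / (\<sigma>\<^sub>p - \<omega> * \<sigma>\<^sub>m))"

text \<open>
  The pairing is bilinear. For \<open>\<psi> = \<phi>\<close> it becomes the inner product of \<open>h\<close> with the regular
  solution at the conjugate spectral parameter.
\<close>

definition moment :: "(real \<Rightarrow> complex) \<Rightarrow> (real \<Rightarrow> complex) \<Rightarrow> complex" where
  "moment \<psi> h = (LINT y:{0<..}|lebesgue. \<psi> y * h y)"

text \<open>
  With this constant \<open>K\<close>, the coefficient \<open>B x\<close> of \<open>\<phi>\<close> is \<open>\<gamma>\<close> times the moment of \<open>h\<close> against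
  \<open>\<phi>\<close> plus the integral of \<open>\<theta> h\<close> over \<open>(x, \<infinity>)\<close>, as in the resolvent formula.
\<close>

definition green :: "(real \<Rightarrow> complex) \<Rightarrow> real \<Rightarrow> complex" where
  "green h = inhomogeneous.sol (\<gamma> * moment \<phi> h + moment \<theta> h) \<phi> \<theta> h"

lemma inhomogeneous: "h \<in> L2 \<Longrightarrow> inhomogeneous p q z \<phi> \<theta> h"
  by unfold_locales (simp_all add: phi_solution theta_solution wronskian_phi_theta phi_L2 theta_L2)

lemma green_formula:
  assumes h: "h \<in> L2" and x: "0 < x"
  shows "green h x = \<gamma> * moment \<phi> h * \<phi> x + quasiresolvent \<phi> \<theta> h x"
proof -
  interpret inhomogeneous p q z "\<gamma> * moment \<phi> h + moment \<theta> h" \<phi> \<theta> h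
    by (rule inhomogeneous[OF h])
  show ?thesis
    unfolding green_def sol_def A_def B_def
    unfolding quasiresolvent_def set_integral_below[OF phi_h] set_integral_above[OF theta_h x] moment_def
    by (simp add: algebra_simps)
qed

text \<open>
  At infinity \<open>A\<close> tends to the moment \<open>c\<close> of \<open>h\<close> against \<open>\<phi>\<close>, and \<open>B\<close> tends to \<open>\<gamma> c\<close>.
\<close>

lemma green_asymptotics:
  assumes h: "h \<in> L2"
  shows "has_asymptotics p q x0 (green h)
    (moment \<phi> h * (\<tau>\<^sub>p + \<gamma> * \<sigma>\<^sub>p), moment \<phi> h * (\<tau>\<^sub>m + \<gamma> * \<sigma>\<^sub>m))"
proof -
  interpret inhomogeneous p q z "\<gamma> * moment \<phi> h + moment \<theta> h" \<phi> \<theta> h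
    by (rule inhomogeneous[OF h])
  define E where "E s t x = s * cis (\<Xi> x) + t * cis (- \<Xi> x)" for s t x
  have E_bound: "cmod (E s t x) \<le> cmod s + cmod t" for s t x
    unfolding E_def by (rule order_trans[OF norm_triangle_ineq]) (simp add: norm_mult)
  have r: "((\<lambda>x. \<phi> x / of_real (a x) - E \<sigma>\<^sub>p \<sigma>\<^sub>m x) \<longlongrightarrow> 0) at_top"
     "((\<lambda>x. \<theta> x / of_real (a x) - E \<tau>\<^sub>p \<tau>\<^sub>m x) \<longlongrightarrow> 0) at_top"
    using phi_asym theta_asym unfolding has_asymptotics_iff E_def by simp_all
  have A_lim: "(A \<longlongrightarrow> moment \<phi> h) at_top"
    unfolding A_def[abs_def] moment_def by (rule integral_tendsto_at_top[OF phi_h])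
  have "(B \<longlongrightarrow> (\<gamma> * moment \<phi> h + moment \<theta> h) - moment \<theta> h) at_top"
    unfolding B_def[abs_def]
    by (intro tendsto_diff tendsto_const integral_tendsto_at_top[OF theta_h, folded moment_def])
  then have B_lim: "(B \<longlongrightarrow> \<gamma> * moment \<phi> h) at_top" by simp
  have "((\<lambda>x. A x - moment \<phi> h) \<longlongrightarrow> moment \<phi> h - moment \<phi> h) at_top"
    by (intro tendsto_diff A_lim tendsto_const)
  then have A0: "((\<lambda>x. A x - moment \<phi> h) \<longlongrightarrow> 0) at_top" by simp
  have "((\<lambda>x. B x - \<gamma> * moment \<phi> h) \<longlongrightarrow> \<gamma> * moment \<phi> h - \<gamma> * moment \<phi> h) at_top"
    by (intro tendsto_diff B_lim tendsto_const)
  then have B0: "((\<lambda>x. B x - \<gamma> * moment \<phi> h) \<longlongrightarrow> 0) at_top" by simp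
  have "((\<lambda>x. ((\<theta> x / of_real (a x) - E \<tau>\<^sub>p \<tau>\<^sub>m x) * A x + (A x - moment \<phi> h) * E \<tau>\<^sub>p \<tau>\<^sub>m x)
      + ((\<phi> x / of_real (a x) - E \<sigma>\<^sub>p \<sigma>\<^sub>m x) * B x + (B x - \<gamma> * moment \<phi> h) * E \<sigma>\<^sub>p \<sigma>\<^sub>m x))
      \<longlongrightarrow> (0 * moment \<phi> h + 0) + (0 * (\<gamma> * moment \<phi> h) + 0)) at_top"
    by (intro tendsto_add tendsto_mult r A_lim B_lim tendsto_mult_bounded_zero[OF A0 E_bound]
        tendsto_mult_bounded_zero[OF B0 E_bound])
  moreover have "((\<theta> x / of_real (a x) - E \<tau>\<^sub>p \<tau>\<^sub>m x) * A x + (A x - moment \<phi> h) * E \<tau>\<^sub>p \<tau>\<^sub>m x)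
      + ((\<phi> x / of_real (a x) - E \<sigma>\<^sub>p \<sigma>\<^sub>m x) * B x + (B x - \<gamma> * moment \<phi> h) * E \<sigma>\<^sub>p \<sigma>\<^sub>m x)
      = green h x / of_real (a x)
        - (moment \<phi> h * (\<tau>\<^sub>p + \<gamma> * \<sigma>\<^sub>p) * cis (\<Xi> x) + moment \<phi> h * (\<tau>\<^sub>m + \<gamma> * \<sigma>\<^sub>m) * cis (- \<Xi> x))" for x
    unfolding green_def sol_def E_def add_divide_distrib by (simp add: algebra_simps)
  ultimately show ?thesis
    unfolding has_asymptotics_iff by simp
qed

text \<open>
  The number \<open>\<gamma>\<close> is the solution of \<open>\<tau>\<^sub>p + \<gamma> \<sigma>\<^sub>p = \<omega> (\<tau>\<^sub>m + \<gamma> \<sigma>\<^sub>m)\<close>.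
\<close>

lemma green_in_domain:
  assumes h: "h \<in> L2"
  shows "green h \<in> dom_H_omega p q x0 \<alpha> \<omega>"
proof -
  interpret inhomogeneous p q z "\<gamma> * moment \<phi> h + moment \<theta> h" \<phi> \<theta> h
    by (rule inhomogeneous[OF h])
  have "boundary_condition \<alpha> (green h)"
    unfolding green_def by (rule boundary_condition_multiple[OF sol_initial_values[OF phi_initial theta_initial]])
  then have "green h \<in> dom_H_max p q \<alpha>"
    unfolding dom_H_max_def green_def using sol_H2_loc sol_L2 H_sol_L2 by simp
  moreover have "\<tau>\<^sub>p + \<gamma> * \<sigma>\<^sub>p = \<omega> * (\<tau>\<^sub>m + \<gamma> * \<sigma>\<^sub>m)"
  proof -
    have "\<gamma> * (\<sigma>\<^sub>p - \<omega> * \<sigma>\<^sub>m) = - (\<tau>\<^sub>p - \<omega> * \<tau>\<^sub>m)"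
      unfolding \<gamma>_def using nondegenerate by simp
    then show ?thesis by algebra
  qed
  then have "s_plus p q x0 (green h) = \<omega> * s_minus p q x0 (green h)"
    unfolding s_plus_minus[OF green_asymptotics[OF h]] by simp
  ultimately show ?thesis by (simp add: dom_H_omega_def)
qed

lemma green_equation:
  assumes h: "h \<in> L2"
  shows "L2_eq (\<lambda>x. H_expr p q (green h) x - z * green h x) h"
proof -
  interpret inhomogeneous p q z "\<gamma> * moment \<phi> h + moment \<theta> h" \<phi> \<theta> h
    by (rule inhomogeneous[OF h])
  show ?thesis unfolding green_def by (rule sol_equation)
qed

text \<open>
  The difference is a combination of \<open>\<phi>\<close> and \<open>\<theta>\<close>. The condition at the origin removes \<open>\<theta>\<close>, and
  the condition at infinity removes \<open>\<phi>\<close>, because \<open>\<phi>\<close> itself violates it.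
\<close>

lemma green_unique:
  assumes h: "h \<in> L2" and v: "v \<in> dom_H_omega p q x0 \<alpha> \<omega>"
    and eq: "L2_eq (\<lambda>x. H_expr p q v x - z * v x) h" and x: "0 < x"
  shows "v x = green h x"
proof -
  interpret inhomogeneous p q z "\<gamma> * moment \<phi> h + moment \<theta> h" \<phi> \<theta> h
    by (rule inhomogeneous[OF h])
  have v_H2: "v \<in> H2_loc" and v_bc: "boundary_condition \<alpha> v"
    and v_s: "s_plus p q x0 v = \<omega> * s_minus p q x0 v"
    using v by (auto simp: dom_H_omega_def dom_H_max_def)
  obtain k1 k2 where k: "\<And>x. 0 < x \<Longrightarrow> v x = sol x + k1 * \<phi> x + k2 * \<theta> x"
    "\<And>x. 0 < x \<Longrightarrow> vderiv v x = vderiv sol x + k1 * vderiv \<phi> x + k2 * vderiv \<theta> x"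
    by (rule solution_difference[OF v_H2 eq]) (rule that; assumption)
  have "k2 = 0"
    by (rule boundary_condition_excludes_theta[OF v_bc p0 sol_initial_values[OF phi_initial theta_initial]
          phi_initial theta_initial k])
  then have v_eq: "v x = green h x + k1 * \<phi> x" if "0 < x" for x
    using k(1)[OF that] by (simp add: green_def)
  define s where "s = moment \<phi> h * (\<tau>\<^sub>p + \<gamma> * \<sigma>\<^sub>p)"
  define t where "t = moment \<phi> h * (\<tau>\<^sub>m + \<gamma> * \<sigma>\<^sub>m)"
  have g_asym: "has_asymptotics p q x0 (green h) (s, t)"
    unfolding s_def t_def by (rule green_asymptotics[OF h])
  have "((\<lambda>x. (green h x / of_real (a x) - (s * cis (\<Xi> x) + t * cis (- \<Xi> x)))
      + k1 * (\<phi> x / of_real (a x) - (\<sigma>\<^sub>p * cis (\<Xi> x) + \<sigma>\<^sub>m * cis (- \<Xi> x)))) \<longlongrightarrow> 0 + k1 * 0) at_top"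
    using g_asym phi_asym unfolding has_asymptotics_iff fst_conv snd_conv
    by (intro tendsto_add tendsto_mult tendsto_const)
  then have "((\<lambda>x. (green h x / of_real (a x) - (s * cis (\<Xi> x) + t * cis (- \<Xi> x)))
      + k1 * (\<phi> x / of_real (a x) - (\<sigma>\<^sub>p * cis (\<Xi> x) + \<sigma>\<^sub>m * cis (- \<Xi> x)))) \<longlongrightarrow> 0) at_top"
    by simp
  then have "has_asymptotics p q x0 v (s + k1 * \<sigma>\<^sub>p, t + k1 * \<sigma>\<^sub>m)"
    unfolding has_asymptotics_iff fst_conv snd_conv
  proof (rule Lim_transform_eventually)
    show "\<forall>\<^sub>F x in at_top. (green h x / of_real (a x) - (s * cis (\<Xi> x) + t * cis (- \<Xi> x)))
        + k1 * (\<phi> x / of_real (a x) - (\<sigma>\<^sub>p * cis (\<Xi> x) + \<sigma>\<^sub>m * cis (- \<Xi> x)))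
        = v x / of_real (a x) - ((s + k1 * \<sigma>\<^sub>p) * cis (\<Xi> x) + (t + k1 * \<sigma>\<^sub>m) * cis (- \<Xi> x))"
      using eventually_gt_at_top[of "0::real"]
      by eventually_elim (simp add: v_eq add_divide_distrib algebra_simps)
  qed
  from v_s[unfolded s_plus_minus[OF this]] have "s + k1 * \<sigma>\<^sub>p = \<omega> * (t + k1 * \<sigma>\<^sub>m)" by simp
  moreover have "s = \<omega> * t"
    using green_in_domain[OF h] unfolding dom_H_omega_def s_plus_minus[OF g_asym]
    by (simp add: s_plus_minus[OF g_asym])
  ultimately have "k1 * (\<sigma>\<^sub>p - \<omega> * \<sigma>\<^sub>m) = 0"
    by algebra
  then have "k1 = 0" using nondegenerate by simp
  then show ?thesis using v_eq[OF x] by simp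
qed

text \<open>
  The pointwise bound \<open>sol_bound\<close> is linear in the norm of \<open>h\<close>, since the constant \<open>K\<close> is a
  combination of two moments, each bounded by the Cauchy-Schwarz inequality.
\<close>

lemma green_bound: "\<exists>C. \<forall>h\<in>L2. L2_norm (green h) \<le> C * L2_norm h"
proof -
  define m where "m = cmod \<gamma> * L2_norm \<phi> + 2 * L2_norm \<theta>"
  define g where "g x = complex_of_real (L2_norm \<phi>) * of_real (cmod (\<theta> x))
      + of_real m * of_real (cmod (\<phi> x))" for x
  have abs_L2: "(\<lambda>x. complex_of_real (cmod (u x))) \<in> L2" if "u \<in> L2" for u
    using that by (auto simp: L2_def intro: borel_measurable_of_real borel_measurable_norm)
  have g_L2: "g \<in> L2"
    unfolding g_def[abs_def] by (intro L2_add L2_scale abs_L2 phi_L2 theta_L2)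
  have m0: "0 \<le> m" by (simp add: m_def L2_norm_nonneg)
  have "L2_norm (green h) \<le> L2_norm g * L2_norm h" if h: "h \<in> L2" for h
  proof -
    interpret inhomogeneous p q z "\<gamma> * moment \<phi> h + moment \<theta> h" \<phi> \<theta> h
      by (rule inhomogeneous[OF h])
    have mom: "cmod (moment \<phi> h) \<le> L2_norm \<phi> * L2_norm h" "cmod (moment \<theta> h) \<le> L2_norm \<theta> * L2_norm h"
      unfolding moment_def by (rule L2_set_integral_bound[OF _ h]; simp add: phi_L2 theta_L2)+
    have K: "cmod (\<gamma> * moment \<phi> h + moment \<theta> h) + L2_norm \<theta> * L2_norm h \<le> m * L2_norm h"
    proof -
      have "cmod (\<gamma> * moment \<phi> h + moment \<theta> h) \<le> cmod \<gamma> * cmod (moment \<phi> h) + cmod (moment \<theta> h)"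
        by (rule order_trans[OF norm_triangle_ineq]) (simp add: norm_mult)
      also have "\<dots> \<le> cmod \<gamma> * (L2_norm \<phi> * L2_norm h) + L2_norm \<theta> * L2_norm h"
        by (intro add_mono mult_left_mono mom) simp
      finally show ?thesis by (simp add: m_def algebra_simps)
    qed
    have "cmod (green h x) \<le> cmod (of_real (L2_norm h) * g x)" for x
    proof -
      have "cmod (green h x) \<le> L2_norm \<phi> * L2_norm h * cmod (\<theta> x)
          + (cmod (\<gamma> * moment \<phi> h + moment \<theta> h) + L2_norm \<theta> * L2_norm h) * cmod (\<phi> x)"
        using sol_bound[of x] unfolding green_def norm_mult norm_of_real
        by (simp add: L2_norm_nonneg norm_mult)
      also have "\<dots> \<le> L2_norm \<phi> * L2_norm h * cmod (\<theta> x) + (m * L2_norm h) * cmod (\<phi> x)"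
        by (intro add_left_mono mult_right_mono K) simp
      also have "\<dots> = L2_norm h * (L2_norm \<phi> * cmod (\<theta> x) + m * cmod (\<phi> x))"
        by (simp add: algebra_simps)
      also have "\<dots> = cmod (of_real (L2_norm h) * g x)"
        unfolding g_def of_real_mult[symmetric] of_real_add[symmetric] norm_of_real
        using m0 by (simp add: L2_norm_nonneg abs_mult abs_of_nonneg)
      finally show ?thesis .
    qed
    then have "L2_norm (green h) \<le> L2_norm (\<lambda>x. of_real (L2_norm h) * g x)"
      by (intro L2_norm_mono L2_scale g_L2)
    also have "\<dots> = L2_norm g * L2_norm h"
      unfolding L2_norm_scale norm_of_real by (simp add: L2_norm_nonneg mult.commute)
    finally show ?thesis .
  qed
  then show ?thesis by (intro exI ballI)
qed

lemma in_resolvent_set: "z \<in> resolvent_set (dom_H_omega p q x0 \<alpha> \<omega>) (H_expr p q)"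
  unfolding resolvent_set_def
proof (intro CollectI conjI ballI)
  fix h assume h: "h \<in> L2"
  show "\<exists>u\<in>dom_H_omega p q x0 \<alpha> \<omega>. L2_eq (\<lambda>x. H_expr p q u x - z * u x) h \<and>
      (\<forall>v\<in>dom_H_omega p q x0 \<alpha> \<omega>. L2_eq (\<lambda>x. H_expr p q v x - z * v x) h \<longrightarrow> L2_eq v u)"
    by (intro bexI[OF _ green_in_domain[OF h]] conjI[OF green_equation[OF h]] ballI impI
        L2_eq_half_line[OF green_unique[OF h]])
next
  obtain C where C: "\<forall>h\<in>L2. L2_norm (green h) \<le> C * L2_norm h"
    using green_bound by (elim exE)
  show "\<exists>C. \<forall>u\<in>dom_H_omega p q x0 \<alpha> \<omega>. L2_norm u \<le> C * L2_norm (\<lambda>x. H_expr p q u x - z * u x)"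
  proof (intro exI ballI)
    fix u assume u: "u \<in> dom_H_omega p q x0 \<alpha> \<omega>"
    define h where "h = (\<lambda>x. H_expr p q u x - z * u x)"
    have h: "h \<in> L2"
      unfolding h_def using u by (intro L2_diff L2_scale) (auto simp: dom_H_omega_def dom_H_max_def)
    have "L2_eq (\<lambda>x. H_expr p q u x - z * u x) h"
      by (rule L2_eq_half_line) (simp add: h_def)
    then have eq: "u x = green h x" if "0 < x" for x
      using that by (rule green_unique[OF h u])
    have "green h \<in> L2" using green_in_domain[OF h] by (simp add: dom_H_omega_def dom_H_max_def)
    then have "L2_norm u \<le> L2_norm (green h)"
      by (rule L2_norm_mono) (simp add: eq)
    also have "\<dots> \<le> C * L2_norm h" using C h by (rule bspec)
    finally show "L2_norm u \<le> C * L2_norm (\<lambda>x. H_expr p q u x - z * u x)"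
      unfolding h_def .
  qed
qed

lemma resolvent_formula:
  assumes h: "h \<in> L2"
  shows "L2_eq (resolvent (dom_H_omega p q x0 \<alpha> \<omega>) (H_expr p q) z h)
    (\<lambda>x. \<gamma> * moment \<phi> h * \<phi> x + quasiresolvent \<phi> \<theta> h x)"
proof (rule L2_eq_half_line)
  fix x :: real assume x: "0 < x"
  define R where "R = resolvent (dom_H_omega p q x0 \<alpha> \<omega>) (H_expr p q) z h"
  have "R \<in> dom_H_omega p q x0 \<alpha> \<omega> \<and> L2_eq (\<lambda>x. H_expr p q R x - z * R x) h"
    unfolding R_def resolvent_def
    by (rule someI[of _ "green h"]) (intro conjI green_in_domain[OF h] green_equation[OF h])
  then have "R x = green h x"
    using x by (intro green_unique[OF h]) simp_all
  then show "resolvent (dom_H_omega p q x0 \<alpha> \<omega>) (H_expr p q) z h x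
      = \<gamma> * moment \<phi> h * \<phi> x + quasiresolvent \<phi> \<theta> h x"
    unfolding R_def by (simp only: green_formula[OF h x])
qed

end

context sturm_liouville
begin

text \<open>
  Both functions solve the same equation with the same initial values, hence have the same
  Wronskians with \<open>\<phi>\<close> and \<open>\<theta>\<close>, and Cramer's rule applies.
\<close>

lemma regular_phi_cnj:
  assumes phi: "regular_phi p q \<alpha> z \<phi>" and phi': "regular_phi p q \<alpha> (cnj z) \<psi>"
    and theta: "regular_theta p q \<alpha> z \<theta>" and x: "0 < x"
  shows "cnj (\<psi> x) = \<phi> x"
proof -
  have p0: "p 0 \<noteq> 0" using p_pos[of 0] by simp
  note phi = phi[unfolded regular_phi_iff] and phi' = phi'[unfolded regular_phi_iff]
    and theta = theta[unfolded regular_theta_iff]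
  have s: "is_solution p q z (\<lambda>x. cnj (\<psi> x))"
    using solution_cnj[OF conjunct1[OF phi']] by simp
  have i: "initial_values (\<lambda>x. cnj (\<psi> x)) (of_real (fst (phi_init \<alpha>))) (of_real (snd (phi_init \<alpha>)))"
    using initial_values_cnj[OF conjunct1[OF phi'] conjunct2[OF phi']] by simp
  have W1: "wronskian p \<phi> \<theta> x = - 1"
    using wronskian_solutions_constant[OF conjunct1[OF phi] conjunct1[OF theta] conjunct2[OF phi] conjunct2[OF theta] x]
    by (simp only: init_determinant[OF p0])
  have W2: "wronskian p (\<lambda>x. cnj (\<psi> x)) \<theta> x = - 1"
    using wronskian_solutions_constant[OF s conjunct1[OF theta] i conjunct2[OF theta] x]
    by (simp only: init_determinant[OF p0])
  have W3: "wronskian p (\<lambda>x. cnj (\<psi> x)) \<phi> x = 0"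
    using wronskian_solutions_constant[OF s conjunct1[OF phi] i conjunct2[OF phi] x] by simp
  show ?thesis
    using wronskian_Cramer(1)[OF W1, of "\<lambda>x. cnj (\<psi> x)"] unfolding W2 W3 by simp
qed

end

theorem theorem4p5:
  fixes p q :: "real \<Rightarrow> real" and x0 :: real and \<alpha> :: boundary and \<omega> z :: complex
    and \<phi> \<theta> f :: "complex \<Rightarrow> real \<Rightarrow> complex"
    and \<sigma>\<^sub>p \<sigma>\<^sub>m \<tau>\<^sub>p \<tau>\<^sub>m :: "complex \<Rightarrow> complex"
    and h :: "real \<Rightarrow> complex"
  assumes standing: "standing_assumptions p q x0"
    and amp_L2: "set_integrable lebesgue {x0<..} (\<lambda>x. (amp p q x)\<^sup>2)"
    and amp_L1: "set_integrable lebesgue {x0<..}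
                   (\<lambda>x. amp p q x * deriv (\<lambda>y. p y * deriv (amp p q) y) x)"
    and amp_lim: "((\<lambda>x. p x * deriv (amp p q) x * amp p q x) \<longlongrightarrow> 0) at_top"
    and phi: "\<And>\<zeta>. regular_phi p q \<alpha> \<zeta> (\<phi> \<zeta>)"
    and theta: "\<And>\<zeta>. regular_theta p q \<alpha> \<zeta> (\<theta> \<zeta>)"
    and jost: "\<And>\<zeta>. jost_solution p q x0 \<zeta> (f \<zeta>)"
    and sigma: "\<And>\<zeta> x. x > 0 \<Longrightarrow> \<phi> \<zeta> x = \<sigma>\<^sub>p \<zeta> * f \<zeta> x + \<sigma>\<^sub>m \<zeta> * cnj (f (cnj \<zeta>) x)"
    and tau: "\<And>\<zeta> x. x > 0 \<Longrightarrow> \<theta> \<zeta> x = \<tau>\<^sub>p \<zeta> * f \<zeta> x + \<tau>\<^sub>m \<zeta> * cnj (f (cnj \<zeta>) x)"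
    and omega: "cmod \<omega> = 1"
    and z: "Im z \<noteq> 0"
    and h: "h \<in> L2"
  shows "z \<in> resolvent_set (dom_H_omega p q x0 \<alpha> \<omega>) (H_expr p q) \<and>
         L2_eq (resolvent (dom_H_omega p q x0 \<alpha> \<omega>) (H_expr p q) z h)
           (\<lambda>x. - ((\<tau>\<^sub>p z - \<omega> * \<tau>\<^sub>m z) / (\<sigma>\<^sub>p z - \<omega> * \<sigma>\<^sub>m z))
                  * L2_inner h (\<phi> (cnj z)) * \<phi> z x
                + quasiresolvent (\<phi> z) (\<theta> z) h x)"
proof -
  interpret quasiclassical p q x0
  proof
    show "p C1_differentiable_on {0<..}" "(p \<longlongrightarrow> p 0) (at_right 0)" "continuous_on {0<..} q" "0 < x0"
      using standing by (simp_all add: standing_assumptions_def)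
    show "0 < p x" if "0 \<le> x" for x using standing that by (simp add: standing_assumptions_def)
    show "0 < q x" if "x0 \<le> x" for x using standing that by (simp add: standing_assumptions_def)
    show "\<exists>a'. \<forall>x\<ge>x0. (amp p q has_real_derivative a' x) (at x within {x0..})"
      using standing unfolding standing_assumptions_def by (elim conjE exE) (rule exI)
  qed (fact amp_L2 amp_lim)+
  have phi_asym: "has_asymptotics p q x0 (\<phi> z) (\<sigma>\<^sub>p z, \<sigma>\<^sub>m z)"
    by (rule solution_asymptotics(1)[OF jost[of z] jost[of "cnj z"]]) (rule sigma)
  have phi_asym': "((\<lambda>x. vderiv (\<phi> z) x / of_real (\<xi> x * a x)
      - \<i> * (\<sigma>\<^sub>p z * cis (\<Xi> x) - \<sigma>\<^sub>m z * cis (- \<Xi> x))) \<longlongrightarrow> 0) at_top"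
    by (rule solution_asymptotics(2)[OF jost[of z] jost[of "cnj z"]]) (rule sigma)
  have theta_asym: "has_asymptotics p q x0 (\<theta> z) (\<tau>\<^sub>p z, \<tau>\<^sub>m z)"
    by (rule solution_asymptotics(1)[OF jost[of z] jost[of "cnj z"]]) (rule tau)
  have conj: "cnj (\<phi> (cnj z) x) = \<phi> z x" if "0 < x" for x
    by (rule regular_phi_cnj[OF phi phi theta that])
  have p0: "p 0 \<noteq> 0" using p_pos[of 0] by simp
  have phi_sol: "is_solution p q z (\<phi> z)"
    and phi_init: "initial_values (\<phi> z) (of_real (fst (phi_init \<alpha>))) (of_real (snd (phi_init \<alpha>)))"
    using phi[of z] unfolding regular_phi_iff by simp_all
  have theta_sol: "is_solution p q z (\<theta> z)"
    and theta_init: "initial_values (\<theta> z) (of_real (fst (theta_init (p 0) \<alpha>))) (of_real (snd (theta_init (p 0) \<alpha>)))"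
    using theta[of z] unfolding regular_theta_iff by simp_all
  have W: "wronskian p (\<phi> z) (\<theta> z) x = - 1" if "0 < x" for x
    using wronskian_solutions_constant[OF phi_sol theta_sol phi_init theta_init that]
    by (simp only: init_determinant[OF p0])
  have "\<exists>x>0. \<phi> z x \<noteq> 0"
  proof (rule ccontr)
    assume "\<not> (\<exists>x>0. \<phi> z x \<noteq> 0)"
    then have zero: "\<And>x. 0 < x \<Longrightarrow> \<phi> z x = 0" by simp
    have "(\<phi> z has_vector_derivative 0) (at 1)"
      by (rule has_vector_derivative_transform_within_open[of "\<lambda>x. 0" 0 1 "{0<..}"])
         (use zero in auto)
    then have "vderiv (\<phi> z) 1 = 0" by (rule vector_derivative_at)
    then show False using W[of 1] zero[of 1] by (simp add: wronskian_def)
  qed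
  then obtain x1 where x1: "0 < x1" "\<phi> z x1 \<noteq> 0" by (elim exE conjE)
  have "cmod (\<sigma>\<^sub>p z) \<noteq> cmod (\<sigma>\<^sub>m z)"
    by (rule coefficients_nondegenerate[OF z phi_sol phi_init phi_asym phi_asym' x1])
  then have nondeg: "\<sigma>\<^sub>p z - \<omega> * \<sigma>\<^sub>m z \<noteq> 0"
    using omega by (auto simp: norm_mult)
  interpret resolvent_setup p q x0 \<alpha> \<omega> z "\<sigma>\<^sub>p z" "\<sigma>\<^sub>m z" "\<tau>\<^sub>p z" "\<tau>\<^sub>m z" "\<phi> z" "\<theta> z"
    by unfold_locales
      (fact phi theta phi_asym theta_asym nondeg)+
  have "L2_inner h (\<phi> (cnj z)) = (LINT x:{0<..}|lebesgue. h x * cnj (\<phi> (cnj z) x))"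
    unfolding L2_inner_def by (rule integral_half_line)
  also have "\<dots> = moment (\<phi> z) h"
    unfolding moment_def set_lebesgue_integral_def
    by (rule Bochner_Integration.integral_cong)
       (auto simp: indicator_def conj mult.commute)
  finally have inner: "L2_inner h (\<phi> (cnj z)) = moment (\<phi> z) h" .
  show ?thesis
    unfolding inner using in_resolvent_set resolvent_formula[OF h] unfolding \<gamma>_def by (rule conjI)
qed

end
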